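(* Let $\mu\leq_c\nu$ be irreducible with domain $(I,J)$. Let $f:\mathbb{R}\to[0,\infty]$ be Borel and let $(\varphi,\psi)\in\widetilde{\mathcal{D}}_{\mu,\nu}(f)$. Denoting the canonical process on $\hat\Omega$ by $(X,A)$, define the $\hat{\mathbb{F}}$-adapted process $h = (h_t)_{t\in[0,T]}$ on $\hat\Omega$ by $$h_0 = \varphi'(X_0)(1-A_0) - \psi'(X_0)A_0,\qquad h_t = -\varphi'(X_0) - \psi'(X_t),\quad t \in (0,T],$$ where $\varphi'$ is any superderivative of $\varphi$, $\psi'$ is any subderivative of $\psi$, and $\varphi'=\psi'=0$ on $\mathbb{R}\setminus I$. Set $H = (h,A)$. Then $(\varphi,\psi, H) \in \mathcal{D}_{\mu,\nu}(f,\mathcal{A})$ for any nonempty set $\mathcal{A}$ of averaging processes.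
   Context: **Path space.** Fix $T>0$. $\Omega=D([0,T];\mathbb{R})$ is the space of real càdlàg paths with the Skorokhod topology and Borel $\sigma$-algebra $\mathcal{F}$; $X=(X_t)$ is the canonical process and $\mathbb{F}=(\mathcal{F}_t)$ its raw filtration. For a process $Y$ set $Y_{0-}=0$, so $\Delta Y_0=Y_0$. **Measures.** All measures on $\mathbb{R}$ are finite with finite first moment; $\mu(\varphi)$ denotes $\int\varphi\,d\mu$. $\mu\leq_c\nu$ (convex order) means $\mu(\varphi)\le\nu(\varphi)$ for all convex $\varphi:\mathbb{R}\to\mathbb{R}$. The potential function is $u_\mu(x)=\int|x-y|\,\mu(dy)$. A pair $\mu\leq_c\nu$ is irreducible if $I=\{u_\mu<u_\nu\}$ is connected and $\mu(I)=\mu(\mathbb{R})$; $J$ is the union of $I$ and any endpoints of $I$ that are atoms of $\nu$; $(I,J)$ is the domain. $\mathcal{M}(\mu,\nu)$ is the set of finite measures $P$ on $\Omega$ with $P\circ X_0^{-1}=\mu$, $P\circ X_T^{-1}=\nu$ under which $X$ is an $\mathbb{F}$-martingale; $E^P[\cdot]$ is the integral with respect to $P$. **Generalized integral.** Let $\mu\leq_c\theta_1\leq_c\theta_2\leq_c\nu$. For concave $\chi:J\to\mathbb{R}$ let $-\chi''$ be the second derivative measure of $-\chi$ on $I$, $\Delta\chi$ the possible jumps of $\chi$ at endpoints of $I$ belonging to $J$, and $$(\theta_1-\theta_2)(\chi)=\tfrac12\int_I(u_{\theta_1}-u_{\theta_2})\,d\chi''+\int_{J\setminus I}|\Delta\chi|\,d(\theta_2-\theta_1)\in[0,\infty].$$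 For Borel $\varphi,\psi:J\to\overline{\mathbb{R}}$, a concave $\chi:J\to\mathbb{R}$ is a concave moderator for $(\varphi,\psi)$ w.r.t. $\theta_1\leq_c\theta_2$ if $\varphi-\chi\in L^1(\theta_1)$ and $\psi+\chi\in L^1(\theta_2)$; then $\theta_1(\varphi)+\theta_2(\psi):=\theta_1(\varphi-\chi)+\theta_2(\psi+\chi)+(\theta_1-\theta_2)(\chi)\in(-\infty,\infty]$ (independent of the choice of $\chi$). $L^c(\theta_1,\theta_2)$ is the set of pairs $(\varphi,\psi)$ admitting a concave moderator with $(\theta_1-\theta_2)(\chi)<\infty$. The expression $\mu(\varphi)+\nu(\psi)$ is understood in this sense. **Auxiliary dual space.** $\widetilde{\mathcal{D}}_{\mu,\nu}(f)$ is the set of $(\varphi,\psi)\in L^c(\mu,\nu)$ with $\varphi:J\to\overline{\mathbb{R}}$ concave, $\psi:J\to\overline{\mathbb{R}}$ convex and $\varphi+\psi\ge f$ on $J$ (when $f>-\infty$ on $J$, such $\varphi,\psi$ are real-valued on $J$). A subderivative of a convex $\psi:J\to\mathbb{R}$ is a Borel function $\psi':I\to\mathbb{R}$ with $\psi(x)-\psi(x_0)\ge\psi'(x_0)(x-x_0)$ for all $x_0\in I$, $x\in J$. A superderivative of a concave $\varphi:J\to\mathbb{R}$ is a Borel $\varphi':I\to\mathbb{R}$ such that $-\varphi'$ is a subderivative of $-\varphi$. **Averaging processes.** An averaging process is a nonnegative $\mathbb{F}$-adapted nondecreasing càdlàg process $A$ on $\Omega$ with $A_T(\omega)=1$ for all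 $\omega\in\Omega$. Integrals over $[0,T]$ against $dA$ include the jump $A_0$ at time $0$. **Relevant paths.** $\Omega_{\mu,\nu}$ is the set of $\omega\in\Omega$ such that $\omega_0\in I$; $\omega_t\in J$ for all $t\in(0,T]$; if $\omega_{t-}\in\partial J$ for some $t\in(0,T]$ then $\omega_u=\omega_{t-}$ for all $u\in[t,T]$; and if $\omega_t\in\partial J$ then $\omega_u=\omega_t$ for all $u\in[t,T]$. **Pathwise integral.** For $\Omega'\subset\Omega$, $L(\Omega')$ is the set of pairs $H=(h,Y)$ with $h$ an $\mathbb{F}$-adapted process and $Y$ an $\mathbb{F}$-adapted càdlàg finite variation process such that $((X_T-X_t)h_t)_t$ is $dY$-integrable on $(0,T]$ for each path in $\Omega'$. For such $H$, on $\Omega'$, $H\diamond X_T:=(X_T-X_0)h_0+\int_{(0,T]}(X_T-X_t)h_t\,dY_t$. **Superhedges.** $\hat\Omega$ is the product of $\Omega$ and the set of nonnegative nondecreasing càdlàg $a:[0,T]\to[0,1]$ with $a(T)=1$, with the subspace Skorokhod topology of $D([0,T];\mathbb{R}\times[0,1])$; $\hat{\mathbb{F}}$ is the raw filtration of its canonical process. For a process $Z$ on $\hat\Omega$ and an averaging process $A$ on $\Omega$, $Z^A_t(\omega)=Z_t(\omega,A(\omega))$. A semi-static trading strategy is a triplet $(\varphi,\psi,H)$ with $(\varphi,\psi)\in L^c(\mu,\nu)$ and $H=(h,Y)$ a pair of $\hat{\mathbb{F}}$-adapted processes on $\hat\Omega$ with $H^A:=(h^A,Y^A)\in L(\Omega_{\mu,\nu})$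 for every averaging process $A$. It is a semi-static superhedge for $f$ and $\mathcal{A}$, written $(\varphi,\psi,H)\in\mathcal{D}_{\mu,\nu}(f,\mathcal{A})$, if for every $A\in\mathcal{A}$: $f(\int_{[0,T]}X_t\,dA_t)\le\varphi(X_0)+\psi(X_T)+H^A\diamond X_T$ on $\Omega_{\mu,\nu}$, and $E^P[\varphi(X_0)+\psi(X_T)+H^A\diamond X_T]\le\mu(\varphi)+\nu(\psi)$ for all $P\in\mathcal{M}(\mu,\nu)$. *)

theory Defs
  imports "HOL-Probability.Probability"
begin

section \<open>Path space\<close>

text \<open>Functions on \<open>[0,T]\<close> are represented by total functions that are \<^const>\<open>undefined\<close>
  off \<open>[0,T]\<close>. A process is a map from outcomes to functions of time; \<open>\<lambda>\<omega>. \<omega>\<close> is the canonical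
  process on the path space.\<close>

type_synonym path = "real \<Rightarrow> real"

definition cadlag_on :: "real \<Rightarrow> (real \<Rightarrow> 'a::topological_space) \<Rightarrow> bool" where
  "cadlag_on T w \<longleftrightarrow>
     (\<forall>t\<in>{0..<T}. (w \<longlongrightarrow> w t) (at_right t)) \<and> (\<forall>t\<in>{0<..T}. \<exists>l. (w \<longlongrightarrow> l) (at_left t))"

definition cadlag_paths :: "real \<Rightarrow> (real \<Rightarrow> 'a::topological_space) set" where
  "cadlag_paths T = {w \<in> extensional {0..T}. cadlag_on T w}"

definition time_changes :: "real \<Rightarrow> (real \<Rightarrow> real) set" where
  "time_changes T = {l. strict_mono_on {0..T} l \<and> bij_betw l {0..T} {0..T}}"

text \<open>Open balls of the metric
  \<open>inf\<^sub>l max (sup\<^sub>t \<bar>l t - t\<bar>) (sup\<^sub>t dist (v (l t)) (w t))\<close>, \<open>l\<close> ranging over the time changes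
  (the \<open>J\<^sub>1\<close> topology).\<close>

definition skorokhod_ball :: "real \<Rightarrow> (real \<Rightarrow> 'a::metric_space) \<Rightarrow> real \<Rightarrow> (real \<Rightarrow> 'a) set" where
  "skorokhod_ball T w e = {v \<in> cadlag_paths T. \<exists>r<e. \<exists>l\<in>time_changes T.
     \<forall>t\<in>{0..T}. \<bar>l t - t\<bar> \<le> r \<and> dist (v (l t)) (w t) \<le> r}"

definition skorokhod_topology :: "real \<Rightarrow> (real \<Rightarrow> 'a::metric_space) topology" where
  "skorokhod_topology T = topology (\<lambda>U. U \<subseteq> cadlag_paths T \<and>
     (\<forall>w\<in>U. \<exists>e>0. skorokhod_ball T w e \<subseteq> U))"

lemma openin_skorokhod_topology:
  "openin (skorokhod_topology T) U \<longleftrightarrow>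
     U \<subseteq> cadlag_paths T \<and> (\<forall>w\<in>U. \<exists>e>0. skorokhod_ball T w e \<subseteq> U)"
proof -
  have mono: "skorokhod_ball T w d \<subseteq> skorokhod_ball T w e" if "d \<le> e"
    for d e :: real and w :: "real \<Rightarrow> 'a"
    using that unfolding skorokhod_ball_def by (blast intro: less_le_trans)
  have "istopology (\<lambda>U :: (real \<Rightarrow> 'a) set. U \<subseteq> cadlag_paths T \<and>
     (\<forall>w\<in>U. \<exists>e>0. skorokhod_ball T w e \<subseteq> U))"
    unfolding istopology_def
  proof (intro conjI allI impI ballI)
    fix S V :: "(real \<Rightarrow> 'a) set" and w
    assume S: "S \<subseteq> cadlag_paths T \<and> (\<forall>w\<in>S. \<exists>e>0. skorokhod_ball T w e \<subseteq> S)"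
      and V: "V \<subseteq> cadlag_paths T \<and> (\<forall>w\<in>V. \<exists>e>0. skorokhod_ball T w e \<subseteq> V)"
      and w: "w \<in> S \<inter> V"
    obtain d where d: "d > 0" "skorokhod_ball T w d \<subseteq> S" using S w by blast
    obtain e where e: "e > 0" "skorokhod_ball T w e \<subseteq> V" using V w by blast
    have "skorokhod_ball T w (min d e) \<subseteq> S \<inter> V"
      using d(2) e(2) mono[of "min d e" d w] mono[of "min d e" e w] by auto
    then show "\<exists>e>0. skorokhod_ball T w e \<subseteq> S \<inter> V"
      using d(1) e(1) by (intro exI[of _ "min d e"]) auto
  next
    fix K :: "(real \<Rightarrow> 'a) set set" and w
    assume K: "\<forall>S\<in>K. S \<subseteq> cadlag_paths T \<and> (\<forall>w\<in>S. \<exists>e>0. skorokhod_ball T w e \<subseteq> S)"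
      and w: "w \<in> \<Union>K"
    then obtain S where S: "S \<in> K" "w \<in> S" by blast
    with K obtain e where "e > 0" "skorokhod_ball T w e \<subseteq> S" by blast
    with S show "\<exists>e>0. skorokhod_ball T w e \<subseteq> \<Union>K" by blast
  qed blast+
  from topology_inverse'[OF this] show ?thesis
    by (simp add: skorokhod_topology_def)
qed

definition path_borel :: "real \<Rightarrow> path measure" where
  "path_borel T = sigma (cadlag_paths T) {U. openin (skorokhod_topology T) U}"

definition raw_filtration ::
    "'w set \<Rightarrow> ('w \<Rightarrow> real \<Rightarrow> 'b::topological_space) \<Rightarrow> real \<Rightarrow> 'w measure" where
  "raw_filtration S Z t = sigma S {(\<lambda>w. Z w s) -` B \<inter> S | s B. s \<in> {0..t} \<and> B \<in> sets borel}"

definition path_filtration :: "real \<Rightarrow> real \<Rightarrow> path measure" where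
  "path_filtration T = raw_filtration (cadlag_paths T) (\<lambda>\<omega>. \<omega>)"

definition adapted :: "real \<Rightarrow> (real \<Rightarrow> 'w measure) \<Rightarrow> ('w \<Rightarrow> real \<Rightarrow> real) \<Rightarrow> bool" where
  "adapted T F Z \<longleftrightarrow> (\<forall>t\<in>{0..T}. (\<lambda>w. Z w t) \<in> borel_measurable (F t))"

definition is_martingale ::
    "real \<Rightarrow> (real \<Rightarrow> 'w measure) \<Rightarrow> 'w measure \<Rightarrow> ('w \<Rightarrow> real \<Rightarrow> real) \<Rightarrow> bool" where
  "is_martingale T F P Z \<longleftrightarrow>
     adapted T F Z \<and>
     (\<forall>t\<in>{0..T}. subalgebra P (F t) \<and> integrable P (\<lambda>w. Z w t)) \<and>
     (\<forall>s t. 0 \<le> s \<longrightarrow> s \<le> t \<longrightarrow> t \<le> T \<longrightarrow>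
        (AE w in P. real_cond_exp P (F s) (\<lambda>w. Z w t) w = Z w s))"

definition martingale_measures :: "real \<Rightarrow> real measure \<Rightarrow> real measure \<Rightarrow> path measure set" where
  "martingale_measures T \<mu> \<nu> = {P. finite_measure P \<and> sets P = sets (path_borel T) \<and>
     distr P borel (\<lambda>\<omega>. \<omega> 0) = \<mu> \<and> distr P borel (\<lambda>\<omega>. \<omega> T) = \<nu> \<and>
     is_martingale T (path_filtration T) P (\<lambda>\<omega>. \<omega>)}"

section \<open>Convex order, irreducible pairs\<close>

definition admissible_measure :: "real measure \<Rightarrow> bool" where
  "admissible_measure \<mu> \<longleftrightarrow>
     finite_measure \<mu> \<and> sets \<mu> = sets borel \<and> integrable \<mu> (\<lambda>x. x)"

text \<open>Integral of an extended real function. If the positive and the negative part both have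
  infinite integral, the value is \<open>\<infinity>\<close>, as \<open>\<infinity> - \<infinity> = \<infinity>\<close> in \<^typ>\<open>ereal\<close>.\<close>

definition eintegral :: "'w measure \<Rightarrow> ('w \<Rightarrow> ereal) \<Rightarrow> ereal" where
  "eintegral M g =
     enn2ereal (\<integral>\<^sup>+w. e2ennreal (g w) \<partial>M) - enn2ereal (\<integral>\<^sup>+w. e2ennreal (- g w) \<partial>M)"

definition eintegrable :: "'w measure \<Rightarrow> ('w \<Rightarrow> ereal) \<Rightarrow> bool" where
  "eintegrable M g \<longleftrightarrow> g \<in> borel_measurable M \<and> (\<integral>\<^sup>+w. e2ennreal \<bar>g w\<bar> \<partial>M) < \<infinity>"

definition convex_order :: "real measure \<Rightarrow> real measure \<Rightarrow> bool" where
  "convex_order \<mu> \<nu> \<longleftrightarrow> (\<forall>g. convex_on UNIV g \<longrightarrow>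
     eintegral \<mu> (\<lambda>x. ereal (g x)) \<le> eintegral \<nu> (\<lambda>x. ereal (g x)))"

definition potential :: "real measure \<Rightarrow> real \<Rightarrow> real" where
  "potential \<mu> x = (LINT y|\<mu>. \<bar>x - y\<bar>)"

definition domain_I :: "real measure \<Rightarrow> real measure \<Rightarrow> real set" where
  "domain_I \<mu> \<nu> = {x. potential \<mu> x < potential \<nu> x}"

definition domain_J :: "real measure \<Rightarrow> real measure \<Rightarrow> real set" where
  "domain_J \<mu> \<nu> = domain_I \<mu> \<nu> \<union> {x \<in> frontier (domain_I \<mu> \<nu>). emeasure \<nu> {x} > 0}"

definition irreducible_pair :: "real measure \<Rightarrow> real measure \<Rightarrow> bool" where
  "irreducible_pair \<mu> \<nu> \<longleftrightarrow> convex_order \<mu> \<nu> \<and> connected (domain_I \<mu> \<nu>) \<and>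
     emeasure \<mu> (domain_I \<mu> \<nu>) = emeasure \<mu> UNIV"

section \<open>Generalized integral\<close>

text \<open>In this section \<open>I\<close> is an open interval and \<open>J\<close> adds some of its endpoints.\<close>

definition right_deriv :: "(real \<Rightarrow> real) \<Rightarrow> real \<Rightarrow> real" where
  "right_deriv g x = Lim (at_right x) (\<lambda>y. (g y - g x) / (y - x))"

text \<open>For \<open>g\<close> convex on \<open>I\<close>: the measure \<open>g''\<close> on \<open>I\<close>, which gives \<open>(a,b]\<close> the mass
  \<open>g'(b+) - g'(a+)\<close>. Unlike for \<^const>\<open>interval_measure\<close>, the distribution function may be
  unbounded at the endpoints of \<open>I\<close>.\<close>

definition second_deriv_measure :: "real set \<Rightarrow> (real \<Rightarrow> real) \<Rightarrow> real measure" where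
  "second_deriv_measure I g = extend_measure I {(a, b). a \<le> b \<and> {a..b} \<subseteq> I}
     (\<lambda>(a, b). {a<..b}) (\<lambda>(a, b). ennreal (right_deriv g b - right_deriv g a))"

definition boundary_jump :: "real set \<Rightarrow> (real \<Rightarrow> real) \<Rightarrow> real \<Rightarrow> real" where
  "boundary_jump I \<kappa> b = \<kappa> b - Lim (at b within I) \<kappa>"

text \<open>\<open>(\<theta>\<^sub>1 - \<theta>\<^sub>2)(\<kappa>)\<close> for concave \<open>\<kappa>\<close>. Both factors of
  \<open>(u\<^sub>\<theta>\<^sub>1 - u\<^sub>\<theta>\<^sub>2) d\<kappa>''\<close> are written with the opposite sign, which makes them nonnegative.\<close>

definition concave_difference ::
    "real set \<Rightarrow> real set \<Rightarrow> real measure \<Rightarrow> real measure \<Rightarrow> (real \<Rightarrow> real) \<Rightarrow> ereal" where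
  "concave_difference I J \<theta>1 \<theta>2 \<kappa> =
     ereal (1/2) * enn2ereal (\<integral>\<^sup>+x. ennreal (potential \<theta>2 x - potential \<theta>1 x)
                                \<partial>second_deriv_measure I (\<lambda>x. - \<kappa> x)) +
     ereal ((LINT b:(J - I)|\<theta>2. \<bar>boundary_jump I \<kappa> b\<bar>) - (LINT b:(J - I)|\<theta>1. \<bar>boundary_jump I \<kappa> b\<bar>))"

definition concave_moderator ::
    "real set \<Rightarrow> real measure \<Rightarrow> real measure \<Rightarrow> (real \<Rightarrow> ereal) \<Rightarrow> (real \<Rightarrow> ereal) \<Rightarrow>
     (real \<Rightarrow> real) \<Rightarrow> bool" where
  "concave_moderator J \<theta>1 \<theta>2 \<phi> \<psi> \<kappa> \<longleftrightarrow>
     \<phi> \<in> borel_measurable (restrict_space borel J) \<and>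
     \<psi> \<in> borel_measurable (restrict_space borel J) \<and>
     concave_on J \<kappa> \<and>
     eintegrable (restrict_space \<theta>1 J) (\<lambda>x. \<phi> x - ereal (\<kappa> x)) \<and>
     eintegrable (restrict_space \<theta>2 J) (\<lambda>x. \<psi> x + ereal (\<kappa> x))"

text \<open>\<open>\<theta>\<^sub>1(\<phi>) + \<theta>\<^sub>2(\<psi>)\<close>; the value does not depend on the moderator.\<close>

definition generalized_integral ::
    "real set \<Rightarrow> real set \<Rightarrow> real measure \<Rightarrow> real measure \<Rightarrow> (real \<Rightarrow> ereal) \<Rightarrow> (real \<Rightarrow> ereal) \<Rightarrow>
     ereal" where
  "generalized_integral I J \<theta>1 \<theta>2 \<phi> \<psi> =
     (let \<kappa> = (SOME \<kappa>. concave_moderator J \<theta>1 \<theta>2 \<phi> \<psi> \<kappa>) in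
        eintegral (restrict_space \<theta>1 J) (\<lambda>x. \<phi> x - ereal (\<kappa> x)) +
        eintegral (restrict_space \<theta>2 J) (\<lambda>x. \<psi> x + ereal (\<kappa> x)) +
        concave_difference I J \<theta>1 \<theta>2 \<kappa>)"

definition Lc ::
    "real set \<Rightarrow> real set \<Rightarrow> real measure \<Rightarrow> real measure \<Rightarrow> ((real \<Rightarrow> ereal) \<times> (real \<Rightarrow> ereal)) set" where
  "Lc I J \<theta>1 \<theta>2 = {(\<phi>, \<psi>). \<exists>\<kappa>. concave_moderator J \<theta>1 \<theta>2 \<phi> \<psi> \<kappa> \<and>
     concave_difference I J \<theta>1 \<theta>2 \<kappa> < \<infinity>}"

section \<open>Auxiliary dual space\<close>

definition econvex_on :: "real set \<Rightarrow> (real \<Rightarrow> ereal) \<Rightarrow> bool" where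
  "econvex_on S g \<longleftrightarrow> convex S \<and> convex {(x, r). x \<in> S \<and> g x \<le> ereal r}"

definition econcave_on :: "real set \<Rightarrow> (real \<Rightarrow> ereal) \<Rightarrow> bool" where
  "econcave_on S g \<longleftrightarrow> econvex_on S (\<lambda>x. - g x)"

definition dual_aux ::
    "real measure \<Rightarrow> real measure \<Rightarrow> (real \<Rightarrow> ereal) \<Rightarrow> ((real \<Rightarrow> ereal) \<times> (real \<Rightarrow> ereal)) set" where
  "dual_aux \<mu> \<nu> f = {(\<phi>, \<psi>).
     (\<phi>, \<psi>) \<in> Lc (domain_I \<mu> \<nu>) (domain_J \<mu> \<nu>) \<mu> \<nu> \<and>
     econcave_on (domain_J \<mu> \<nu>) \<phi> \<and> econvex_on (domain_J \<mu> \<nu>) \<psi> \<and>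
     (\<forall>x\<in>domain_J \<mu> \<nu>. f x \<le> \<phi> x + \<psi> x)}"

text \<open>Meant for functions that are finite on \<open>J\<close>.\<close>

definition subderivative :: "real set \<Rightarrow> real set \<Rightarrow> (real \<Rightarrow> ereal) \<Rightarrow> (real \<Rightarrow> real) \<Rightarrow> bool" where
  "subderivative I J g g' \<longleftrightarrow> g' \<in> borel_measurable (restrict_space borel I) \<and>
     (\<forall>x0\<in>I. \<forall>x\<in>J. g x - g x0 \<ge> ereal (g' x0 * (x - x0)))"

definition superderivative :: "real set \<Rightarrow> real set \<Rightarrow> (real \<Rightarrow> ereal) \<Rightarrow> (real \<Rightarrow> real) \<Rightarrow> bool" where
  "superderivative I J g g' \<longleftrightarrow> subderivative I J (\<lambda>x. - g x) (\<lambda>x. - g' x)"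

section \<open>Pathwise integrals and averaging processes\<close>

text \<open>For nonnegative, nondecreasing, right-continuous \<open>a\<close> on \<open>[0,T]\<close>: the measure \<open>da\<close> on
  \<open>[0,T]\<close> under the convention \<open>a(0-) = 0\<close>, so that \<open>{0}\<close> has mass \<open>a 0\<close>.\<close>

definition stieltjes_measure :: "real \<Rightarrow> (real \<Rightarrow> real) \<Rightarrow> real measure" where
  "stieltjes_measure T a = interval_measure (\<lambda>t. if t < 0 then 0 else a (min t T))"

definition variation_sums :: "(real \<Rightarrow> real) \<Rightarrow> real \<Rightarrow> real set" where
  "variation_sums y t = {(\<Sum>i<n. \<bar>y (s (Suc i)) - y (s i)\<bar>) | (n::nat) s.
     s 0 = 0 \<and> s n = t \<and> (\<forall>i<n. s i \<le> s (Suc i))}"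

definition finite_variation :: "real \<Rightarrow> (real \<Rightarrow> real) \<Rightarrow> bool" where
  "finite_variation T y \<longleftrightarrow> bdd_above (variation_sums y T)"

definition total_variation :: "(real \<Rightarrow> real) \<Rightarrow> real \<Rightarrow> real" where
  "total_variation y t = Sup (variation_sums y t)"

definition stieltjes_integrable :: "real \<Rightarrow> (real \<Rightarrow> real) \<Rightarrow> (real \<Rightarrow> real) \<Rightarrow> bool" where
  "stieltjes_integrable T y g \<longleftrightarrow>
     set_integrable (stieltjes_measure T (total_variation y)) {0<..T} g"

text \<open>\<open>\<integral>\<^bsub>(0,T]\<^esub> g dy\<close> via the Jordan decomposition \<open>y = y 0 + p - n\<close>,
  \<open>p = (\<bar>y\<bar> + y - y 0)/2\<close>, \<open>n = (\<bar>y\<bar> - y + y 0)/2\<close>, where \<open>\<bar>y\<bar>\<close> is the variation process.\<close>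

definition stieltjes_integral :: "real \<Rightarrow> (real \<Rightarrow> real) \<Rightarrow> (real \<Rightarrow> real) \<Rightarrow> real" where
  "stieltjes_integral T y g =
     (LINT t:{0<..T}|stieltjes_measure T (\<lambda>t. (total_variation y t + (y t - y 0)) / 2). g t) -
     (LINT t:{0<..T}|stieltjes_measure T (\<lambda>t. (total_variation y t - (y t - y 0)) / 2). g t)"

definition averaging_paths :: "real \<Rightarrow> path set" where
  "averaging_paths T =
     {a \<in> cadlag_paths T. (\<forall>t\<in>{0..T}. a t \<in> {0..1}) \<and> mono_on {0..T} a \<and> a T = 1}"

definition averaging_processes :: "real \<Rightarrow> (path \<Rightarrow> path) set" where
  "averaging_processes T =
     {A. (\<forall>\<omega>\<in>cadlag_paths T. A \<omega> \<in> averaging_paths T) \<and> adapted T (path_filtration T) A}"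

definition path_average :: "real \<Rightarrow> path \<Rightarrow> path \<Rightarrow> real" where
  "path_average T a \<omega> = (LINT t:{0..T}|stieltjes_measure T a. \<omega> t)"

definition relevant_paths :: "real \<Rightarrow> real set \<Rightarrow> real set \<Rightarrow> path set" where
  "relevant_paths T I J = {\<omega> \<in> cadlag_paths T.
     \<omega> 0 \<in> I \<and> (\<forall>t\<in>{0<..T}. \<omega> t \<in> J) \<and>
     (\<forall>t\<in>{0<..T}. Lim (at_left t) \<omega> \<in> frontier J \<longrightarrow> (\<forall>u\<in>{t..T}. \<omega> u = Lim (at_left t) \<omega>)) \<and>
     (\<forall>t\<in>{0..T}. \<omega> t \<in> frontier J \<longrightarrow> (\<forall>u\<in>{t..T}. \<omega> u = \<omega> t))}"

definition pathwise_integrands ::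
    "real \<Rightarrow> path set \<Rightarrow> ((path \<Rightarrow> real \<Rightarrow> real) \<times> (path \<Rightarrow> real \<Rightarrow> real)) set" where
  "pathwise_integrands T S = {(h, Y).
     adapted T (path_filtration T) h \<and> adapted T (path_filtration T) Y \<and>
     (\<forall>\<omega>\<in>cadlag_paths T. cadlag_on T (Y \<omega>) \<and> finite_variation T (Y \<omega>)) \<and>
     (\<forall>\<omega>\<in>S. stieltjes_integrable T (Y \<omega>) (\<lambda>t. (\<omega> T - \<omega> t) * h \<omega> t))}"

definition pathwise_gain ::
    "real \<Rightarrow> (path \<Rightarrow> real \<Rightarrow> real) \<times> (path \<Rightarrow> real \<Rightarrow> real) \<Rightarrow> path \<Rightarrow> real" where
  "pathwise_gain T H \<omega> = (case H of (h, Y) \<Rightarrow>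
     (\<omega> T - \<omega> 0) * h \<omega> 0 + stieltjes_integral T (Y \<omega>) (\<lambda>t. (\<omega> T - \<omega> t) * h \<omega> t))"

section \<open>Semi-static superhedges\<close>

definition hat_space :: "real \<Rightarrow> (path \<times> path) set" where
  "hat_space T = cadlag_paths T \<times> averaging_paths T"

definition hat_filtration :: "real \<Rightarrow> real \<Rightarrow> (path \<times> path) measure" where
  "hat_filtration T = raw_filtration (hat_space T) (\<lambda>(\<omega>, a) t. (\<omega> t, a t))"

definition along :: "(path \<times> path \<Rightarrow> real \<Rightarrow> real) \<Rightarrow> (path \<Rightarrow> path) \<Rightarrow> path \<Rightarrow> real \<Rightarrow> real" where
  "along Z A \<omega> = Z (\<omega>, A \<omega>)"

type_synonym strategy =
  "(real \<Rightarrow> ereal) \<times> (real \<Rightarrow> ereal) \<times>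
   ((path \<times> path \<Rightarrow> real \<Rightarrow> real) \<times> (path \<times> path \<Rightarrow> real \<Rightarrow> real))"

definition semistatic_strategies :: "real \<Rightarrow> real measure \<Rightarrow> real measure \<Rightarrow> strategy set" where
  "semistatic_strategies T \<mu> \<nu> = {(\<phi>, \<psi>, (h, Y)).
     (\<phi>, \<psi>) \<in> Lc (domain_I \<mu> \<nu>) (domain_J \<mu> \<nu>) \<mu> \<nu> \<and>
     adapted T (hat_filtration T) h \<and> adapted T (hat_filtration T) Y \<and>
     (\<forall>A\<in>averaging_processes T. (along h A, along Y A) \<in>
        pathwise_integrands T (relevant_paths T (domain_I \<mu> \<nu>) (domain_J \<mu> \<nu>)))}"

definition payoff :: "real \<Rightarrow> strategy \<Rightarrow> (path \<Rightarrow> path) \<Rightarrow> path \<Rightarrow> ereal" where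
  "payoff T S A \<omega> = (case S of (\<phi>, \<psi>, (h, Y)) \<Rightarrow>
     \<phi> (\<omega> 0) + \<psi> (\<omega> T) + ereal (pathwise_gain T (along h A, along Y A) \<omega>))"

text \<open>\<open>E\<^sup>P\<close> of the payoff, which is only meaningful on the relevant paths; these carry every
  \<open>P \<in> martingale_measures T \<mu> \<nu>\<close>. With the completion of \<open>P\<close>, measurability is required up to
  \<open>P\<close>-null sets.\<close>

definition superhedges ::
    "real \<Rightarrow> real measure \<Rightarrow> real measure \<Rightarrow> (real \<Rightarrow> ereal) \<Rightarrow> (path \<Rightarrow> path) set \<Rightarrow> strategy set" where
  "superhedges T \<mu> \<nu> f \<A> = {(\<phi>, \<psi>, H).
     (\<phi>, \<psi>, H) \<in> semistatic_strategies T \<mu> \<nu> \<and>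
     (\<forall>A\<in>\<A>.
        (\<forall>\<omega>\<in>relevant_paths T (domain_I \<mu> \<nu>) (domain_J \<mu> \<nu>).
           f (path_average T (A \<omega>) \<omega>) \<le> payoff T (\<phi>, \<psi>, H) A \<omega>) \<and>
        (\<forall>P\<in>martingale_measures T \<mu> \<nu>.
           let Z = (\<lambda>\<omega>. if \<omega> \<in> relevant_paths T (domain_I \<mu> \<nu>) (domain_J \<mu> \<nu>)
                        then payoff T (\<phi>, \<psi>, H) A \<omega> else 0)
           in Z \<in> borel_measurable (completion P) \<and>
              eintegral (completion P) Z
                \<le> generalized_integral (domain_I \<mu> \<nu>) (domain_J \<mu> \<nu>) \<mu> \<nu> \<phi> \<psi>))}"

end

theory Submission
  imports Defs
begin

text \<open>
  The pathwise inequality comes from tangents. Let \<open>a\<close> be the averaging path of \<open>\<omega>\<close> and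
  \<open>m = \<integral> \<omega>\<^sub>t da\<^sub>t\<close>. Collecting terms, the gain of the strategy is
  \<open>\<phi>'(\<omega>\<^sub>0) (m - \<omega>\<^sub>0) - \<integral> \<psi>'(\<omega>\<^sub>t) (\<omega>\<^sub>T - \<omega>\<^sub>t) da\<^sub>t\<close> (\<open>hedge_gain\<close>). The first summand lifts
  \<open>\<phi>(\<omega>\<^sub>0)\<close> above \<open>\<phi>(m)\<close>, as \<open>\<phi>\<close> is concave. For the second one, the tangent of \<open>\<psi>\<close> at \<open>\<omega>\<^sub>t\<close> lies
  below \<open>\<psi>(\<omega>\<^sub>T)\<close> at \<open>\<omega>\<^sub>T\<close>, and Jensen's inequality bounds \<open>\<psi>(m)\<close> by the average of the \<open>\<psi>(\<omega>\<^sub>t)\<close>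
  (\<open>psi_avg_le\<close>). So the payoff is at least \<open>\<phi>(m) + \<psi>(m) \<ge> f(m)\<close>. The integral exists on relevant
  paths because its integrand is bounded (\<open>integrand_bounded\<close>): \<open>\<psi>'\<close> can explode only at an endpoint
  \<open>l\<close> of \<open>I\<close>, a relevant path that approaches \<open>l\<close> ends in \<open>l\<close>, and \<open>\<psi>'(x) (l - x)\<close> is squeezed
  between two tangents.

  For the expectation, fix a martingale measure \<open>P\<close> and a concave moderator \<open>\<kappa>\<close> with
  \<open>(\<mu> - \<nu>)(\<kappa>) < \<infinity>\<close>; if that difference is infinite, nothing is to be shown. Almost every path is
  relevant (\<open>AE_relevant\<close>), since the distance to an endpoint of \<open>I\<close> is a nonnegative martingale, and
  such a martingale is absorbed at zero. Three further facts give the bound.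

  \<^item> The Bregman distance \<open>B(x, y) = \<kappa>(x) - \<kappa>(y) + \<kappa>'(x) (y - x)\<close> is the integral of an explicit
    kernel against \<open>-\<kappa>''\<close>, up to the boundary jumps, and the expectation of the kernel is half the
    gap between the potentials. Hence \<open>E B(X\<^sub>0, X\<^sub>T) \<le> (\<mu> - \<nu>)(\<kappa>)\<close> (\<open>bregman_expectation_le\<close>).

  \<^item> \<open>E \<integral> (X\<^sub>T - X\<^sub>t) \<eta>(X\<^sub>0, X\<^sub>t) dA\<^sub>t = 0\<close> for bounded Borel \<open>\<eta>\<close> (\<open>gap_orthogonal\<close>): for continuous
    \<open>\<eta>\<close> this is the limit of Riemann sums whose terms vanish by the martingale property.

  \<^item> If \<open>X\<^sub>0\<close> is restricted to a set where the data of the hedge are bounded, then \<open>\<psi>(X\<^sub>T)\<close> is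
    integrable, because \<open>\<psi> + \<kappa>\<close> is \<open>\<nu>\<close>-integrable and \<open>\<kappa>(X\<^sub>T)\<close> differs from \<open>- B(X\<^sub>0, X\<^sub>T)\<close> by
    integrable terms (\<open>tame_expectation\<close>). Truncating \<open>\<psi>'\<close> makes the expected gain vanish, and the
    truncated payoffs are bounded below by one integrable function, again by tangents
    (\<open>tame_payoff_le\<close>).

  Fatou's lemma removes the truncation, and a second time the restriction of \<open>X\<^sub>0\<close>: the payoff is
  nonnegative by the pathwise inequality, as \<open>f \<ge> 0\<close>. What remains is
  \<open>E[(\<phi> - \<kappa>)(X\<^sub>0) + (\<psi> + \<kappa>)(X\<^sub>T) + B(X\<^sub>0, X\<^sub>T)]\<close>, which is at most
  \<open>\<mu>(\<phi> - \<kappa>) + \<nu>(\<psi> + \<kappa>) + (\<mu> - \<nu>)(\<kappa>)\<close>.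

  All this uses that \<open>\<phi>\<close> and \<open>\<psi>\<close> are real-valued on \<open>J\<close> (\<open>dual_aux_finite\<close>), which irreducibility
  enforces.
\<close>

section \<open>Open intervals and their endpoints\<close>

lemma frontier_open_interval:
  fixes S :: "real set"
  assumes "open S" "connected S" "S \<noteq> {}" "b \<in> frontier S"
  shows "(\<forall>x\<in>S. x < b) \<or> (\<forall>x\<in>S. b < x)"
proof (rule ccontr)
  assume "\<not> ?thesis"
  then obtain x y where "x \<in> S" "b \<le> x" "y \<in> S" "y \<le> b" by (auto simp: not_less)
  then have "b \<in> S"
    using assms(2) connected_contains_Icc[of S y x] by auto
  then show False using assms by (simp add: frontier_def interior_open)
qed

lemma frontier_bounds:
  fixes S :: "real set"
  assumes "open S" "connected S" "S \<noteq> {}" "b \<in> frontier S"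
  shows "b = Sup S \<or> b = Inf S"
proof -
  have cl: "b \<in> closure S" using assms(4) by (simp add: frontier_def)
  from frontier_open_interval[OF assms] show ?thesis
  proof
    assume a: "\<forall>x\<in>S. x < b"
    then have "Sup S \<le> b" using assms(3) by (intro cSup_least) (simp_all add: less_imp_le)
    moreover have "bdd_above S" using a by (intro bdd_aboveI[of _ b]) (simp add: less_imp_le)
    then have "S \<subseteq> {..Sup S}" by (auto intro: cSup_upper)
    then have "b \<le> Sup S" using cl closure_minimal[of S "{..Sup S}"] by auto
    ultimately show ?thesis by simp
  next
    assume a: "\<forall>x\<in>S. b < x"
    then have "b \<le> Inf S" using assms(3) by (intro cInf_greatest) (simp_all add: less_imp_le)
    moreover have "bdd_below S" using a by (intro bdd_belowI[of _ b]) (simp add: less_imp_le)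
    then have "S \<subseteq> {Inf S..}" by (auto intro: cInf_lower)
    then have "Inf S \<le> b" using cl closure_minimal[of S "{Inf S..}"] by auto
    ultimately show ?thesis by simp
  qed
qed

lemma finite_frontier_open_interval:
  fixes S :: "real set"
  assumes "open S" "connected S"
  shows "finite (frontier S)"
proof (cases "S = {}")
  case False
  then have "frontier S \<subseteq> {Sup S, Inf S}" using frontier_bounds[OF assms] by auto
  then show ?thesis by (rule finite_subset) auto
qed auto

locale interval_domain =
  fixes I J :: "real set"
  assumes open_I: "open I" and connected_I: "connected I"
    and I_subset_J: "I \<subseteq> J" and J_subset_closure: "J \<subseteq> closure I"
begin

lemma mem_between: "x \<in> I \<Longrightarrow> y \<in> I \<Longrightarrow> x \<le> z \<Longrightarrow> z \<le> y \<Longrightarrow> z \<in> I"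
  using connected_contains_Icc[OF connected_I, of x y] by auto

lemma ball_in_I:
  assumes "x \<in> I"
  obtains e where "e > 0" "\<And>y. \<bar>y - x\<bar> < e \<Longrightarrow> y \<in> I"
  using open_I assms unfolding open_dist dist_real_def by blast

lemma J_diff_I: "J - I \<subseteq> frontier I"
  using J_subset_closure open_I by (auto simp: frontier_def interior_open)

lemma connected_J: "connected J"
  using connected_intermediate_closure[OF connected_I I_subset_J J_subset_closure] .

lemma convex_I: "convex I" and convex_J: "convex J"
  using connected_I connected_J by (auto simp: is_interval_convex_1[symmetric] is_interval_connected_1)

lemma finite_J_diff_I: "finite (J - I)"
  using J_diff_I finite_frontier_open_interval[OF open_I connected_I] by (rule finite_subset)

lemma borel_I [measurable]: "I \<in> sets borel"
  using open_I by auto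

lemma borel_J [measurable]: "J \<in> sets borel"
proof -
  have "J = I \<union> (J - I)" using I_subset_J by auto
  moreover have "J - I \<in> sets borel" using finite_J_diff_I by (simp add: borel_closed finite_imp_closed)
  ultimately show ?thesis using borel_I by (metis sets.Un)
qed

lemma frontier_J: "frontier J = frontier I"
proof -
  have "closure J = closure I"
    using I_subset_J J_subset_closure by (metis closure_closure closure_mono subset_antisym)
  moreover have "interior J = I"
  proof
    show "I \<subseteq> interior J" using open_I I_subset_J by (simp add: interior_maximal)
    have "interior J \<subseteq> interior (closure I)" using J_subset_closure by (rule interior_mono)
    also have "\<dots> = I" using convex_interior_closure[OF convex_I] open_I by (simp add: interior_open)
    finally show "interior J \<subseteq> I" .
  qed
  ultimately show ?thesis using open_I by (simp add: frontier_def interior_open)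
qed

lemma frontier_I_disjoint: "b \<in> frontier I \<Longrightarrow> b \<notin> I"
  using open_I by (simp add: frontier_def interior_open)

text \<open>A segment that ends outside the closure of \<open>I\<close> crosses the frontier of \<open>I\<close> before its end.\<close>

lemma mem_closure_I:
  assumes ne: "I \<noteq> {}"
    and up: "\<And>b. b \<in> frontier I \<Longrightarrow> \<forall>x\<in>I. x < b \<Longrightarrow> y \<le> b"
    and low: "\<And>b. b \<in> frontier I \<Longrightarrow> \<forall>x\<in>I. b < x \<Longrightarrow> b \<le> y"
  shows "y \<in> closure I"
proof (rule ccontr)
  assume y: "y \<notin> closure I"
  obtain x where x: "x \<in> I" using ne by auto
  define S where "S = closed_segment x y"
  have "connected S" "S \<inter> I \<noteq> {}" "S - I \<noteq> {}"
    using x y closure_subset by (auto simp: S_def)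
  then obtain b where b: "b \<in> S" "b \<in> frontier I"
    using connected_Int_frontier[of S I] by auto
  have "b \<noteq> y" using b y by (auto simp: frontier_def)
  moreover have "b \<noteq> x" using b x frontier_I_disjoint by auto
  ultimately show False
    using frontier_open_interval[OF open_I connected_I ne b(2)] up[OF b(2)] low[OF b(2)] b x
    by (auto simp: S_def closed_segment_eq_real_ivl split: if_splits)
qed

end

section \<open>The domain of an irreducible pair\<close>

lemma eintegral_ereal:
  assumes "integrable M g"
  shows "eintegral M (\<lambda>x. ereal (g x)) = ereal (LINT x|M. g x)"
proof -
  have fin: "(\<integral>\<^sup>+x. ennreal (g x) \<partial>M) < \<infinity>" "(\<integral>\<^sup>+x. ennreal (- g x) \<partial>M) < \<infinity>"
    using assms by (auto simp: real_integrable_def less_top)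
  then obtain a b where ab: "(\<integral>\<^sup>+x. ennreal (g x) \<partial>M) = ennreal a" "a \<ge> 0"
    "(\<integral>\<^sup>+x. ennreal (- g x) \<partial>M) = ennreal b" "b \<ge> 0"
    by (metis ennreal_cases infinity_ennreal_def less_irrefl)
  show ?thesis
    using ab by (simp add: eintegral_def real_lebesgue_integral_def[OF assms] e2ennreal_ereal)
qed

lemma admissible_measureD:
  assumes "admissible_measure \<theta>"
  shows "finite_measure \<theta>" "sets \<theta> = sets borel" "space \<theta> = UNIV" "integrable \<theta> (\<lambda>x. x)"
  using assms sets_eq_imp_space_eq[of \<theta> borel] unfolding admissible_measure_def by auto

lemma admissible_integrable:
  assumes "admissible_measure \<theta>"
  shows "integrable \<theta> (\<lambda>y. \<bar>x - y\<bar>)" "integrable \<theta> (\<lambda>y. c :: real)" "integrable \<theta> (\<lambda>y. y - x)"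
proof -
  interpret finite_measure \<theta> using admissible_measureD(1)[OF assms] .
  show "integrable \<theta> (\<lambda>y. \<bar>x - y\<bar>)" "integrable \<theta> (\<lambda>y. c)" "integrable \<theta> (\<lambda>y. y - x)"
    using admissible_measureD(4)[OF assms] by auto
qed

lemma continuous_potential:
  assumes "admissible_measure \<theta>"
  shows "continuous_on UNIV (potential \<theta>)"
proof -
  interpret finite_measure \<theta> using admissible_measureD(1)[OF assms] .
  have le: "potential \<theta> x \<le> potential \<theta> y + measure \<theta> (space \<theta>) * \<bar>x - y\<bar>" for x y
  proof -
    have "potential \<theta> x \<le> (LINT z|\<theta>. \<bar>y - z\<bar> + \<bar>x - y\<bar>)"
      unfolding potential_def
      by (intro integral_mono) (auto intro!: admissible_integrable[OF assms] Bochner_Integration.integrable_add)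
    also have "\<dots> = potential \<theta> y + measure \<theta> (space \<theta>) * \<bar>x - y\<bar>"
      unfolding potential_def by (simp add: admissible_integrable[OF assms])
    finally show ?thesis .
  qed
  have lip: "dist (potential \<theta> x) (potential \<theta> y) \<le> measure \<theta> (space \<theta>) * dist x y" for x y
    using le[of x y] le[of y x] by (auto simp: dist_real_def abs_minus_commute)
  show ?thesis
    by (rule lipschitz_on_continuous_on[of "measure \<theta> (space \<theta>)"])
      (auto simp: lipschitz_on_def intro: lip)
qed

lemma convex_order_integral_le:
  assumes "convex_order \<mu> \<nu>" "convex_on UNIV g" "integrable \<mu> g" "integrable \<nu> g"
  shows "(LINT x|\<mu>. g x) \<le> (LINT x|\<nu>. g x)"
  using assms eintegral_ereal[OF assms(3)] eintegral_ereal[OF assms(4)]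
  unfolding convex_order_def by (metis ereal_less_eq(3))

locale irreducible_measures =
  fixes \<mu> \<nu> :: "real measure"
  assumes adm_mu: "admissible_measure \<mu>" and adm_nu: "admissible_measure \<nu>"
    and irr: "irreducible_pair \<mu> \<nu>"
begin

abbreviation I :: "real set" where "I \<equiv> domain_I \<mu> \<nu>"
abbreviation J :: "real set" where "J \<equiv> domain_J \<mu> \<nu>"

lemma convex_order_mu_nu: "convex_order \<mu> \<nu>"
  using irr by (simp add: irreducible_pair_def)

lemma sets_mu: "sets \<mu> = sets borel" and sets_nu: "sets \<nu> = sets borel"
  using adm_mu adm_nu by (auto simp: admissible_measureD)

lemma space_mu: "space \<mu> = UNIV" and space_nu: "space \<nu> = UNIV"
  using adm_mu adm_nu by (auto simp: admissible_measureD)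

lemma open_domain_I: "open I"
  unfolding domain_I_def
  by (rule open_Collect_less) (use continuous_potential adm_mu adm_nu in auto)

lemma connected_domain_I: "connected I"
  using irr by (simp add: irreducible_pair_def)

lemma I_subset_domain_J: "I \<subseteq> J" and domain_J_subset_closure: "J \<subseteq> closure I"
  unfolding domain_J_def frontier_def using closure_subset by auto

sublocale interval_domain I J
  by unfold_locales (use open_domain_I connected_domain_I I_subset_domain_J domain_J_subset_closure in auto)

lemma AE_mu_I: "AE x in \<mu>. x \<in> I"
proof -
  interpret finite_measure \<mu> using admissible_measureD(1)[OF adm_mu] .
  have "emeasure \<mu> I = emeasure \<mu> (space \<mu>)"
    using irr by (simp add: irreducible_pair_def space_mu)
  then have "emeasure \<mu> (space \<mu> - I) = 0"
    using sets_mu emeasure_compl[of I \<mu>] by simp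
  then have "AE x in \<mu>. x \<notin> space \<mu> - I"
    using sets_mu borel_I by (intro AE_not_in) (auto simp: null_sets_def space_mu)
  then show ?thesis by (rule AE_mp) (auto simp: space_mu)
qed

lemma affine_integral_eq: "(LINT x|\<mu>. a * x + b) = (LINT x|\<nu>. a * x + b)"
proof (rule antisym)
  have conv: "convex_on UNIV (\<lambda>x. c * x + d)" for c d :: real
  proof (rule convex_onI)
    fix t x y :: real
    have "d = (1 - t) * d + t * d" by (simp add: algebra_simps)
    then show "c * ((1 - t) *\<^sub>R x + t *\<^sub>R y) + d \<le> (1 - t) * (c * x + d) + t * (c * y + d)"
      by (simp add: algebra_simps)
  qed simp
  interpret m: finite_measure \<mu> using admissible_measureD(1)[OF adm_mu] .
  interpret n: finite_measure \<nu> using admissible_measureD(1)[OF adm_nu] .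
  have int: "integrable \<mu> (\<lambda>x. c * x + d)" "integrable \<nu> (\<lambda>x. c * x + d)" for c d
    using admissible_measureD(4)[OF adm_mu] admissible_measureD(4)[OF adm_nu] by auto
  show "(LINT x|\<mu>. a * x + b) \<le> (LINT x|\<nu>. a * x + b)"
    by (intro convex_order_integral_le[OF convex_order_mu_nu] conv int)
  have "(LINT x|\<mu>. - a * x + - b) \<le> (LINT x|\<nu>. - a * x + - b)"
    by (intro convex_order_integral_le[OF convex_order_mu_nu] conv int)
  moreover have "(LINT x|\<theta>. - a * x + - b) = - (LINT x|\<theta>. a * x + b)" for \<theta> :: "real measure"
    by (subst Bochner_Integration.integral_minus[symmetric]) (simp add: algebra_simps)
  ultimately show "(LINT x|\<nu>. a * x + b) \<le> (LINT x|\<mu>. a * x + b)" by simp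
qed

text \<open>Seen from a point on one side of \<open>\<nu>\<close>, the potential of \<open>\<nu>\<close> is the integral of an affine
  function, and the two measures agree on affine functions.\<close>

lemma one_sided_notin_I:
  assumes "(AE y in \<nu>. x \<le> y) \<or> (AE y in \<nu>. y \<le> x)"
  shows "x \<notin> I"
proof -
  obtain a :: real where a: "\<bar>a\<bar> = 1" "AE y in \<nu>. \<bar>x - y\<bar> = a * (y - x)"
    using assms
  proof
    assume *: "AE y in \<nu>. x \<le> y"
    show thesis by (rule that[of 1]) (use * in \<open>auto elim!: AE_mp\<close>)
  next
    assume *: "AE y in \<nu>. y \<le> x"
    show thesis by (rule that[of "-1"]) (use * in \<open>auto elim!: AE_mp\<close>)
  qed
  interpret m: finite_measure \<mu> using admissible_measureD(1)[OF adm_mu] .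
  have "potential \<nu> x = (LINT y|\<nu>. a * y + - a * x)"
    unfolding potential_def
    by (rule integral_cong_AE) (use a(2) sets_nu in \<open>auto simp: algebra_simps\<close>)
  also have "\<dots> = (LINT y|\<mu>. a * y + - a * x)" by (rule affine_integral_eq[symmetric])
  also have "\<dots> \<le> potential \<mu> x"
    unfolding potential_def
  proof (rule integral_mono)
    show "integrable \<mu> (\<lambda>y. a * y + - a * x)" using admissible_measureD(4)[OF adm_mu] by auto
    show "integrable \<mu> (\<lambda>y. \<bar>x - y\<bar>)" by (rule admissible_integrable[OF adm_mu])
    show "a * y + - a * x \<le> \<bar>x - y\<bar>" for y
      using a(1) abs_ge_self[of "a * (y - x)"] unfolding abs_mult by (simp add: algebra_simps)
  qed
  finally show ?thesis by (simp add: domain_I_def)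
qed

text \<open>The point \<open>b\<close> is not in \<open>I\<close>, so the potential of \<open>\<nu>\<close> at \<open>b\<close> is at most that of \<open>\<mu>\<close>, which is the
  integral of \<open>a (y - b)\<close> since \<open>\<mu>\<close> lives on \<open>I\<close>. Both measures integrate this affine function alike,
  so \<open>\<bar>y - b\<bar>\<close> and \<open>a (y - b)\<close> have the same integral under \<open>\<nu>\<close>. The sign \<open>a\<close> covers both endpoints.\<close>

lemma AE_nu_beyond_frontier:
  assumes a: "\<bar>a\<bar> = 1" and b: "b \<in> frontier I" and side: "\<And>x. x \<in> I \<Longrightarrow> 0 \<le> a * (x - b)"
  shows "AE y in \<nu>. 0 \<le> a * (y - b)"
proof -
  interpret n: finite_measure \<nu> using admissible_measureD(1)[OF adm_nu] .
  have "potential \<nu> b \<le> potential \<mu> b"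
    using frontier_I_disjoint[OF b] by (simp add: domain_I_def)
  also have "\<dots> = (LINT y|\<mu>. a * y + - a * b)"
    unfolding potential_def
  proof (rule integral_cong_AE)
    show "AE y in \<mu>. \<bar>b - y\<bar> = a * y + - a * b"
      using AE_mu_I
    proof eventually_elim
      case (elim y)
      then have "\<bar>a * (y - b)\<bar> = a * (y - b)" using side by simp
      then show ?case using a unfolding abs_mult by (simp add: algebra_simps abs_minus_commute)
    qed
  qed (use sets_mu in auto)
  also have "\<dots> = (LINT y|\<nu>. a * y + - a * b)" by (rule affine_integral_eq)
  finally have le: "(LINT y|\<nu>. \<bar>b - y\<bar>) \<le> (LINT y|\<nu>. a * y + - a * b)"
    by (simp add: potential_def)
  have int: "integrable \<nu> (\<lambda>y. \<bar>b - y\<bar> - (a * y + - a * b))"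
    using admissible_measureD(4)[OF adm_nu] admissible_integrable[OF adm_nu] by auto
  have nn: "0 \<le> \<bar>b - y\<bar> - (a * y + - a * b)" for y
    using a abs_ge_self[of "a * (y - b)"] unfolding abs_mult by (simp add: algebra_simps abs_minus_commute)
  have "(LINT y|\<nu>. \<bar>b - y\<bar> - (a * y + - a * b)) = 0"
    using le nn Bochner_Integration.integral_nonneg[of \<nu> "\<lambda>y. \<bar>b - y\<bar> - (a * y + - a * b)"]
    by (subst Bochner_Integration.integral_diff)
      (use admissible_measureD(4)[OF adm_nu] admissible_integrable[OF adm_nu] in \<open>auto simp: Bochner_Integration.integral_diff\<close>)
  then have "AE y in \<nu>. \<bar>b - y\<bar> - (a * y + - a * b) = 0"
    using integral_nonneg_eq_0_iff_AE[OF int] nn by auto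
  then show ?thesis
  proof eventually_elim
    case (elim y)
    then have "a * (y - b) = \<bar>b - y\<bar>" by (simp add: algebra_simps)
    then show ?case by simp
  qed
qed

lemma total_mass_eq: "measure \<mu> UNIV = measure \<nu> UNIV"
  using affine_integral_eq[of 0 1] space_mu space_nu by simp

lemma AE_nu_closure:
  assumes "I \<noteq> {}"
  shows "AE y in \<nu>. y \<in> closure I"
proof -
  have "AE y in \<nu>. \<forall>b\<in>frontier I. (\<forall>x\<in>I. x < b) \<longrightarrow> y \<le> b"
  proof (rule AE_finite_allI[OF finite_frontier_open_interval[OF open_I connected_I]])
    fix b assume b: "b \<in> frontier I"
    show "AE y in \<nu>. (\<forall>x\<in>I. x < b) \<longrightarrow> y \<le> b"
    proof (cases "\<forall>x\<in>I. x < b")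
      case True
      have "AE y in \<nu>. 0 \<le> - 1 * (y - b)" using True b by (intro AE_nu_beyond_frontier) auto
      then show ?thesis by eventually_elim auto
    qed auto
  qed
  moreover have "AE y in \<nu>. \<forall>b\<in>frontier I. (\<forall>x\<in>I. b < x) \<longrightarrow> b \<le> y"
  proof (rule AE_finite_allI[OF finite_frontier_open_interval[OF open_I connected_I]])
    fix b assume b: "b \<in> frontier I"
    show "AE y in \<nu>. (\<forall>x\<in>I. b < x) \<longrightarrow> b \<le> y"
    proof (cases "\<forall>x\<in>I. b < x")
      case True
      have "AE y in \<nu>. 0 \<le> 1 * (y - b)" using True b by (intro AE_nu_beyond_frontier) auto
      then show ?thesis by eventually_elim auto
    qed auto
  qed
  ultimately show ?thesis
  proof eventually_elim
    case (elim y)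
    show ?case by (rule mem_closure_I[OF assms]) (use elim in auto)
  qed
qed

lemma AE_nu_J: "AE y in \<nu>. y \<in> J"
proof (cases "I = {}")
  case True
  interpret m: finite_measure \<mu> using admissible_measureD(1)[OF adm_mu] .
  interpret n: finite_measure \<nu> using admissible_measureD(1)[OF adm_nu] .
  have "measure \<mu> UNIV = 0"
    using irr True by (simp add: irreducible_pair_def measure_def)
  then have "emeasure \<nu> (space \<nu>) = 0"
    using total_mass_eq space_nu by (simp add: n.emeasure_eq_measure)
  then have "\<nu> = null_measure \<nu>"
    by (intro measure_eqI) (auto simp: emeasure_eq_0[OF sets.top] sets.sets_into_space)
  then show ?thesis by (metis AE_I' \<open>emeasure \<nu> (space \<nu>) = 0\<close> null_setsI sets.top Collect_subset space_nu subset_UNIV)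
next
  case False
  have fin: "finite (frontier I)" using finite_frontier_open_interval[OF open_I connected_I] .
  have "AE y in \<nu>. \<forall>b\<in>frontier I. y = b \<longrightarrow> b \<in> J"
  proof (rule AE_finite_allI[OF fin])
    fix b assume b: "b \<in> frontier I"
    show "AE y in \<nu>. y = b \<longrightarrow> b \<in> J"
    proof (cases "b \<in> J")
      case False
      then have "emeasure \<nu> {b} = 0" using b by (auto simp: domain_J_def zero_less_iff_neq_zero)
      then have "AE y in \<nu>. y \<notin> {b}" using sets_nu by (intro AE_not_in) (auto simp: null_sets_def)
      then show ?thesis by eventually_elim auto
    qed auto
  qed
  with AE_nu_closure[OF False] show ?thesis
  proof eventually_elim
    case (elim y)
    then show ?case using I_subset_J open_I by (auto simp: frontier_def interior_open)
  qed
qed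

end

section \<open>Second derivative measures of convex functions\<close>

text \<open>Over \<open>n\<close> equal steps the errors add up to \<open>(F v - F u) (v - u) / n\<close>, which tends to zero. This
  replaces the fundamental theorem of calculus for functions with one-sided derivatives.\<close>

lemma telescoping_increment_le:
  fixes D F :: "real \<Rightarrow> real"
  assumes "u \<le> v"
    and incr: "\<And>p q. u \<le> p \<Longrightarrow> p \<le> q \<Longrightarrow> q \<le> v \<Longrightarrow> D q - D p \<le> (F q - F p) * (q - p)"
  shows "D v \<le> D u"
proof -
  have bound: "D v - D u \<le> (F v - F u) * (v - u) / real n" if n: "n > 0" for n :: nat
  proof -
    define h where "h = (v - u) / real n"
    define t where "t i = u + real i * h" for i
    have t0: "t 0 = u" and tn: "t n = v" using n by (auto simp: t_def h_def)
    have step: "t (Suc i) - t i = h" for i by (simp add: t_def algebra_simps)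
    have nonneg: "0 \<le> h" using assms(1) by (simp add: h_def)
    have lo: "u \<le> t i" for i unfolding t_def using nonneg by (simp add: mult_nonneg_nonneg)
    have up: "t i \<le> v" if "i \<le> n" for i
    proof -
      have "real i * h \<le> real n * h"
        using that nonneg by (intro mult_right_mono) auto
      then show ?thesis using tn by (simp add: t_def)
    qed
    have "D v - D u = (\<Sum>i<n. D (t (Suc i)) - D (t i))"
      by (subst sum_lessThan_telescope) (simp add: t0 tn)
    also have "\<dots> \<le> (\<Sum>i<n. (F (t (Suc i)) - F (t i)) * h)"
    proof (rule sum_mono)
      fix i assume "i \<in> {..<n}"
      then show "D (t (Suc i)) - D (t i) \<le> (F (t (Suc i)) - F (t i)) * h"
        using incr[of "t i" "t (Suc i)"] lo[of i] up[of "Suc i"] step[of i] nonneg by auto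
    qed
    also have "\<dots> = (F v - F u) * h"
      by (subst sum_distrib_right[symmetric], subst sum_lessThan_telescope) (simp add: t0 tn)
    finally show ?thesis by (simp add: h_def)
  qed
  have "(\<lambda>n. (F v - F u) * (v - u) / real n) \<longlonglongrightarrow> 0"
    by (rule lim_const_over_n)
  then have "D v - D u \<le> 0"
    by (rule tendsto_lowerbound)
      (use bound in \<open>auto simp: eventually_sequentially intro!: exI[of _ 1]\<close>)
  then show ?thesis by simp
qed

locale convex_profile = interval_domain +
  fixes g :: "real \<Rightarrow> real"
  assumes convex_g: "convex_on J g"
begin

abbreviation "F \<equiv> right_deriv g"
abbreviation "M \<equiv> second_deriv_measure I g"

definition bregman :: "real \<Rightarrow> real \<Rightarrow> real" where
  "bregman x y = g y - g x - F x * (y - x)"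

text \<open>The difference quotients of a convex function decrease, as \<open>y\<close> decreases to \<open>x\<close>, to their infimum,
  and this infimum is the slope of a supporting line.\<close>

lemma right_deriv_supporting_line:
  assumes x: "x \<in> I"
  shows "((\<lambda>y. (g y - g x) / (y - x)) \<longlongrightarrow> F x) (at_right x)"
    and "\<And>y. y \<in> J \<Longrightarrow> g x + F x * (y - x) \<le> g y"
proof -
  define m where "m = Inf ((\<lambda>t. (g x - g t) / (x - t)) ` ({x<..} \<inter> J))"
  obtain e where e: "e > 0" "\<And>y. \<bar>y - x\<bar> < e \<Longrightarrow> y \<in> I" using ball_in_I[OF x] by blast
  have xJ: "x \<in> interior J"
    using x open_I I_subset_J interior_maximal by blast
  have sub: "g x + m * (y - x) \<le> g y" if "y \<in> J" for y
    unfolding m_def by (rule convex_le_Inf_differential[OF convex_g xJ that])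
  have flip: "(g x - g t) / (x - t) = (g t - g x) / (t - x)" for t
    by (metis minus_diff_eq minus_divide_divide)
  have ne: "{x<..} \<inter> J \<noteq> {}"
  proof -
    have "x + e/2 \<in> {x<..} \<inter> J" using e(1) e(2)[of "x + e/2"] I_subset_J by auto
    then show ?thesis by blast
  qed
  have ev: "\<forall>\<^sub>F y in at_right x. y \<in> I"
    unfolding eventually_at_right_field using e by (intro exI[of _ "x + e"]) auto
  have lim: "((\<lambda>y. (g y - g x) / (y - x)) \<longlongrightarrow> m) (at_right x)"
  proof (rule order_tendstoI)
    fix a assume a: "a < m"
    show "\<forall>\<^sub>F y in at_right x. a < (g y - g x) / (y - x)"
      using ev eventually_at_right_less[of x]
    proof eventually_elim
      case (elim y)
      then have "m \<le> (g y - g x) / (y - x)"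
        using sub[of y] I_subset_J by (auto simp: pos_le_divide_eq algebra_simps)
      with a show ?case by simp
    qed
  next
    fix a assume a: "m < a"
    then obtain t where t: "t \<in> J" "x < t" "(g x - g t) / (x - t) < a"
      using cInf_lessD[of "(\<lambda>t. (g x - g t) / (x - t)) ` ({x<..} \<inter> J)" a] ne
      unfolding m_def by auto
    have "\<forall>\<^sub>F y in at_right x. y < t"
      using t(2) by (auto simp: eventually_at_right_field)
    then show "\<forall>\<^sub>F y in at_right x. (g y - g x) / (y - x) < a"
      using eventually_at_right_less[of x]
    proof eventually_elim
      case (elim y)
      have "(g x - g y) / (x - y) \<le> (g x - g t) / (x - t)"
        by (rule convex_on_slope_le(1)[OF convex_g]) (use x I_subset_J t elim in auto)
      with t(3) show ?case by (simp add: flip)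
    qed
  qed
  have Fm: "F x = m"
    unfolding right_deriv_def by (rule tendsto_Lim[OF _ lim]) simp
  show "((\<lambda>y. (g y - g x) / (y - x)) \<longlongrightarrow> F x) (at_right x)"
    and "\<And>y. y \<in> J \<Longrightarrow> g x + F x * (y - x) \<le> g y"
    using lim sub by (auto simp: Fm)
qed

lemma bregman_nonneg: "x \<in> I \<Longrightarrow> y \<in> J \<Longrightarrow> 0 \<le> bregman x y"
  using right_deriv_supporting_line(2)[of x y] by (simp add: bregman_def)

lemma F_mono:
  assumes "x \<in> I" "y \<in> I" "x \<le> y"
  shows "F x \<le> F y"
proof (cases "x = y")
  case False
  have "x \<in> J" "y \<in> J" using assms I_subset_J by auto
  then have "F x * (y - x) \<le> F y * (y - x)"
    using right_deriv_supporting_line(2)[OF assms(1), of y] right_deriv_supporting_line(2)[OF assms(2), of x]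
    by (simp add: algebra_simps)
  then show ?thesis using False assms(3) by (simp add: mult_le_cancel_right)
qed simp

lemma F_measurable: "F \<in> borel_measurable (restrict_space borel I)"
  by (intro borel_measurable_mono_on_fnc) (auto simp: mono_on_def intro: F_mono)

lemma F_right_continuous:
  assumes x: "x \<in> I" and a: "F x < a"
  obtains z where "z \<in> I" "x < z" "F z < a"
proof -
  obtain e where e: "e > 0" "\<And>y. \<bar>y - x\<bar> < e \<Longrightarrow> y \<in> I" using ball_in_I[OF x] by blast
  have "\<forall>\<^sub>F y in at_right x. (g y - g x) / (y - x) < a"
    using right_deriv_supporting_line(1)[OF x] a by (rule order_tendstoD)
  moreover have "\<forall>\<^sub>F y in at_right x. x < y \<and> y < x + e"
    unfolding eventually_at_right_field using e by (intro exI[of _ "x + e"]) auto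
  ultimately obtain t where t: "(g t - g x) / (t - x) < a" "x < t" "t < x + e"
    using eventually_happens'[OF _ eventually_conj] by (smt (verit) trivial_limit_at_right_real)
  have tI: "t \<in> I" using e t by auto
  have "continuous_on I g"
    using convex_on_continuous[OF open_I] convex_on_subset[OF convex_g I_subset_J]
      connected_I is_interval_convex_1 is_interval_connected_1 by blast
  then have cont: "(g \<longlongrightarrow> g x) (at x)"
    using x open_I by (simp add: continuous_on_eq_continuous_at isCont_def)
  have "((\<lambda>y. (g t - g y) / (t - y)) \<longlongrightarrow> (g t - g x) / (t - x)) (at x)"
    using t cont by (intro tendsto_intros) auto
  then have "((\<lambda>y. (g t - g y) / (t - y)) \<longlongrightarrow> (g t - g x) / (t - x)) (at_right x)"
    by (rule filterlim_mono) (auto simp: at_le)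
  then have "\<forall>\<^sub>F y in at_right x. (g t - g y) / (t - y) < a"
    using t(1) by (rule order_tendstoD)
  moreover have "\<forall>\<^sub>F y in at_right x. x < y \<and> y < t"
    unfolding eventually_at_right_field using t by (intro exI[of _ t]) auto
  ultimately obtain z where z: "(g t - g z) / (t - z) < a" "x < z" "z < t"
    using eventually_happens'[OF _ eventually_conj] by (smt (verit) trivial_limit_at_right_real)
  have zI: "z \<in> I" using mem_between[OF x tI, of z] z by auto
  have "F z * (t - z) \<le> g t - g z"
    using right_deriv_supporting_line(2)[OF zI, of t] tI I_subset_J by auto
  then have "F z \<le> (g t - g z) / (t - z)" using z by (simp add: pos_le_divide_eq)
  with z zI that show thesis by force
qed

abbreviation "gens \<equiv> (\<lambda>(a, b). {a<..b}) ` {(a, b). a \<le> b \<and> {a..b} \<subseteq> I}"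

lemma gens_Pow: "gens \<subseteq> Pow I"
  by auto

lemma space_M [simp]: "space M = I"
  unfolding second_deriv_measure_def by (rule space_extend_measure) auto

lemma sets_M: "sets M = sigma_sets I gens"
  unfolding second_deriv_measure_def by (rule sets_extend_measure) auto

text \<open>The definition by extension only has a meaning once some measure with the prescribed values is known.
  Such a measure is the image of Lebesgue measure under the generalized inverse \<open>G\<close> of the
  right-continuous function \<open>F\<close>.\<close>

lemma emeasure_M_Ioc:
  assumes ab: "a \<le> b" "a \<in> I" "b \<in> I"
  shows "emeasure M {a<..b} = ennreal (F b - F a)"
proof -
  \<comment> \<open>\<open>R\<close> is the range of \<open>F\<close> without gaps and endpoints; \<open>G\<close> maps it into \<open>I\<close>.\<close>
  define R where "R = (\<Union>x\<in>I. {F x<..}) \<inter> (\<Union>x\<in>I. {..<F x})"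
  define G where "G u = Inf {x \<in> I. u \<le> F x}" for u
  have R: "R \<in> sets lborel" unfolding R_def by (simp add: borel_open open_Int open_UN)
  have key: "G u \<in> I \<and> (\<forall>x\<in>I. G u \<le> x \<longleftrightarrow> u \<le> F x)" if u: "u \<in> R" for u
  proof -
    obtain y w where y: "y \<in> I" "F y < u" and w: "w \<in> I" "u \<le> F w"
      using u by (auto simp: R_def intro: less_imp_le)
    have low: "z \<le> x" if "x \<in> I" "u \<le> F x" "z \<in> I" "F z < u" for x z
      using F_mono[of x z] that by linarith
    have bdd: "bdd_below {x \<in> I. u \<le> F x}"
      using low y by (intro bdd_belowI[of _ y]) auto
    have le: "G u \<le> x" if "x \<in> I" "u \<le> F x" for x
      unfolding G_def using that bdd by (intro cInf_lower) auto
    have ge: "z \<le> G u" if "z \<in> I" "F z < u" for z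
      unfolding G_def using low that w by (intro cInf_greatest) auto
    have GI: "G u \<in> I"
      using mem_between[OF y(1) w(1)] le[OF w] ge[OF y] by auto
    have "u \<le> F (G u)"
    proof (rule ccontr)
      assume "\<not> u \<le> F (G u)"
      then obtain z where "z \<in> I" "G u < z" "F z < u" using F_right_continuous[OF GI, of u] by auto
      then show False using ge[of z] by auto
    qed
    then have "u \<le> F x" if "x \<in> I" "G u \<le> x" for x
      using F_mono[OF GI that(1) that(2)] by linarith
    with GI le show ?thesis by blast
  qed
  have pre: "G -` {a<..b} \<inter> R = {F a<..F b} \<inter> R" if "a \<in> I" "b \<in> I" for a b
    using key that by (auto simp: not_le[symmetric])
  have mem: "a \<in> I" "b \<in> I" if "a \<le> b" "{a..b} \<subseteq> I" for a b using that by auto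
  define N where "N = distr (restrict_space lborel R) (sigma I gens) G"
  have G: "G \<in> measurable (restrict_space lborel R) (sigma I gens)"
  proof (rule measurable_measure_of[OF gens_Pow])
    show "G \<in> space (restrict_space lborel R) \<rightarrow> I" using key by (auto simp: space_restrict_space)
    fix A assume "A \<in> gens"
    then obtain a b where "A = {a<..b}" "a \<in> I" "b \<in> I" using mem by auto
    then have "G -` A \<inter> R = {F a<..F b} \<inter> R" using pre by simp
    then show "G -` A \<inter> space (restrict_space lborel R) \<in> sets (restrict_space lborel R)"
      using R by (auto simp: space_restrict_space sets_restrict_space_iff)
  qed
  have sets_N: "sets N = sets M" by (simp add: N_def sets_M gens_Pow)
  have N: "emeasure N {a<..b} = ennreal (F b - F a)" if ab: "a \<le> b" "{a..b} \<subseteq> I" for a b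
  proof -
    have I: "a \<in> I" "b \<in> I" using mem ab by auto
    have "{a<..b} \<in> gens" using ab by auto
    then have "emeasure N {a<..b} = emeasure (restrict_space lborel R) (G -` {a<..b} \<inter> space (restrict_space lborel R))"
      unfolding N_def by (intro emeasure_distr[OF G]) (simp add: gens_Pow sets_measure_of)
    also have "\<dots> = emeasure lborel ({F a<..F b} \<inter> R)"
      using R pre[OF I] by (simp add: space_restrict_space emeasure_restrict_space)
    also have "\<dots> = ennreal (F b - F a)"
    proof (rule antisym)
      have mono: "F a \<le> F b" using F_mono I ab by auto
      have "emeasure lborel ({F a<..F b} \<inter> R) \<le> emeasure lborel {F a<..F b}"
        by (rule emeasure_mono) auto
      then show "emeasure lborel ({F a<..F b} \<inter> R) \<le> ennreal (F b - F a)" using mono by simp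
      have "{F a<..<F b} \<subseteq> {F a<..F b} \<inter> R" using I by (auto simp: R_def)
      then have "emeasure lborel {F a<..<F b} \<le> emeasure lborel ({F a<..F b} \<inter> R)"
        using R by (intro emeasure_mono) auto
      then show "ennreal (F b - F a) \<le> emeasure lborel ({F a<..F b} \<inter> R)" using mono by simp
    qed
    finally show ?thesis .
  qed
  have "emeasure M ((\<lambda>(a, b). {a<..b}) (a, b)) = (\<lambda>(a, b). ennreal (F b - F a)) (a, b)"
  proof (rule emeasure_extend_measure[OF second_deriv_measure_def, where \<mu>' = "emeasure N"])
    show "positive (sets M) (emeasure N)" by (simp add: positive_def)
    show "countably_additive (sets M) (emeasure N)"
      using emeasure_countably_additive[of N] by (simp add: sets_N)
    show "(a, b) \<in> {(a, b). a \<le> b \<and> {a..b} \<subseteq> I}" using ab mem_between[OF ab(2,3)] by (simp add: subset_iff)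
  qed (use N in auto)
  then show ?thesis by simp
qed

lemma Ioc_sets_M: "a \<in> I \<Longrightarrow> b \<in> I \<Longrightarrow> {a<..b} \<in> sets M"
proof (cases "a \<le> b")
  assume "a \<le> b" "a \<in> I" "b \<in> I"
  then have "{a<..b} \<in> gens"
    using mem_between[of a b] by (intro image_eqI[of _ _ "(a, b)"]) (simp_all add: subset_iff)
  then show ?thesis unfolding sets_M by (rule sigma_sets.Basic)
qed auto

lemma I_Union_Ioc: "I = (\<Union>(a, b) \<in> (\<rat> \<inter> I) \<times> (\<rat> \<inter> I). {a<..b})"
proof (intro equalityI subsetI)
  fix x assume x: "x \<in> I"
  obtain e where e: "e > 0" "\<And>y. \<bar>y - x\<bar> < e \<Longrightarrow> y \<in> I" using ball_in_I[OF x] by blast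
  obtain a where a: "a \<in> \<rat>" "x - e < a" "a < x" using Rats_dense_in_real[of "x - e" x] e by auto
  obtain b where b: "b \<in> \<rat>" "x < b" "b < x + e" using Rats_dense_in_real[of x "x + e"] e by auto
  show "x \<in> (\<Union>(a, b) \<in> (\<rat> \<inter> I) \<times> (\<rat> \<inter> I). {a<..b})"
    using a b e(2)[of a] e(2)[of b] by (intro UN_I[of "(a, b)"]) auto
next
  fix x assume "x \<in> (\<Union>(a, b) \<in> (\<rat> \<inter> I) \<times> (\<rat> \<inter> I). {a<..b})"
  then obtain a b where "a \<in> I" "b \<in> I" "a < x" "x \<le> b" by auto
  then show "x \<in> I" using mem_between[of a b x] by simp
qed

lemma countable_rat_pairs: "countable ((\<rat> \<inter> S) \<times> (\<rat> \<inter> S) :: (real \<times> real) set)"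
  using countable_rat by blast

sublocale M: sigma_finite_measure M
proof
  let ?A = "(\<lambda>(a, b). {a<..b}) ` ((\<rat> \<inter> I) \<times> (\<rat> \<inter> I))"
  have "emeasure M {a<..b} \<noteq> \<infinity>" if "a \<in> I" "b \<in> I" for a b
    using emeasure_M_Ioc[of a b] that by (cases "a \<le> b") auto
  then show "\<exists>A. countable A \<and> A \<subseteq> sets M \<and> \<Union> A = space M \<and> (\<forall>a\<in>A. emeasure M a \<noteq> \<infinity>)"
    using countable_rat_pairs I_Union_Ioc by (intro exI[of _ ?A]) (auto intro: Ioc_sets_M simp: split_beta)
qed

lemma measurable_ident_M: "(\<lambda>x. x) \<in> borel_measurable M"
proof (subst borel_measurable_iff_greater, intro allI)
  fix c
  show "{w \<in> space M. c < w} \<in> sets M"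
  proof (cases "c \<in> I")
    case True
    have "{w \<in> space M. c < w} = (\<Union>b \<in> \<rat> \<inter> I. {c<..b})"
    proof (intro equalityI subsetI)
      fix x assume "x \<in> {w \<in> space M. c < w}"
      then have x: "x \<in> I" "c < x" by auto
      obtain e where e: "e > 0" "\<And>y. \<bar>y - x\<bar> < e \<Longrightarrow> y \<in> I" using ball_in_I[OF x(1)] by blast
      obtain b where b: "b \<in> \<rat>" "x < b" "b < x + e" using Rats_dense_in_real[of x "x + e"] e by auto
      show "x \<in> (\<Union>b \<in> \<rat> \<inter> I. {c<..b})" using b x e(2)[of b] by (intro UN_I[of b]) auto
    next
      fix x assume "x \<in> (\<Union>b \<in> \<rat> \<inter> I. {c<..b})"
      then obtain b where "b \<in> I" "c < x" "x \<le> b" by auto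
      then show "x \<in> {w \<in> space M. c < w}" using mem_between[OF True, of b x] by simp
    qed
    also have "\<dots> \<in> sets M"
      using True countable_rat by (intro sets.countable_UN') (auto intro: Ioc_sets_M)
    finally show ?thesis .
  next
    case False
    show ?thesis
    proof (cases "\<exists>w\<in>I. c < w")
      case True
      then obtain w where w: "w \<in> I" "c < w" by blast
      have "c < z" if "z \<in> I" for z
        using mem_between[OF that w(1), of c] w(2) False by (cases "c < z") (simp_all add: not_less)
      then have "{w \<in> space M. c < w} = space M" by auto
      then show ?thesis by (simp only: sets.top)
    next
      case False
      then have "{w \<in> space M. c < w} = {}" by auto
      then show ?thesis by (simp only: sets.empty_sets)
    qed
  qed
qed

text \<open>The Bregman distance of \<open>y \<mapsto> max 0 (y - s)\<close>, again with right derivatives as slopes.\<close>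

definition kernel :: "real \<Rightarrow> real \<Rightarrow> real \<Rightarrow> real" where
  "kernel x y s = (if x < s then max 0 (y - s) else max 0 (s - y))"

lemma kernel_nonneg: "0 \<le> kernel x y s"
  by (simp add: kernel_def)

lemma measurable_kernel [measurable (raw)]:
  assumes [measurable]: "a \<in> borel_measurable N" "b \<in> borel_measurable N" "c \<in> borel_measurable N"
  shows "(\<lambda>w. kernel (a w) (b w) (c w)) \<in> borel_measurable N"
  unfolding kernel_def by measurable

lemma integrable_Ioc: 
  assumes "a \<in> I" "b \<in> I" "a \<le> b"
  shows "integrable M (indicator {a<..b} :: real \<Rightarrow> real)"
    and "(LINT s|M. indicator {a<..b} s) = F b - F a"
proof -
  have "{a<..b} \<inter> space M = {a<..b}" using mem_between[OF assms(1,2)] by auto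
  then show "integrable M (indicator {a<..b} :: real \<Rightarrow> real)"
    and "(LINT s|M. indicator {a<..b} s) = F b - F a"
    using emeasure_M_Ioc[OF assms(3,1,2)] F_mono[OF assms] assms
    by (auto simp: measure_def Ioc_sets_M)
qed

lemma integrable_kernel:
  assumes "x \<in> I" "y \<in> I"
  shows "integrable M (kernel x y)"
proof (rule Bochner_Integration.integrable_bound)
  show "integrable M (\<lambda>s. \<bar>y - x\<bar> * (indicator {min x y<..max x y} s :: real))"
    using assms by (intro integrable_mult_right integrable_Ioc) (auto simp: min_def max_def)
  show "kernel x y \<in> borel_measurable M"
    by (intro measurable_kernel measurable_ident_M) auto
  show "AE s in M. norm (kernel x y s) \<le> norm (\<bar>y - x\<bar> * (indicator {min x y<..max x y} s :: real))"
    by (auto simp: kernel_def indicator_def)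
qed

text \<open>Both sides vanish for \<open>y = x\<close>, and over an interval from \<open>p\<close> to \<open>q\<close> their increments differ by at
  most \<open>(F q - F p) (q - p)\<close>.\<close>

lemma bregman_le_integral_kernel:
  assumes x: "x \<in> I" and y: "y \<in> I"
  shows "bregman x y \<le> (LINT s|M. kernel x y s)"
proof -
  define D where "D z = bregman x z - (LINT s|M. kernel x z s)" for z
  have Dx: "D x = 0"
    by (auto simp: D_def bregman_def kernel_def intro!: integral_eq_zero_AE)
  have "D y \<le> 0"
  proof (cases "x \<le> y")
    case True
    have "D y \<le> D x"
    proof (rule telescoping_increment_le[OF True])
      fix p q assume pq: "x \<le> p" "p \<le> q" "q \<le> y"
      have pI: "p \<in> I" "q \<in> I" using mem_between[OF x y] pq by auto
      have "(q - p) * (F p - F x) = (LINT s|M. (q - p) * indicator {x<..p} s)"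
        using integrable_Ioc(2)[OF x pI(1) pq(1)] by simp
      also have "\<dots> \<le> (LINT s|M. kernel x q s - kernel x p s)"
        using pq x pI
        by (intro integral_mono integrable_mult_right integrable_Ioc Bochner_Integration.integrable_diff integrable_kernel)
          (auto simp: kernel_def indicator_def)
      also have "\<dots> = (LINT s|M. kernel x q s) - (LINT s|M. kernel x p s)"
        using x pI by (intro Bochner_Integration.integral_diff integrable_kernel)
      finally have "(q - p) * (F p - F x) \<le> (LINT s|M. kernel x q s) - (LINT s|M. kernel x p s)" .
      moreover have "g q - g p \<le> F q * (q - p)"
        using right_deriv_supporting_line(2)[OF pI(2), of p] pI I_subset_J by (auto simp: algebra_simps)
      ultimately show "D q - D p \<le> (F q - F p) * (q - p)"
        by (simp add: D_def bregman_def algebra_simps)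
    qed
    then show ?thesis by (simp add: Dx)
  next
    case False
    then have yx: "y \<le> x" by simp
    have "- D x \<le> - D y"
    proof (rule telescoping_increment_le[OF yx])
      fix p q assume pq: "y \<le> p" "p \<le> q" "q \<le> x"
      have pI: "p \<in> I" "q \<in> I" using mem_between[OF y x] pq by auto
      have "(q - p) * (F x - F q) = (LINT s|M. (q - p) * indicator {q<..x} s)"
        using integrable_Ioc(2)[OF pI(2) x pq(3)] by simp
      also have "\<dots> \<le> (LINT s|M. kernel x p s - kernel x q s)"
        using pq x pI
        by (intro integral_mono integrable_mult_right integrable_Ioc Bochner_Integration.integrable_diff integrable_kernel)
          (auto simp: kernel_def indicator_def)
      also have "\<dots> = (LINT s|M. kernel x p s) - (LINT s|M. kernel x q s)"
        using x pI by (intro Bochner_Integration.integral_diff integrable_kernel)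
      finally have "(q - p) * (F x - F q) \<le> (LINT s|M. kernel x p s) - (LINT s|M. kernel x q s)" .
      moreover have "F p * (q - p) \<le> g q - g p"
        using right_deriv_supporting_line(2)[OF pI(1), of q] pI I_subset_J by (auto simp: algebra_simps)
      ultimately show "- D q - - D p \<le> (F q - F p) * (q - p)"
        by (simp add: D_def bregman_def algebra_simps)
    qed
    then show ?thesis by (simp add: Dx)
  qed
  then show ?thesis by (simp add: D_def)
qed

text \<open>The sign \<open>\<sigma>\<close> orients \<open>I\<close> towards its endpoint \<open>b\<close>, so that left and right endpoints need only one
  argument.\<close>

lemma boundary_side:
  assumes "b \<in> J - I" "I \<noteq> {}"
  obtains \<sigma> :: real where "\<bar>\<sigma>\<bar> = 1" "\<And>z. z \<in> I \<Longrightarrow> 0 < \<sigma> * (b - z)"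
proof -
  have "(\<forall>z\<in>I. z < b) \<or> (\<forall>z\<in>I. b < z)"
  proof (rule ccontr)
    assume "\<not> ?thesis"
    then obtain p q where "p \<in> I" "q \<in> I" "b \<le> p" "q \<le> b" by (auto simp: not_less)
    then show False using mem_between[of q p b] assms by auto
  qed
  then show thesis
    using that[of 1] that[of "-1"] by auto
qed

text \<open>The slopes seen from a fixed point of \<open>I\<close> increase towards the endpoint and are bounded by the slope
  of the chord that ends there.\<close>

lemma boundary_limit:
  assumes b: "b \<in> J - I" and ne: "I \<noteq> {}"
  shows "(g \<longlongrightarrow> Lim (at b within I) g) (at b within I)" "at b within I \<noteq> bot"
proof -
  obtain \<sigma> :: real where s: "\<bar>\<sigma>\<bar> = 1" "\<And>z. z \<in> I \<Longrightarrow> 0 < \<sigma> * (b - z)"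
    using boundary_side[OF assms] by metis
  obtain x where x: "x \<in> I" using ne by auto
  have bcl: "b \<in> closure I" using b J_subset_closure by auto
  have "b islimpt I" using bcl b by (metis DiffD2 closure_def UnE mem_Collect_eq)
  then show nb: "at b within I \<noteq> bot" by (simp add: trivial_limit_within)
  define Q where "Q y = (g y - g x) / (\<sigma> * (y - x))" for y
  define A where "A = {y \<in> I. 0 < \<sigma> * (y - x)}"
  have mono: "Q y \<le> Q z" if "y \<in> I" "z \<in> J" "0 < \<sigma> * (y - x)" "\<sigma> * (y - x) \<le> \<sigma> * (z - x)" for y z
  proof -
    define dy where "dy = \<sigma> * (y - x)"
    define dz where "dz = \<sigma> * (z - x)"
    define l where "l = dy / dz"
    have d: "0 < dy" "dy \<le> dz" "0 < dz" using that unfolding dy_def dz_def by linarith+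
    have l: "0 < l" "l \<le> 1" "l * dz = dy" using d by (auto simp: l_def)
    have "\<sigma> * (l * (z - x)) = \<sigma> * (y - x)" using l(3) by (simp add: dy_def dz_def algebra_simps)
    moreover have "\<sigma> \<noteq> 0" using s by auto
    ultimately have "l * (z - x) = y - x" by (metis mult_left_cancel)
    then have "y = (1 - l) *\<^sub>R x + l *\<^sub>R z"
      by (simp add: algebra_simps)
    then have "g y \<le> (1 - l) * g x + l * g z"
      using convex_onD[OF convex_g, of l x z] l x I_subset_J that by auto
    then have "g y - g x \<le> l * (g z - g x)" by (simp add: algebra_simps)
    then have "(g y - g x) / dy \<le> (l * (g z - g x)) / dy"
      using d by (intro divide_right_mono) auto
    also have "\<dots> = (g z - g x) / dz" using d by (simp add: l_def)
    finally show ?thesis unfolding Q_def dy_def dz_def .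
  qed
  have dist: "\<bar>y - b\<bar> = \<sigma> * (b - y)" if "y \<in> I" for y
    using s(2)[OF that] s(1) by (metis abs_minus_commute abs_mult abs_of_pos mult_1)
  have ev: "\<forall>\<^sub>F y in at b within I. y \<in> I \<and> \<sigma> * (z - x) \<le> \<sigma> * (y - x)" if "z \<in> I" for z
  proof -
    have "\<forall>\<^sub>F y in at b within I. dist y b < \<bar>z - b\<bar>"
      using s(2)[OF that] unfolding eventually_at by (intro exI[of _ "\<bar>z - b\<bar>"]) auto
    moreover have "\<forall>\<^sub>F y in at b within I. y \<in> I"
      unfolding eventually_at by (intro exI[of _ 1]) auto
    ultimately show ?thesis
    proof eventually_elim
      case (elim y)
      then have "\<sigma> * (b - y) < \<sigma> * (b - z)" using dist[OF elim(2)] dist[OF that] by (simp add: dist_real_def)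
      then show ?case using elim by (simp add: algebra_simps)
    qed
  qed
  have evA: "\<forall>\<^sub>F y in at b within I. y \<in> A"
  proof -
    obtain z where z: "z \<in> I" "0 < \<sigma> * (z - x)"
    proof -
      have "0 < \<bar>x - b\<bar>" using s(2)[OF x] by auto
      then have "\<exists>z\<in>I. \<bar>z - b\<bar> < \<bar>x - b\<bar>"
        using bcl closure_approachable[of b I] by (simp add: dist_real_def)
      then obtain z where "z \<in> I" "\<bar>z - b\<bar> < \<bar>x - b\<bar>" by auto
      then show thesis using dist[of z] dist[OF x] that[of z] by (simp add: algebra_simps)
    qed
    show ?thesis using ev[OF z(1)] by eventually_elim (use z in \<open>auto simp: A_def\<close>)
  qed
  have Ane: "A \<noteq> {}" using eventually_happens'[OF nb evA] by auto
  have bound: "Q y \<le> Q b" if "y \<in> A" for y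
    using mono[of y b] that b s(2)[of y] by (auto simp: A_def algebra_simps)
  have bdd: "bdd_above (Q ` A)" using bound by (intro bdd_aboveI[of _ "Q b"]) auto
  have "(Q \<longlongrightarrow> Sup (Q ` A)) (at b within I)"
  proof (rule order_tendstoI)
    fix a assume "a < Sup (Q ` A)"
    then obtain z where z: "z \<in> A" "a < Q z" using less_cSup_iff[of "Q ` A" a] Ane bdd by auto
    have "\<forall>\<^sub>F y in at b within I. y \<in> I \<and> \<sigma> * (z - x) \<le> \<sigma> * (y - x)" using z ev by (auto simp: A_def)
    then show "\<forall>\<^sub>F y in at b within I. a < Q y"
    proof eventually_elim
      case (elim y)
      then show ?case using mono[of z y] z I_subset_J by (auto simp: A_def)
    qed
  next
    fix a assume a: "Sup (Q ` A) < a"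
    show "\<forall>\<^sub>F y in at b within I. Q y < a"
      using evA
    proof eventually_elim
      case (elim y)
      then have "Q y \<le> Sup (Q ` A)" using bdd by (intro cSup_upper) auto
      with a show ?case by simp
    qed
  qed
  then have "((\<lambda>y. g x + Q y * (\<sigma> * (y - x))) \<longlongrightarrow> g x + Sup (Q ` A) * (\<sigma> * (b - x))) (at b within I)"
    by (intro tendsto_intros)
  moreover have "\<forall>\<^sub>F y in at b within I. g x + Q y * (\<sigma> * (y - x)) = g y"
    using evA by eventually_elim (auto simp: A_def Q_def)
  ultimately have "(g \<longlongrightarrow> g x + Sup (Q ` A) * (\<sigma> * (b - x))) (at b within I)"
    by (rule Lim_transform_eventually)
  then show "(g \<longlongrightarrow> Lim (at b within I) g) (at b within I)"
    using tendsto_Lim[OF nb] by metis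
qed

text \<open>At an endpoint the estimate for interior points is continued by a limit from inside: the kernel
  increases along the way, and \<open>g\<close> falls short of its boundary value by the jump.\<close>

lemma bregman_le_kernel_boundary:
  assumes x: "x \<in> I" and y: "y \<in> J"
  shows "ennreal (bregman x y) \<le> (\<integral>\<^sup>+s. ennreal (kernel x y s) \<partial>M) +
    ennreal (indicator (J - I) y * \<bar>boundary_jump I (\<lambda>x. - g x) y\<bar>)"
proof (cases "y \<in> I")
  case True
  have "(\<integral>\<^sup>+s. ennreal (kernel x y s) \<partial>M) = ennreal (LINT s|M. kernel x y s)"
    using integrable_kernel[OF x True] kernel_nonneg by (intro nn_integral_eq_integral) auto
  with bregman_le_integral_kernel[OF x True] show ?thesis
    using True by (simp add: ennreal_leI)
next
  case False
  have b: "y \<in> J - I" and ne: "I \<noteq> {}" using x y False by auto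
  define L where "L = Lim (at y within I) g"
  have lim: "(g \<longlongrightarrow> L) (at y within I)" and nb: "at y within I \<noteq> bot"
    using boundary_limit[OF b ne] by (auto simp: L_def)
  have "Lim (at y within I) (\<lambda>x. - g x) = - L"
    using lim by (intro tendsto_Lim[OF nb] tendsto_minus)
  then have jump: "g y - L \<le> \<bar>boundary_jump I (\<lambda>x. - g x) y\<bar>"
    by (simp add: boundary_jump_def)
  show ?thesis
  proof (cases "(\<integral>\<^sup>+s. ennreal (kernel x y s) \<partial>M) = \<infinity>")
    case False
    then obtain c where c: "(\<integral>\<^sup>+s. ennreal (kernel x y s) \<partial>M) = ennreal c" "0 \<le> c"
      by (metis ennreal_cases infinity_ennreal_def)
    obtain \<sigma> :: real where s: "\<bar>\<sigma>\<bar> = 1" "\<And>z. z \<in> I \<Longrightarrow> 0 < \<sigma> * (y - z)"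
      using boundary_side[OF b ne] by metis
    have ev: "\<forall>\<^sub>F z in at y within I. bregman x z \<le> c"
    proof -
      have "\<forall>\<^sub>F z in at y within I. dist z y < \<bar>x - y\<bar>"
        using s(2)[OF x] unfolding eventually_at by (intro exI[of _ "\<bar>x - y\<bar>"]) auto
      moreover have "\<forall>\<^sub>F z in at y within I. z \<in> I"
        unfolding eventually_at by (intro exI[of _ 1]) auto
      ultimately show ?thesis
      proof eventually_elim
        case (elim z)
        have k: "kernel x z s \<le> kernel x y s" for s
          using elim s(1) s(2)[OF elim(2)] s(2)[OF x] 
          by (cases "\<sigma> = 1"; cases "\<sigma> = -1") (auto simp: kernel_def dist_real_def abs_if split: if_splits)
        have "ennreal (LINT s|M. kernel x z s) = (\<integral>\<^sup>+s. ennreal (kernel x z s) \<partial>M)"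
          using integrable_kernel[OF x elim(2)] kernel_nonneg
          by (intro nn_integral_eq_integral[symmetric]) auto
        also have "\<dots> \<le> ennreal c"
          unfolding c(1)[symmetric] by (intro nn_integral_mono ennreal_leI k)
        finally have "(LINT s|M. kernel x z s) \<le> c" using c(2) by (simp add: ennreal_le_iff)
        then show ?case using bregman_le_integral_kernel[OF x elim(2)] by simp
      qed
    qed
    have "((\<lambda>z. bregman x z) \<longlongrightarrow> L - g x - F x * (y - x)) (at y within I)"
      unfolding bregman_def by (intro tendsto_intros lim)
    then have "L - g x - F x * (y - x) \<le> c"
      by (rule tendsto_upperbound[OF _ ev nb])
    then have "bregman x y \<le> c + \<bar>boundary_jump I (\<lambda>x. - g x) y\<bar>"
      using jump by (simp add: bregman_def)
    then show ?thesis
      using b c by (simp add: ennreal_plus[symmetric] ennreal_leI del: ennreal_plus)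
  qed simp
qed

end

section \<open>Finiteness of the dual pair\<close>

lemma econvex_onD:
  assumes "econvex_on S g" "x \<in> S" "y \<in> S" "g x \<le> ereal r" "g y \<le> ereal s" "0 \<le> t" "t \<le> 1"
  shows "g ((1 - t) * x + t * y) \<le> ereal ((1 - t) * r + t * s)"
proof -
  have "convex {(x, r). x \<in> S \<and> g x \<le> ereal r}" using assms by (simp add: econvex_on_def)
  from convexD[OF this, of "(x, r)" "(y, s)" "1 - t" t] assms show ?thesis by auto
qed

lemma strictly_between_combination:
  fixes x y z :: real
  assumes "x < y \<and> y < z \<or> z < y \<and> y < x"
  obtains t where "0 < t" "t < 1" "y = (1 - t) * x + t * z"
proof
  show "0 < (y - x) / (z - x)" "(y - x) / (z - x) < 1"
    using assms by (auto simp: divide_simps)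
  define t where "t = (y - x) / (z - x)"
  have "t * (z - x) = y - x" using assms by (auto simp: t_def)
  then have "y = (1 - t) * x + t * z" by (simp add: algebra_simps)
  then show "y = (1 - (y - x) / (z - x)) * x + (y - x) / (z - x) * z"
    by (simp only: t_def)
qed

lemma ereal_le_real_if_not_PInf: "(a :: ereal) \<noteq> \<infinity> \<Longrightarrow> \<exists>r. a \<le> ereal r"
  by (cases a) (auto intro: exI[of _ 0])

lemma econvex_on_lt_PInf_between:
  assumes "econvex_on S g" "x \<in> S" "z \<in> S" "g x \<noteq> \<infinity>" "g z \<noteq> \<infinity>"
    and "x < y \<and> y < z \<or> z < y \<and> y < x"
  shows "g y \<noteq> \<infinity>"
proof -
  obtain r s where "g x \<le> ereal r" "g z \<le> ereal s" using assms ereal_le_real_if_not_PInf by metis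
  moreover obtain t where "0 < t" "t < 1" "y = (1 - t) * x + t * z"
    using strictly_between_combination[OF assms(6)] .
  ultimately have "g y \<le> ereal ((1 - t) * r + t * s)"
    using econvex_onD[OF assms(1-3)] by auto
  then show ?thesis by auto
qed

text \<open>A chord that starts arbitrarily low is arbitrarily low at each of its inner points.\<close>

lemma econvex_on_MInf_spreads:
  assumes "econvex_on S g" "x \<in> S" "z \<in> S" "g x = - \<infinity>" "g z \<noteq> \<infinity>"
    and "x < y \<and> y < z \<or> z < y \<and> y < x"
  shows "g y = - \<infinity>"
proof -
  obtain s where s: "g z \<le> ereal s" using assms ereal_le_real_if_not_PInf by metis
  obtain t where t: "0 < t" "t < 1" "y = (1 - t) * x + t * z"
    using strictly_between_combination[OF assms(6)] .
  have "g y \<le> ereal R" for R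
  proof -
    have "g x \<le> ereal ((R - t * s) / (1 - t))" using assms(4) by simp
    then have "g y \<le> ereal ((1 - t) * ((R - t * s) / (1 - t)) + t * s)"
      unfolding t(3) by (rule econvex_onD[OF assms(1-3) _ s]) (use t in auto)
    moreover have "(1 - t) * ((R - t * s) / (1 - t)) + t * s = R" using t by simp
    ultimately show ?thesis by simp
  qed
  then show ?thesis by (metis ereal_bot)
qed

lemma eintegrable_AE_finite:
  assumes "eintegrable M g"
  shows "AE x in M. \<bar>g x\<bar> \<noteq> \<infinity>"
proof -
  have [measurable]: "g \<in> borel_measurable M" using assms by (simp add: eintegrable_def)
  have "AE x in M. e2ennreal \<bar>g x\<bar> \<noteq> \<infinity>"
    by (rule nn_integral_PInf_AE) (use assms in \<open>auto simp: eintegrable_def\<close>)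
  then show ?thesis
    by eventually_elim (auto simp: e2ennreal_infty)
qed

context irreducible_measures
begin

lemma AE_restrict_J:
  assumes "sets \<theta> = sets borel"
  shows "(AE x in restrict_space \<theta> J. P x) \<longleftrightarrow> (AE x in \<theta>. x \<in> J \<longrightarrow> P x)"
  using assms by (intro AE_restrict_space_iff) (auto simp: sets_eq_imp_space_eq[OF assms])

lemma AE_mu_obtain:
  assumes "I \<noteq> {}" "AE x in \<mu>. P x"
  obtains x where "x \<in> I" "P x"
proof (rule ccontr)
  assume no: "\<not> thesis"
  have "AE x in \<mu>. False"
    using assms(2) AE_mu_I by eventually_elim (use no that in auto)
  then have "emeasure \<mu> (space \<mu>) = 0"
    using AE_iff_measurable[of "space \<mu>" \<mu> "\<lambda>x. False"] by auto
  then have "measure \<nu> UNIV = 0"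
    using total_mass_eq by (simp add: space_mu measure_def)
  interpret n: finite_measure \<nu> using admissible_measureD(1)[OF adm_nu] .
  have "emeasure \<nu> (space \<nu>) = 0"
    using \<open>measure \<nu> UNIV = 0\<close> by (simp add: space_nu n.emeasure_eq_measure)
  then have "AE x in \<nu>. False"
    by (auto intro!: AE_I[of _ _ "space \<nu>"])
  then have "AE y in \<nu>. x \<le> y" for x by eventually_elim auto
  then show False using one_sided_notin_I assms(1) by auto
qed

text \<open>An infinite value of \<open>\<phi>\<close> or \<open>\<psi>\<close> would confine \<open>\<nu>\<close> to one side of a point of \<open>I\<close>, or of an
  atom of \<open>\<nu>\<close> at the boundary of \<open>I\<close>. The inequality \<open>f \<le> \<phi> + \<psi>\<close> alone does not exclude such values,
  since \<open>\<infinity> + (- \<infinity>) = \<infinity>\<close>.\<close>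

lemma dual_aux_finite:
  assumes dual: "(\<phi>, \<psi>) \<in> dual_aux \<mu> \<nu> f" and f: "\<And>x. 0 \<le> f x" and x: "x \<in> J"
  shows "\<bar>\<phi> x\<bar> \<noteq> \<infinity>" "\<bar>\<psi> x\<bar> \<noteq> \<infinity>"
proof -
  have concave: "econvex_on J (\<lambda>x. - \<phi> x)" and convex: "econvex_on J \<psi>"
    and "(\<phi>, \<psi>) \<in> Lc I J \<mu> \<nu>"
    using dual by (auto simp: dual_aux_def econcave_on_def)
  then obtain \<kappa> where \<kappa>: "eintegrable (restrict_space \<mu> J) (\<lambda>x. \<phi> x - ereal (\<kappa> x))"
    "eintegrable (restrict_space \<nu> J) (\<lambda>x. \<psi> x + ereal (\<kappa> x))"
    by (auto simp: Lc_def concave_moderator_def)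
  have sum: "0 \<le> \<phi> x + \<psi> x" if "x \<in> J" for x
    using dual f[of x] that by (auto simp: dual_aux_def intro: order_trans)
  have mu_fin: "AE x in \<mu>. x \<in> J \<longrightarrow> \<bar>\<phi> x - ereal (\<kappa> x)\<bar> \<noteq> \<infinity>"
    using eintegrable_AE_finite[OF \<kappa>(1)] by (simp add: AE_restrict_J sets_mu)
  have "AE x in \<nu>. x \<in> J \<longrightarrow> \<bar>\<psi> x + ereal (\<kappa> x)\<bar> \<noteq> \<infinity>"
    using eintegrable_AE_finite[OF \<kappa>(2)] by (simp add: AE_restrict_J sets_nu)
  then have nu_fin: "AE x in \<nu>. x \<in> J \<and> \<bar>\<psi> x\<bar> \<noteq> \<infinity>"
    using AE_nu_J by eventually_elim auto
  have ne: "I \<noteq> {}" using x J_subset_closure by auto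
  obtain p where p: "p \<in> I" "\<bar>\<phi> p\<bar> \<noteq> \<infinity>"
  proof -
    obtain p where "p \<in> I" "p \<in> J \<longrightarrow> \<bar>\<phi> p - ereal (\<kappa> p)\<bar> \<noteq> \<infinity>"
      using AE_mu_obtain[OF ne mu_fin] by blast
    then show thesis using that[of p] I_subset_J by (cases "\<phi> p") auto
  qed
  have phi_lt: "\<phi> w \<noteq> \<infinity>" if w: "w \<in> J" for w
  proof
    assume inf: "\<phi> w = \<infinity>"
    then have pw: "p \<noteq> w" using p by auto
    have psi_inf: "\<bar>\<psi> z\<bar> = \<infinity>" if z: "z \<in> J" "w < p \<and> p < z \<or> z < p \<and> p < w" for z
    proof -
      have "- \<phi> z = \<infinity>"
        using econvex_on_MInf_spreads[OF concave w z(1) _ _ z(2)] inf p(2)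
        by (cases "- \<phi> z = \<infinity>") auto
      then have "\<phi> z = - \<infinity>" by (simp add: ereal_uminus_eq_reorder)
      then show ?thesis using sum[OF z(1)] by (cases "\<psi> z") auto
    qed
    have "AE y in \<nu>. \<not> (w < p \<and> p < y \<or> y < p \<and> p < w)"
      using nu_fin proof eventually_elim
      case (elim y)
      then show ?case using psi_inf[of y] by auto
    qed
    then have "(AE y in \<nu>. p \<le> y) \<or> (AE y in \<nu>. y \<le> p)"
      using pw by (cases "w < p") (auto simp: not_less)
    then show False using one_sided_notin_I p(1) by blast
  qed
  have psi_gt: "\<psi> w \<noteq> - \<infinity>" if "w \<in> J" for w
    using sum[OF that] phi_lt[OF that] by (cases "\<phi> w") auto
  have psi_lt: "\<psi> w \<noteq> \<infinity>" if w: "w \<in> J" for w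
  proof
    assume inf: "\<psi> w = \<infinity>"
    have side: "(AE y in \<nu>. w < y) \<or> (AE y in \<nu>. y < w)"
    proof (cases "\<exists>y\<in>J. y < w \<and> \<psi> y \<noteq> \<infinity>")
      case True
      then have no: "\<psi> z = \<infinity>" if "z \<in> J" "w < z" for z
        using econvex_on_lt_PInf_between[OF convex, of _ z w] inf that by auto
      have "AE y in \<nu>. y < w"
        using nu_fin
      proof eventually_elim
        case (elim y)
        then have "y \<noteq> w" "\<not> w < y" using no inf by auto
        then show ?case by simp
      qed
      then show ?thesis ..
    next
      case False
      have "AE y in \<nu>. w < y"
        using nu_fin
      proof eventually_elim
        case (elim y)
        then have "y \<noteq> w" "\<not> y < w" using False inf by auto
        then show ?case by simp
      qed
      then show ?thesis ..
    qed
    then have "(AE y in \<nu>. w \<le> y) \<or> (AE y in \<nu>. y \<le> w)"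
      by (elim disj_forward) (auto elim!: eventually_mono)
    then have "w \<notin> I" using one_sided_notin_I by blast
    then have atom: "emeasure \<nu> {w} > 0" using w by (auto simp: domain_J_def)
    have "AE y in \<nu>. y \<notin> {w}" using side by (auto elim!: eventually_mono)
    then have "emeasure \<nu> {w} = 0"
      using AE_iff_null_sets[of "{w}" \<nu>] sets_nu by (auto simp: null_sets_def)
    with atom show False by simp
  qed
  have "\<phi> x \<noteq> - \<infinity>" using sum[OF x] psi_lt[OF x] by (cases "\<psi> x") auto
  then show "\<bar>\<phi> x\<bar> \<noteq> \<infinity>" "\<bar>\<psi> x\<bar> \<noteq> \<infinity>"
    using phi_lt[OF x] psi_lt[OF x] psi_gt[OF x] by auto
qed

end

section \<open>Stieltjes integrals against averaging paths\<close>

text \<open>Times are rounded up, not down: a cadlag path at the rounded times converges to its value, and the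
  mass that an averaging path gives to a grid cell is known at the right end of the cell.\<close>

definition grid_up :: "real \<Rightarrow> nat \<Rightarrow> real \<Rightarrow> real" where
  "grid_up T n t = min T (of_int \<lceil>real (Suc n) * t\<rceil> / real (Suc n))"

lemma grid_up_bounds:
  assumes "t \<in> {0..T}"
  shows "t \<le> grid_up T n t" "grid_up T n t \<le> T" "grid_up T n t \<le> t + 1 / real (Suc n)"
    "grid_up T n t \<in> {0..T}"
proof -
  have "real (Suc n) * t \<le> of_int \<lceil>real (Suc n) * t\<rceil>" by (rule le_of_int_ceiling)
  then have "t \<le> of_int \<lceil>real (Suc n) * t\<rceil> / real (Suc n)"
    by (simp add: pos_le_divide_eq mult.commute del: of_nat_Suc)
  then show 1: "t \<le> grid_up T n t" using assms by (simp add: grid_up_def)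
  show 2: "grid_up T n t \<le> T" by (simp add: grid_up_def)
  have "of_int \<lceil>real (Suc n) * t\<rceil> \<le> real (Suc n) * t + 1" by linarith
  then have "of_int \<lceil>real (Suc n) * t\<rceil> / real (Suc n) \<le> (real (Suc n) * t + 1) / real (Suc n)"
    by (intro divide_right_mono) auto
  also have "\<dots> = t + 1 / real (Suc n)" by (simp add: add_divide_distrib del: of_nat_Suc)
  finally show "grid_up T n t \<le> t + 1 / real (Suc n)" by (simp add: grid_up_def)
  show "grid_up T n t \<in> {0..T}" using 1 2 assms by auto
qed

lemma cadlag_grid_up_tendsto:
  fixes w :: "real \<Rightarrow> 'a::metric_space"
  assumes w: "cadlag_on T w" and t: "t \<in> {0..T}"
  shows "(\<lambda>n. w (grid_up T n t)) \<longlonglongrightarrow> w t"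
proof (cases "t = T")
  case True
  then have "grid_up T n t = t" for n using grid_up_bounds[OF t, of n] by simp
  then show ?thesis by simp
next
  case False
  then have lim: "(w \<longlongrightarrow> w t) (at_right t)" using w t by (auto simp: cadlag_on_def)
  show ?thesis
  proof (rule tendstoI)
    fix e :: real assume e: "e > 0"
    obtain b where b: "b > t" "\<And>y. t < y \<Longrightarrow> y < b \<Longrightarrow> dist (w y) (w t) < e"
      using tendstoD[OF lim e] by (auto simp: eventually_at_right_field)
    have "(\<lambda>n. 1 / real (Suc n)) \<longlonglongrightarrow> 0" by (rule LIMSEQ_Suc[OF lim_1_over_n])
    then have "\<forall>\<^sub>F n in sequentially. 1 / real (Suc n) < b - t"
      using b by (intro order_tendstoD) auto
    then show "\<forall>\<^sub>F n in sequentially. dist (w (grid_up T n t)) (w t) < e"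
    proof eventually_elim
      case (elim n)
      then have "t \<le> grid_up T n t" "grid_up T n t < b" using grid_up_bounds[OF t, of n] by auto
      then show ?case using b(2)[of "grid_up T n t"] e by (cases "grid_up T n t = t") auto
    qed
  qed
qed

lemma borel_measurable_cadlag:
  fixes w :: "real \<Rightarrow> real"
  assumes "cadlag_on T w"
  shows "(\<lambda>t. indicator {0..T} t * w t) \<in> borel_measurable borel"
proof (rule borel_measurable_LIMSEQ_real)
  show "(\<lambda>n. indicator {0..T} t * w (grid_up T n t)) \<longlonglongrightarrow> indicator {0..T} t * w t" for t
    using cadlag_grid_up_tendsto[OF assms, of t] by (auto simp: indicator_def)
  show "(\<lambda>t. indicator {0..T} t * w (grid_up T n t)) \<in> borel_measurable borel" for n
  proof -
    have "(\<lambda>i. w (min T (of_int i / real (Suc n)))) \<in> measurable (count_space UNIV) borel" by simp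
    then have "(\<lambda>t. w (min T (of_int \<lceil>real (Suc n) * t\<rceil> / real (Suc n)))) \<in> borel_measurable borel"
      by (rule measurable_compose[rotated]) simp
    then show ?thesis unfolding grid_up_def by simp
  qed
qed

lemma sets_borel_Ioc: "sets (borel :: real measure) = sigma_sets UNIV (range (\<lambda>(a, b). {a<..b}))"
  by (subst borel_sigma_sets_Ioc) (rule sets_measure_of, simp)

lemma Int_stable_Ioc: "Int_stable (range (\<lambda>(a, b). {a<..b::real}))"
proof (rule Int_stableI_image)
  fix i j :: "real \<times> real"
  show "\<exists>k\<in>UNIV. (case i of (a, b) \<Rightarrow> {a<..b}) \<inter> (case j of (a, b) \<Rightarrow> {a<..b}) = (case k of (a, b) \<Rightarrow> {a<..b})"
    by (intro bexI[of _ "(max (fst i) (fst j), min (snd i) (snd j))"]) (auto simp: split_beta)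
qed

lemma UNIV_eq_Union_Ioc: "(UNIV :: real set) = (\<Union>i::nat. {- real i<..real i})"
proof (intro equalityI subsetI)
  fix x :: real
  obtain i :: nat where "\<bar>x\<bar> < real i" using reals_Archimedean2 by blast
  then show "x \<in> (\<Union>i::nat. {- real i<..real i})" by (intro UN_I[of i]) auto
qed auto

lemma emeasure_interval_measure_eq_const:
  "emeasure (interval_measure (\<lambda>t. c)) A = 0"
proof -
  have "emeasure (interval_measure (\<lambda>t. c)) UNIV = 0"
  proof -
    have "emeasure (interval_measure (\<lambda>t. c)) (\<Union>i::nat. {- real i<..real i}) = 0"
      by (rule emeasure_UN_eq_0) (auto simp: emeasure_interval_measure_Ioc)
    then show ?thesis using UNIV_eq_Union_Ioc by simp
  qed
  then show ?thesis using emeasure_space[of "interval_measure (\<lambda>t. c)" A] by simp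
qed

text \<open>The two measures differ only by an atom at \<open>0\<close>.\<close>

lemma density_interval_measure_shift:
  assumes F: "\<And>x y. x \<le> y \<Longrightarrow> F x \<le> F y" "\<And>a. continuous (at_right a) F"
    and G: "\<And>x y. x \<le> y \<Longrightarrow> G x \<le> G y" "\<And>a. continuous (at_right a) G"
    and shift: "\<And>t. 0 \<le> t \<Longrightarrow> F t = G t + (c :: real)"
  shows "density (interval_measure F) (indicator {0<..}) = density (interval_measure G) (indicator {0<..})"
proof (rule measure_eqI_generator_eq)
  let ?E = "range (\<lambda>(a, b). {a <.. b::real})"
  show "Int_stable ?E" by (rule Int_stable_Ioc)
  have em: "emeasure (density (interval_measure H) (indicator {0<..})) {a<..b} =
      emeasure (interval_measure H) ({max a 0<..b})" for H and a b :: real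
  proof -
    have "{0<..} \<inter> {a<..b} = {max a 0<..b}" by auto
    then show ?thesis
      by (simp add: emeasure_density indicator_inter_arith[symmetric])
  qed
  show "emeasure (density (interval_measure F) (indicator {0<..})) X =
      emeasure (density (interval_measure G) (indicator {0<..})) X" if X: "X \<in> ?E" for X
  proof -
    obtain a b where X: "X = {a<..b}" using X by auto
    show ?thesis
    proof (cases "max a 0 \<le> b")
      case True
      then show ?thesis unfolding X em
        using emeasure_interval_measure_Ioc[OF True F] emeasure_interval_measure_Ioc[OF True G]
        by (simp add: shift)
    next
      case False
      then have e: "{max a 0<..b} = {}" by auto
      show ?thesis unfolding X em e by (simp only: emeasure_empty)
    qed
  qed
  show "sets (density (interval_measure F) (indicator {0<..})) = sigma_sets UNIV ?E"
    "sets (density (interval_measure G) (indicator {0<..})) = sigma_sets UNIV ?E"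
    by (simp_all add: sets_borel_Ioc)
  show "range (\<lambda>i::nat. {- real i<..real i}) \<subseteq> ?E" by auto
  show "(\<Union>i::nat. {- real i<..real i}) = (UNIV :: real set)" by (rule UNIV_eq_Union_Ioc[symmetric])
  show "emeasure (density (interval_measure F) (indicator {0<..})) {- real i<..real i} \<noteq> \<infinity>" for i
    unfolding em by (subst emeasure_interval_measure_Ioc) (use F in auto)
qed simp

locale averaging_path =
  fixes T :: real and a :: path
  assumes T_pos: "0 < T" and a: "a \<in> averaging_paths T"
begin

abbreviation da :: "real measure" where "da \<equiv> stieltjes_measure T a"

definition cdf_a :: "real \<Rightarrow> real" where
  "cdf_a t = (if t < 0 then 0 else a (min t T))"

lemma a_range: "t \<in> {0..T} \<Longrightarrow> a t \<in> {0..1}"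
  and a_mono: "s \<in> {0..T} \<Longrightarrow> t \<in> {0..T} \<Longrightarrow> s \<le> t \<Longrightarrow> a s \<le> a t"
  and a_T: "a T = 1" and a_cadlag: "cadlag_on T a"
  using a by (auto simp: averaging_paths_def mono_on_def cadlag_paths_def)

lemma shifted_cdf_mono: "x \<le> y \<Longrightarrow> 0 \<le> c \<Longrightarrow> c \<le> a 0 \<Longrightarrow>
    (if x < 0 then 0 else a (min x T) - c) \<le> (if y < 0 then 0 else a (min y T) - c)"
  using a_mono[of "min x T" "min y T"] a_mono[of 0 "min y T"] T_pos by (auto simp: min_def)

lemma shifted_cdf_right_cont: "continuous (at_right s) (\<lambda>t. if t < 0 then 0 else a (min t T) - c)"
proof -
  consider "s < 0" | "0 \<le> s" "s < T" | "T \<le> s" by linarith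
  then show ?thesis
  proof cases
    case 1
    have "\<forall>\<^sub>F t in at_right s. (0::real) = (if t < 0 then 0 else a (min t T) - c)"
      using 1 by (auto simp: eventually_at_right_field intro!: exI[of _ 0])
    then show ?thesis using 1 unfolding continuous_within
      by (intro Lim_transform_eventually[OF tendsto_const]) auto
  next
    case 2
    then have "(a \<longlongrightarrow> a s) (at_right s)" using a_cadlag by (auto simp: cadlag_on_def)
    then have "((\<lambda>t. a t - c) \<longlongrightarrow> a s - c) (at_right s)" by (intro tendsto_intros)
    moreover have "\<forall>\<^sub>F t in at_right s. a t - c = (if t < 0 then 0 else a (min t T) - c)"
      using 2 by (auto simp: eventually_at_right_field intro!: exI[of _ T])
    ultimately show ?thesis using 2 unfolding continuous_within
      by (auto intro: Lim_transform_eventually)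
  next
    case 3
    have "\<forall>\<^sub>F t in at_right s. a T - c = (if t < 0 then 0 else a (min t T) - c)"
      using 3 T_pos by (auto simp: eventually_at_right_field min_def intro!: exI[of _ "s + 1"])
    then have lim: "((\<lambda>t. if t < 0 then 0 else a (min t T) - c) \<longlongrightarrow> a T - c) (at_right s)"
      by (rule Lim_transform_eventually[OF tendsto_const])
    have "(if s < 0 then 0 else a (min s T) - c) = a T - c" using 3 T_pos by (auto simp: min_def)
    with lim show ?thesis unfolding continuous_within by (simp only:)
  qed
qed

lemma cdf_a_alt: "cdf_a = (\<lambda>t. if t < 0 then 0 else a (min t T) - 0)"
  by (simp add: cdf_a_def fun_eq_iff)

lemma cdf_a_mono: "x \<le> y \<Longrightarrow> cdf_a x \<le> cdf_a y"
  using shifted_cdf_mono[of x y 0] a_range[of 0] T_pos unfolding cdf_a_alt by simp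

lemma cdf_a_right_cont: "continuous (at_right s) cdf_a"
  using shifted_cdf_right_cont[of s 0] unfolding cdf_a_alt .

lemma da_eq: "da = interval_measure cdf_a"
  by (simp add: stieltjes_measure_def cdf_a_def[abs_def])

sublocale da: real_distribution da
  unfolding da_eq
proof (rule real_distribution_interval_measure)
  have "\<forall>\<^sub>F t in at_bot. (0::real) = cdf_a t"
    using eventually_gt_at_bot[of 0] by eventually_elim (simp add: cdf_a_def)
  then show "(cdf_a \<longlongrightarrow> 0) at_bot" by (rule Lim_transform_eventually[OF tendsto_const])
  have "\<forall>\<^sub>F t in at_top. 1 = cdf_a t"
    using eventually_ge_at_top[of T] by eventually_elim (use a_T T_pos in \<open>auto simp: cdf_a_def min_def\<close>)
  then show "(cdf_a \<longlongrightarrow> 1) at_top" by (rule Lim_transform_eventually[OF tendsto_const])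
qed (use cdf_a_mono cdf_a_right_cont in auto)

lemma sets_da [simp, measurable_cong]: "sets da = sets borel"
  and space_da [simp]: "space da = UNIV"
  by (simp_all add: da_eq)

lemma measure_da_Ioc: "s \<le> t \<Longrightarrow> measure da {s<..t} = cdf_a t - cdf_a s"
  unfolding da_eq
  by (simp add: measure_def emeasure_interval_measure_Ioc[OF _ cdf_a_mono cdf_a_right_cont] cdf_a_mono)

lemma AE_da_in: "AE t in da. t \<in> {0..T}"
proof -
  have "AE t in da. \<forall>n. t \<in> {- 1 / real (Suc n)<..T}"
    unfolding AE_all_countable
  proof
    fix n
    have neg: "- 1 / real (Suc n) < 0" by simp
    then have "measure da {- 1 / real (Suc n)<..T} = cdf_a T - cdf_a (- 1 / real (Suc n))"
      using T_pos by (intro measure_da_Ioc) linarith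
    also have "\<dots> = 1" using neg T_pos a_T by (simp add: cdf_a_def)
    finally show "AE t in da. t \<in> {- 1 / real (Suc n)<..T}" by (rule da.AE_prob_1)
  qed
  then show ?thesis
  proof eventually_elim
    case (elim t)
    have "0 \<le> t"
    proof (rule ccontr)
      assume "\<not> 0 \<le> t"
      then obtain n where "1 / real (Suc n) < - t"
        using reals_Archimedean[of "- t"] by (auto simp: inverse_eq_divide)
      moreover have "- 1 / real (Suc n) < t" using elim by auto
      ultimately show False by simp
    qed
    then show ?case using elim by auto
  qed
qed

lemma measure_da_0: "measure da {0} = a 0"
proof -
  have "measure da {-1<..0} = a 0" using measure_da_Ioc[of "-1" 0] T_pos by (simp add: cdf_a_def)
  moreover have "AE t in da. t \<in> {-1<..0} \<longleftrightarrow> t \<in> {0}"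
    using AE_da_in by eventually_elim auto
  then have "measure da {-1<..0} = measure da {0}"
    by (intro measure_eq_AE) auto
  ultimately show ?thesis by simp
qed

text \<open>Under the convention \<open>a(0-) = 0\<close> the point \<open>0\<close> has mass \<open>a 0\<close>.\<close>

lemma integral_da_split:
  fixes g :: "real \<Rightarrow> real"
  assumes "integrable da (\<lambda>t. indicator {0..T} t * g t)"
  shows "set_integrable da {0<..T} g"
    and "(LINT t:{0..T}|da. g t) = a 0 * g 0 + (LINT t:{0<..T}|da. g t)"
proof -
  have eq: "indicator {0<..T} t *\<^sub>R g t = indicator {0<..T} t * (indicator {0..T} t * g t)" for t
    by (auto simp: indicator_def)
  have int: "integrable da (\<lambda>t. indicator {0<..T} t * (indicator {0..T} t * g t))"
    using integrable_mult_indicator[OF _ assms, of "{0<..T}"] by simp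
  then show 1: "set_integrable da {0<..T} g"
    unfolding set_integrable_def eq .
  have "(LINT t:{0..T}|da. g t) = (LINT t|da. g 0 * indicator {0} t + indicator {0<..T} t *\<^sub>R g t)"
    unfolding set_lebesgue_integral_def using T_pos
    by (intro Bochner_Integration.integral_cong) (auto simp: indicator_def)
  also have "\<dots> = g 0 * measure da {0} + (LINT t:{0<..T}|da. g t)"
  proof (subst Bochner_Integration.integral_add)
    show "integrable da (\<lambda>t. g 0 * indicator {0} t)"
      by (intro integrable_mult_right integrable_real_indicator) (auto simp: less_top[symmetric])
  qed (use 1 in \<open>auto simp: set_integrable_def set_lebesgue_integral_def\<close>)
  finally show "(LINT t:{0..T}|da. g t) = a 0 * g 0 + (LINT t:{0<..T}|da. g t)"
    by (simp add: measure_da_0 mult.commute)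
qed

lemma variation_sums_eq:
  assumes "t \<in> {0..T}"
  shows "variation_sums a t = {a t - a 0}"
proof (intro equalityI subsetI)
  fix v assume "v \<in> variation_sums a t"
  then obtain n s where v: "v = (\<Sum>i<n. \<bar>a (s (Suc i)) - a (s i)\<bar>)"
    and s: "s 0 = 0" "s n = t" "\<forall>i<n. s i \<le> s (Suc i)"
    by (auto simp: variation_sums_def)
  have mono: "i \<le> j \<Longrightarrow> j \<le> n \<Longrightarrow> s i \<le> s j" for i j :: nat
  proof (induction j rule: nat_induct_at_least[of i])
    case (Suc m)
    then show ?case using s(3)[rule_format, of m] by auto
  qed auto
  have "v = (\<Sum>i<n. a (s (Suc i)) - a (s i))"
    unfolding v
  proof (rule sum.cong[OF refl])
    fix i assume "i \<in> {..<n}"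
    then have "0 \<le> s i" "s i \<le> s (Suc i)" "s (Suc i) \<le> t"
      using mono[of 0 i] mono[of i "Suc i"] mono[of "Suc i" n] s by auto
    then show "\<bar>a (s (Suc i)) - a (s i)\<bar> = a (s (Suc i)) - a (s i)"
      using a_mono[of "s i" "s (Suc i)"] assms by auto
  qed
  also have "\<dots> = a t - a 0" by (subst sum_lessThan_telescope) (simp add: s)
  finally show "v \<in> {a t - a 0}" by simp
next
  fix v assume "v \<in> {a t - a 0}"
  then have "v = (\<Sum>i<1. \<bar>a ((if Suc i = 0 then 0 else t)) - a (if i = 0 then 0 else t)\<bar>)"
    using a_mono[of 0 t] assms by auto
  then show "v \<in> variation_sums a t"
    unfolding variation_sums_def using assms
    by (intro CollectI exI[of _ 1] exI[of _ "\<lambda>i. if i = 0 then 0 else t"]) auto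
qed

lemma total_variation_eq: "t \<in> {0..T} \<Longrightarrow> total_variation a t = a t - a 0"
  by (simp add: total_variation_def variation_sums_eq)

lemma finite_variation_a: "finite_variation T a"
  using T_pos by (simp add: finite_variation_def variation_sums_eq)

lemma stieltjes_measure_shift:
  fixes g :: "real \<Rightarrow> real"
  assumes y_eq: "\<And>t. t \<in> {0..T} \<Longrightarrow> y t = a t - a 0"
    and meas: "(\<lambda>t. indicator {0<..T} t *\<^sub>R g t) \<in> borel_measurable borel"
  shows "(LINT t:{0<..T}|stieltjes_measure T y. g t) = (LINT t:{0<..T}|da. g t)"
    and "set_integrable (stieltjes_measure T y) {0<..T} g \<longleftrightarrow> set_integrable da {0<..T} g"
proof -
  let ?G = "\<lambda>t. if t < 0 then 0 else a (min t T) - a 0"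
  have y: "stieltjes_measure T y = interval_measure ?G"
    unfolding stieltjes_measure_def using y_eq T_pos by (intro arg_cong[of _ _ interval_measure] ext) auto
  have eq: "density da (indicator {0<..}) = density (stieltjes_measure T y) (indicator {0<..})"
    unfolding da_eq y
  proof (rule density_interval_measure_shift[where c = "a 0"])
    show "x \<le> z \<Longrightarrow> ?G x \<le> ?G z" for x z
      using shifted_cdf_mono[of x z "a 0"] a_range[of 0] T_pos by simp
  qed (use cdf_a_mono cdf_a_right_cont shifted_cdf_right_cont in \<open>auto simp: cdf_a_def\<close>)
  have sets_y: "sets (stieltjes_measure T y) = sets borel" by (simp add: stieltjes_measure_def)
  have ind: "indicator {0<..T} t *\<^sub>R g t = indicator {0<..} t *\<^sub>R (indicator {0<..T} t *\<^sub>R g t)" for t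
    by (auto simp: indicator_def)
  have dens: "density N (indicator {0<..} :: real \<Rightarrow> ennreal) = density N (\<lambda>x. ennreal (indicator {0<..} x))" for N
    by (simp add: ennreal_indicator)
  have int_iff: "set_integrable N {0<..T} g \<longleftrightarrow> integrable (density N (indicator {0<..})) (\<lambda>t. indicator {0<..T} t *\<^sub>R g t)"
    if N: "sets N = sets borel" for N :: "real measure"
  proof -
    have "(\<lambda>t. indicator {0<..T} t *\<^sub>R g t) \<in> borel_measurable N"
      using meas measurable_cong_sets[OF N refl, of "borel :: real measure"] by simp
    moreover have "(indicator {0<..} :: real \<Rightarrow> real) \<in> borel_measurable N"
      using measurable_cong_sets[OF N refl, of "borel :: real measure"] by simp
    ultimately show ?thesis unfolding dens set_integrable_def
      using integrable_density[of "\<lambda>t. indicator {0<..T} t *\<^sub>R g t" N "indicator {0<..}"]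
      unfolding ind[symmetric] by simp
  qed
  show iff: "set_integrable (stieltjes_measure T y) {0<..T} g \<longleftrightarrow> set_integrable da {0<..T} g"
    using int_iff[OF sets_y] int_iff[OF sets_da] by (simp add: eq)
  have int_eq: "(LINT t:{0<..T}|N. g t) = integral\<^sup>L (density N (indicator {0<..})) (\<lambda>t. indicator {0<..T} t *\<^sub>R g t)"
    if N: "sets N = sets borel" for N :: "real measure"
  proof -
    have "(\<lambda>t. indicator {0<..T} t *\<^sub>R g t) \<in> borel_measurable N"
      using meas measurable_cong_sets[OF N refl, of "borel :: real measure"] by simp
    moreover have "(indicator {0<..} :: real \<Rightarrow> real) \<in> borel_measurable N"
      using measurable_cong_sets[OF N refl, of "borel :: real measure"] by simp
    ultimately show ?thesis unfolding dens set_lebesgue_integral_def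
      using integral_density[of "\<lambda>t. indicator {0<..T} t *\<^sub>R g t" N "indicator {0<..}"]
      unfolding ind[symmetric] by simp
  qed
  show "(LINT t:{0<..T}|stieltjes_measure T y. g t) = (LINT t:{0<..T}|da. g t)"
    unfolding int_eq[OF sets_y] int_eq[OF sets_da] by (simp add: eq)
qed

lemma stieltjes_integrable_iff:
  fixes g :: "real \<Rightarrow> real"
  assumes "(\<lambda>t. indicator {0<..T} t *\<^sub>R g t) \<in> borel_measurable borel"
  shows "stieltjes_integrable T a g \<longleftrightarrow> set_integrable da {0<..T} g"
  unfolding stieltjes_integrable_def
  by (rule stieltjes_measure_shift(2)[OF _ assms]) (rule total_variation_eq)

text \<open>The path \<open>a\<close> is nondecreasing, so its negative variation vanishes, and its positive variation
  \<open>a - a 0\<close> differs from \<open>a\<close> only in the mass at \<open>0\<close>.\<close>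

lemma stieltjes_integral_eq:
  fixes g :: "real \<Rightarrow> real"
  assumes "(\<lambda>t. indicator {0<..T} t *\<^sub>R g t) \<in> borel_measurable borel"
  shows "stieltjes_integral T a g = (LINT t:{0<..T}|da. g t)"
proof -
  have "stieltjes_measure T (\<lambda>t. (total_variation a t - (a t - a 0)) / 2) = interval_measure (\<lambda>t. 0)"
    unfolding stieltjes_measure_def using T_pos
    by (intro arg_cong[of _ _ interval_measure] ext) (auto simp: total_variation_eq)
  then have "(LINT t:{0<..T}|stieltjes_measure T (\<lambda>t. (total_variation a t - (a t - a 0)) / 2). g t) = 0"
    unfolding set_lebesgue_integral_def
    by (intro integral_eq_zero_AE) (auto intro!: AE_I[of _ _ UNIV] simp: emeasure_interval_measure_eq_const)
  moreover have "(LINT t:{0<..T}|stieltjes_measure T (\<lambda>t. (total_variation a t + (a t - a 0)) / 2). g t) =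
      (LINT t:{0<..T}|da. g t)"
    by (rule stieltjes_measure_shift(1)[OF _ assms]) (simp add: total_variation_eq)
  ultimately show ?thesis by (simp add: stieltjes_integral_def)
qed

end

section \<open>The pathwise inequality\<close>

text \<open>Compactness of \<open>[0, T]\<close>, in the form of the bisection argument of Bolzano.\<close>

lemma bounded_if_one_sided_bounded:
  fixes g :: "real \<Rightarrow> real"
  assumes T: "0 \<le> T"
    and right: "\<And>t. t \<in> {0..<T} \<Longrightarrow> \<exists>C. \<forall>\<^sub>F s in at_right t. \<bar>g s\<bar> \<le> C"
    and left: "\<And>t. t \<in> {0<..T} \<Longrightarrow> \<exists>C. \<forall>\<^sub>F s in at_left t. \<bar>g s\<bar> \<le> C"
  shows "\<exists>C. \<forall>t\<in>{0..T}. \<bar>g t\<bar> \<le> C"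
proof -
  define P where "P p q \<longleftrightarrow> (\<exists>C. \<forall>t\<in>{p..q} \<inter> {0..T}. \<bar>g t\<bar> \<le> C)" for p q
  have "P 0 T"
  proof (rule Bolzano[OF T])
    fix p q r assume "P p q" "P q r" "p \<le> q" "q \<le> r"
    then obtain C D where "\<forall>t\<in>{p..q} \<inter> {0..T}. \<bar>g t\<bar> \<le> C" "\<forall>t\<in>{q..r} \<inter> {0..T}. \<bar>g t\<bar> \<le> D"
      by (auto simp: P_def)
    then show "P p r" unfolding P_def
      by (intro exI[of _ "max C D"] ballI) (metis (no_types) IntE IntI atLeastAtMost_iff le_max_iff_disj linear)
  next
    fix t assume t: "0 \<le> t" "t \<le> T"
    obtain C d where C: "d > 0" "\<And>s. t < s \<Longrightarrow> s < t + d \<Longrightarrow> s \<le> T \<Longrightarrow> \<bar>g s\<bar> \<le> C"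
    proof (cases "t = T")
      case True then show thesis using that[of 1] by auto
    next
      case False
      then obtain C where "\<forall>\<^sub>F s in at_right t. \<bar>g s\<bar> \<le> C" using right[of t] t by auto
      then obtain b where "b > t" "\<forall>y>t. y < b \<longrightarrow> \<bar>g y\<bar> \<le> C" by (auto simp: eventually_at_right_field)
      then show thesis using that[of "b - t" C] by auto
    qed
    obtain D e where D: "e > 0" "\<And>s. s < t \<Longrightarrow> t - e < s \<Longrightarrow> 0 \<le> s \<Longrightarrow> \<bar>g s\<bar> \<le> D"
    proof (cases "t = 0")
      case True then show thesis using that[of 1] by auto
    next
      case False
      then obtain D where "\<forall>\<^sub>F s in at_left t. \<bar>g s\<bar> \<le> D" using left[of t] t by auto
      then obtain b where "b < t" "\<forall>y>b. y < t \<longrightarrow> \<bar>g y\<bar> \<le> D" by (auto simp: eventually_at_left_field)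
      then show thesis using that[of "t - b" D] by auto
    qed
    show "\<exists>d>0. \<forall>p q. p \<le> t \<and> t \<le> q \<and> q - p < d \<longrightarrow> P p q"
    proof (intro exI[of _ "min d e"] conjI allI impI)
      show "0 < min d e" using C D by simp
      fix p q assume pq: "p \<le> t \<and> t \<le> q \<and> q - p < min d e"
      show "P p q" unfolding P_def
      proof (intro exI[of _ "max (max C D) \<bar>g t\<bar>"] ballI)
        fix s assume s: "s \<in> {p..q} \<inter> {0..T}"
        consider "s < t" | "s = t" | "t < s" by linarith
        then show "\<bar>g s\<bar> \<le> max (max C D) \<bar>g t\<bar>"
        proof cases
          case 1
          then have "\<bar>g s\<bar> \<le> D" using D(2)[of s] s pq by auto
          then show ?thesis by auto
        next
          case 3
          then have "\<bar>g s\<bar> \<le> C" using C(2)[of s] s pq by auto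
          then show ?thesis by auto
        qed simp
      qed
    qed
  qed
  then show ?thesis by (auto simp: P_def)
qed

lemma tendsto_imp_eventually_bounded:
  fixes w :: "'a \<Rightarrow> real"
  assumes "(w \<longlongrightarrow> l) Fl"
  shows "\<forall>\<^sub>F s in Fl. \<bar>w s\<bar> \<le> \<bar>l\<bar> + 1"
  using tendstoD[OF assms zero_less_one] by eventually_elim (auto simp: dist_real_def)

lemma cadlag_bounded:
  fixes w :: "real \<Rightarrow> real"
  assumes "0 \<le> T" "cadlag_on T w"
  shows "\<exists>C. \<forall>t\<in>{0..T}. \<bar>w t\<bar> \<le> C"
proof (rule bounded_if_one_sided_bounded[OF assms(1)])
  fix t assume "t \<in> {0..<T}"
  then have "(w \<longlongrightarrow> w t) (at_right t)" using assms(2) by (auto simp: cadlag_on_def)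
  then show "\<exists>C. \<forall>\<^sub>F s in at_right t. \<bar>w s\<bar> \<le> C" using tendsto_imp_eventually_bounded by blast
next
  fix t assume "t \<in> {0<..T}"
  then obtain l where "(w \<longlongrightarrow> l) (at_left t)" using assms(2) unfolding cadlag_on_def by blast
  then show "\<exists>C. \<forall>\<^sub>F s in at_left t. \<bar>w s\<bar> \<le> C" using tendsto_imp_eventually_bounded by blast
qed

locale hedge_functions = interval_domain +
  fixes phi psi phi' psi' :: "real \<Rightarrow> real"
  assumes super: "\<And>x y. x \<in> I \<Longrightarrow> y \<in> J \<Longrightarrow> phi y \<le> phi x + phi' x * (y - x)"
    and sub: "\<And>x y. x \<in> I \<Longrightarrow> y \<in> J \<Longrightarrow> psi x + psi' x * (y - x) \<le> psi y"
    and deriv_off: "\<And>x. x \<notin> I \<Longrightarrow> phi' x = 0 \<and> psi' x = 0"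
    and phi'_measurable [measurable]: "phi' \<in> borel_measurable borel"
    and psi'_measurable [measurable]: "psi' \<in> borel_measurable borel"
begin

lemma psi'_mono:
  assumes "x \<in> I" "y \<in> I"
  shows "0 \<le> (psi' y - psi' x) * (y - x)"
proof -
  have "x \<in> J" "y \<in> J" using assms I_subset_J by auto
  then show ?thesis using sub[OF assms(1), of y] sub[OF assms(2), of x] by (simp add: algebra_simps)
qed

lemma psi'_locally_bounded:
  assumes x: "x \<in> I"
  obtains e C where "e > 0" "\<And>y. \<bar>y - x\<bar> < e \<Longrightarrow> \<bar>psi' y\<bar> \<le> C"
proof -
  obtain e where e: "e > 0" "\<And>y. \<bar>y - x\<bar> < e \<Longrightarrow> y \<in> I" using ball_in_I[OF x] by blast
  define p q where "p = x - e / 2" and "q = x + e / 2"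
  have pq: "p \<in> I" "q \<in> I" using e by (auto simp: p_def q_def)
  have "\<bar>psi' y\<bar> \<le> \<bar>psi' p\<bar> + \<bar>psi' q\<bar>" if y: "\<bar>y - x\<bar> < e / 2" for y
  proof -
    have yI: "y \<in> I" using e(1) y by (intro e(2)) linarith
    have "0 < y - p" "0 < q - y" using y unfolding p_def q_def by linarith+
    then have "psi' p \<le> psi' y" "psi' y \<le> psi' q"
      using psi'_mono[OF pq(1) yI] psi'_mono[OF yI pq(2)] by (auto simp: zero_le_mult_iff)
    then show ?thesis by linarith
  qed
  then show thesis using that[of "e / 2" "\<bar>psi' p\<bar> + \<bar>psi' q\<bar>"] e by auto
qed

text \<open>Close to the frontier \<open>\<psi>'\<close> may be unbounded, but \<open>\<psi>'(x) (l - x)\<close> is squeezed between the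
  tangents at \<open>x\<^sub>0\<close> and at \<open>x\<close>.\<close>

lemma psi'_frontier_bound:
  assumes x0: "x0 \<in> I" and l: "l \<in> frontier I" "l \<in> J"
    and x: "\<bar>x - l\<bar> < \<bar>x0 - l\<bar>" "\<bar>x\<bar> \<le> B" "\<bar>l\<bar> \<le> B" "\<bar>x0\<bar> \<le> B"
  shows "\<bar>psi' x * (l - x)\<bar> \<le> \<bar>psi l\<bar> + \<bar>psi x0\<bar> + \<bar>psi' x0\<bar> * (2 * B)"
proof (cases "x \<in> I")
  case True
  have xJ: "x \<in> J" using True I_subset_J by auto
  have diff: "\<bar>psi' x0 * (y - z)\<bar> \<le> \<bar>psi' x0\<bar> * (2 * B)" if "\<bar>y\<bar> \<le> B" "\<bar>z\<bar> \<le> B" for y z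
    unfolding abs_mult using that by (intro mult_left_mono) auto
  have "psi' x * (l - x) \<le> psi l - psi x0 - psi' x0 * (x - x0)"
    using sub[OF True l(2)] sub[OF x0 xJ] by simp
  then have up: "psi' x * (l - x) \<le> \<bar>psi l\<bar> + \<bar>psi x0\<bar> + \<bar>psi' x0\<bar> * (2 * B)"
    using abs_le_D2[OF diff[OF x(2,4)]] abs_ge_self[of "psi l"] abs_ge_minus_self[of "psi x0"] by linarith
  have ne: "I \<noteq> {}" using x0 by auto
  have "0 \<le> (psi' x - psi' x0) * (l - x)"
    using frontier_open_interval[OF open_I connected_I ne l(1)]
  proof
    assume "\<forall>z\<in>I. z < l"
    then have "x < l" "x0 < l" using True x0 by auto
    then have "0 < l - x" "0 < x - x0" using x(1) by linarith+
    then show ?thesis using psi'_mono[OF x0 True] by (simp add: zero_le_mult_iff)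
  next
    assume "\<forall>z\<in>I. l < z"
    then have "l < x" "l < x0" using True x0 by auto
    then have "l - x < 0" "x - x0 < 0" using x(1) by linarith+
    then show ?thesis using psi'_mono[OF x0 True] by (simp add: zero_le_mult_iff)
  qed
  then have "psi' x0 * (l - x) \<le> psi' x * (l - x)" by (simp add: algebra_simps)
  then have "- (\<bar>psi' x0\<bar> * (2 * B)) \<le> psi' x * (l - x)"
    using abs_le_D2[OF diff[OF x(3,2)]] by linarith
  with up show ?thesis by linarith
next
  case False
  have "0 \<le> B" using x by linarith
  then show ?thesis using deriv_off[OF False] by simp
qed

end

locale hedge_path = hedge_functions + averaging_path +
  fixes \<omega> :: path
  assumes relevant: "\<omega> \<in> relevant_paths T I J"
begin

lemma cadlag_omega: "cadlag_on T \<omega>"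
  using relevant by (auto simp: relevant_paths_def cadlag_paths_def)

lemma start_I: "\<omega> 0 \<in> I"
  using relevant by (auto simp: relevant_paths_def)

lemma path_in_J: "t \<in> {0..T} \<Longrightarrow> \<omega> t \<in> J"
  using relevant I_subset_J by (cases "t = 0") (auto simp: relevant_paths_def)

lemma end_J: "\<omega> T \<in> J"
  using path_in_J T_pos by auto

lemma stuck: "t \<in> {0..T} \<Longrightarrow> \<omega> t \<notin> I \<Longrightarrow> u \<in> {t..T} \<Longrightarrow> \<omega> u = \<omega> t"
  using relevant path_in_J[of t] J_diff_I frontier_J by (auto simp: relevant_paths_def)

lemma left_limit_stuck:
  assumes "t \<in> {0<..T}" "(\<omega> \<longlongrightarrow> l) (at_left t)" "l \<in> frontier I"
  shows "\<omega> T = l"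
proof -
  have "Lim (at_left t) \<omega> = l" using assms(2) by (intro tendsto_Lim) auto
  then show ?thesis using relevant assms(1,3) frontier_J by (auto simp: relevant_paths_def)
qed

lemma path_bounded: obtains B where "\<And>t. t \<in> {0..T} \<Longrightarrow> \<bar>\<omega> t\<bar> \<le> B"
  using cadlag_bounded[OF less_imp_le[OF T_pos] cadlag_omega] by blast

text \<open>Near a time at which the path has its one-sided limit in \<open>I\<close>, the function \<open>\<psi>'\<close> is bounded along the
  path. A one-sided limit at an endpoint of \<open>I\<close> is also the final value of a relevant path, so that
  the bound for \<open>\<psi>'(x) (l - x)\<close> applies.\<close>

lemma integrand_bounded: "\<exists>C. \<forall>t\<in>{0..T}. \<bar>psi' (\<omega> t) * (\<omega> T - \<omega> t)\<bar> \<le> C"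
proof -
  obtain B where B: "\<And>t. t \<in> {0..T} \<Longrightarrow> \<bar>\<omega> t\<bar> \<le> B" using path_bounded by blast
  have inI: "\<exists>C. \<forall>\<^sub>F s in Fl. \<bar>psi' (\<omega> s) * (\<omega> T - \<omega> s)\<bar> \<le> C"
    if lim: "(\<omega> \<longlongrightarrow> l) Fl" and l: "l \<in> I" and ev: "\<forall>\<^sub>F s in Fl. s \<in> {0..T}" for l Fl
  proof -
    obtain e C where eC: "e > 0" "\<And>y. \<bar>y - l\<bar> < e \<Longrightarrow> \<bar>psi' y\<bar> \<le> C"
      using psi'_locally_bounded[OF l] by blast
    have "\<forall>\<^sub>F s in Fl. \<bar>psi' (\<omega> s) * (\<omega> T - \<omega> s)\<bar> \<le> C * (2 * B)"
      using tendstoD[OF lim eC(1)] ev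
    proof eventually_elim
      case (elim s)
      then have "\<bar>psi' (\<omega> s)\<bar> \<le> C" using eC(2) by (simp add: dist_real_def)
      moreover have "\<bar>\<omega> T - \<omega> s\<bar> \<le> 2 * B" using B[of T] B[of s] elim T_pos by auto
      ultimately show ?case unfolding abs_mult by (intro mult_mono) auto
    qed
    then show ?thesis by blast
  qed
  show ?thesis
  proof (rule bounded_if_one_sided_bounded)
    fix t assume t: "t \<in> {0..<T}"
    then have lim: "(\<omega> \<longlongrightarrow> \<omega> t) (at_right t)" using cadlag_omega by (auto simp: cadlag_on_def)
    have ev: "\<forall>\<^sub>F s in at_right t. t < s \<and> s < T"
      using t by (auto simp: eventually_at_right_field intro!: exI[of _ T])
    show "\<exists>C. \<forall>\<^sub>F s in at_right t. \<bar>psi' (\<omega> s) * (\<omega> T - \<omega> s)\<bar> \<le> C"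
    proof (cases "\<omega> t \<in> I")
      case True
      have "\<forall>\<^sub>F s in at_right t. s \<in> {0..T}" using ev by eventually_elim (use t in auto)
      then show ?thesis using inI[OF lim True] by simp
    next
      case False
      have "\<forall>\<^sub>F s in at_right t. \<bar>psi' (\<omega> s) * (\<omega> T - \<omega> s)\<bar> \<le> 0"
        using ev
      proof eventually_elim
        case (elim s)
        then show ?case using stuck[OF _ False, of s] stuck[OF _ False, of T] t by auto
      qed
      then show ?thesis by blast
    qed
  next
    fix t assume t: "t \<in> {0<..T}"
    then obtain l where lim: "(\<omega> \<longlongrightarrow> l) (at_left t)" using cadlag_omega unfolding cadlag_on_def by blast
    have ev: "\<forall>\<^sub>F s in at_left t. s \<in> {0..T}"
      using t by (auto simp: eventually_at_left_field intro!: exI[of _ 0])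
    show "\<exists>C. \<forall>\<^sub>F s in at_left t. \<bar>psi' (\<omega> s) * (\<omega> T - \<omega> s)\<bar> \<le> C"
    proof (cases "l \<in> I")
      case True
      then show ?thesis using inI[OF lim _ ev] by simp
    next
      case False
      have "\<forall>\<^sub>F s in at_left t. \<omega> s \<in> closure I"
        using ev by eventually_elim (use path_in_J J_subset_closure in auto)
      then have "l \<in> closure I"
        by (rule Lim_in_closed_set[OF closed_closure _ _ lim]) auto
      then have l: "l \<in> frontier I" using False open_I by (simp add: frontier_def interior_open)
      then have lT: "\<omega> T = l" using left_limit_stuck[OF t lim] by simp
      have "\<omega> 0 \<noteq> l" using False start_I by auto
      then have "\<forall>\<^sub>F s in at_left t. \<bar>\<omega> s - l\<bar> < \<bar>\<omega> 0 - l\<bar>"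
        using tendstoD[OF lim, of "\<bar>\<omega> 0 - l\<bar>"] by (simp add: dist_real_def)
      then have "\<forall>\<^sub>F s in at_left t. \<bar>psi' (\<omega> s) * (\<omega> T - \<omega> s)\<bar> \<le>
          \<bar>psi l\<bar> + \<bar>psi (\<omega> 0)\<bar> + \<bar>psi' (\<omega> 0)\<bar> * (2 * B)"
        using ev
      proof eventually_elim
        case (elim s)
        show ?case unfolding lT
          by (rule psi'_frontier_bound[OF start_I l]) (use lT end_J elim B[of s] B[of 0] B[of T] T_pos in auto)
      qed
      then show ?thesis by blast
    qed
  qed (use T_pos in simp)
qed

lemma measurable_path: "(\<lambda>t. indicator {0..T} t * \<omega> t) \<in> borel_measurable borel"
  by (rule borel_measurable_cadlag[OF cadlag_omega])

lemma measurable_path_compose: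
  assumes f: "(\<lambda>x. f x :: real) \<in> borel_measurable borel"
  shows "(\<lambda>t. indicator {0..T} t * f (\<omega> t)) \<in> borel_measurable borel"
proof -
  have "(\<lambda>t. indicator {0..T} t * f (indicator {0..T} t * \<omega> t)) \<in> borel_measurable borel"
    using measurable_compose[OF measurable_path f] by simp
  moreover have "indicator {0..T} t * f (indicator {0..T} t * \<omega> t) = indicator {0..T} t * f (\<omega> t)" for t
    by (auto simp: indicator_def)
  ultimately show ?thesis by simp
qed

lemma integrable_da_bounded:
  assumes "(\<lambda>t. indicator {0..T} t * g t) \<in> borel_measurable borel"
    and "\<And>t. t \<in> {0..T} \<Longrightarrow> \<bar>g t\<bar> \<le> (C :: real)"
  shows "integrable da (\<lambda>t. indicator {0..T} t * g t)"
proof (rule da.integrable_const_bound[of _ "max C 0"])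
  show "AE t in da. norm (indicator {0..T} t * g t) \<le> max C 0"
    using assms(2) by (intro AE_I2) (force simp: indicator_def)
qed (use assms(1) in simp)

lemma integrable_path: "integrable da (\<lambda>t. indicator {0..T} t * \<omega> t)"
proof -
  obtain B where B: "\<And>t. t \<in> {0..T} \<Longrightarrow> \<bar>\<omega> t\<bar> \<le> B" using path_bounded by blast
  show ?thesis by (rule integrable_da_bounded[OF measurable_path B])
qed

lemma measurable_integrand:
  "(\<lambda>t. indicator {0..T} t * (psi' (\<omega> t) * (\<omega> T - \<omega> t))) \<in> borel_measurable borel"
  by (rule measurable_path_compose) measurable

lemma integrable_integrand:
  "integrable da (\<lambda>t. indicator {0..T} t * (psi' (\<omega> t) * (\<omega> T - \<omega> t)))"
  using integrand_bounded integrable_da_bounded[OF measurable_integrand] by blast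

abbreviation avg :: real where "avg \<equiv> path_average T a \<omega>"

text \<open>The part of the gain that comes from \<open>\<psi>'\<close>, with the opposite sign.\<close>

definition cost :: real where
  "cost = (LINT t:{0..T}|da. psi' (\<omega> t) * (\<omega> T - \<omega> t))"

lemma avg_eq: "avg = (LINT t|da. indicator {0..T} t * \<omega> t)"
  by (simp add: path_average_def set_lebesgue_integral_def)

lemma measure_da_UNIV: "measure da UNIV = 1"
  using da.prob_space by simp

lemma avg_in_J: "avg \<in> J"
proof (rule ccontr)
  assume no: "avg \<notin> J"
  have zero: "(LINT t|da. indicator {0..T} t * \<omega> t - avg) = 0"
    using integrable_path by (simp add: avg_eq measure_da_UNIV)
  have int: "integrable da (\<lambda>t. indicator {0..T} t * \<omega> t - avg)"
    using integrable_path by simp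
  have "(\<forall>x\<in>J. avg < x) \<or> (\<forall>x\<in>J. x < avg)"
  proof (rule ccontr)
    assume "\<not> ?thesis"
    then obtain p q where "p \<in> J" "q \<in> J" "p \<le> avg" "avg \<le> q" by (auto simp: not_less)
    then show False using connected_contains_Icc[OF connected_J, of p q] no by auto
  qed
  then show False
  proof
    assume *: "\<forall>x\<in>J. avg < x"
    have "AE t in da. 0 < indicator {0..T} t * \<omega> t - avg"
      using AE_da_in by eventually_elim (use * path_in_J in simp)
    then have "(LINT t|da. 0) < (LINT t|da. indicator {0..T} t * \<omega> t - avg)"
      using int da.emeasure_space_1 by (intro da.integral_less_AE_space) auto
    with zero show False by simp
  next
    assume *: "\<forall>x\<in>J. x < avg"
    have "AE t in da. indicator {0..T} t * \<omega> t - avg < 0"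
      using AE_da_in by eventually_elim (use * path_in_J in simp)
    then have "(LINT t|da. indicator {0..T} t * \<omega> t - avg) < (LINT t|da. 0)"
      using int da.emeasure_space_1 by (intro da.integral_less_AE_space) auto
    with zero show False by simp
  qed
qed

lemma tangent_at_path:
  assumes t: "t \<in> {0..T}"
  shows "psi (\<omega> t) + psi' (\<omega> t) * (\<omega> T - \<omega> t) \<le> psi (\<omega> T)"
proof (cases "\<omega> t \<in> I")
  case True
  then show ?thesis using sub[OF True end_J] by simp
next
  case False
  then have "\<omega> T = \<omega> t" using stuck[OF t False, of T] t by auto
  then show ?thesis by simp
qed

text \<open>Jensen's inequality in the form that the hedge needs: integrate the tangent of \<open>\<psi>\<close> at the
  average, where the path stays above it, and the tangents at \<open>\<omega>\<^sub>t\<close> evaluated at \<open>\<omega>\<^sub>T\<close>. An average at an endpoint of \<open>I\<close> has no tangent there, but then the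
  path sits in this endpoint for almost all times, and \<open>cost\<close> vanishes.\<close>

lemma psi_avg_le: "psi avg \<le> psi (\<omega> T) - cost"
proof (cases "avg \<in> I")
  case True
  have "(LINT t|da. psi avg + psi' avg * (indicator {0..T} t * \<omega> t - avg)) \<le>
      (LINT t|da. psi (\<omega> T) - indicator {0..T} t * (psi' (\<omega> t) * (\<omega> T - \<omega> t)))"
  proof (rule integral_mono_AE)
    show "AE t in da. psi avg + psi' avg * (indicator {0..T} t * \<omega> t - avg) \<le>
        psi (\<omega> T) - indicator {0..T} t * (psi' (\<omega> t) * (\<omega> T - \<omega> t))"
      using AE_da_in
    proof eventually_elim
      case (elim t)
      then show ?case using sub[OF True path_in_J[OF elim]] tangent_at_path[OF elim] by simp
    qed
  qed (use integrable_path integrable_integrand in auto)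
  also have "\<dots> = psi (\<omega> T) - cost"
    using integrable_integrand by (simp add: cost_def set_lebesgue_integral_def measure_da_UNIV)
  also have "(LINT t|da. psi avg + psi' avg * (indicator {0..T} t * \<omega> t - avg)) = psi avg"
    using integrable_path by (simp add: avg_eq measure_da_UNIV)
  finally show ?thesis .
next
  case False
  have ne: "I \<noteq> {}" using start_I by auto
  have front: "avg \<in> frontier I" using False avg_in_J J_diff_I by auto
  have zero: "(LINT t|da. indicator {0..T} t * \<omega> t - avg) = 0"
    using integrable_path by (simp add: avg_eq measure_da_UNIV)
  have int: "integrable da (\<lambda>t. indicator {0..T} t * \<omega> t - avg)"
    using integrable_path by simp
  have cl: "\<omega> t \<in> closure I" if "t \<in> {0..T}" for t using path_in_J[OF that] J_subset_closure by auto
  have "AE t in da. indicator {0..T} t * \<omega> t - avg = 0"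
    using frontier_open_interval[OF open_I connected_I ne front]
  proof
    assume *: "\<forall>x\<in>I. x < avg"
    have "closure I \<subseteq> {..avg}" using * by (intro closure_minimal) (auto intro: less_imp_le)
    have "AE t in da. 0 \<le> - (indicator {0..T} t * \<omega> t - avg)"
      using AE_da_in
    proof eventually_elim
      case (elim t)
      then show ?case using cl[OF elim] \<open>closure I \<subseteq> {..avg}\<close> by auto
    qed
    moreover have "(LINT t|da. - (indicator {0..T} t * \<omega> t - avg)) = 0"
      unfolding Bochner_Integration.integral_minus using zero by simp
    ultimately have "AE t in da. - (indicator {0..T} t * \<omega> t - avg) = 0"
      using integral_nonneg_eq_0_iff_AE[OF Bochner_Integration.integrable_minus[OF int]] by blast
    then show ?thesis by eventually_elim simp
  next
    assume *: "\<forall>x\<in>I. avg < x"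
    have "closure I \<subseteq> {avg..}" using * by (intro closure_minimal) (auto intro: less_imp_le)
    have "AE t in da. 0 \<le> indicator {0..T} t * \<omega> t - avg"
      using AE_da_in
    proof eventually_elim
      case (elim t)
      then show ?case using cl[OF elim] \<open>closure I \<subseteq> {avg..}\<close> by auto
    qed
    then show ?thesis
      using integral_nonneg_eq_0_iff_AE[OF int] zero by blast
  qed
  then have ae: "AE t in da. t \<in> {0..T} \<and> \<omega> t = avg"
    using AE_da_in by eventually_elim auto
  have "\<exists>t\<in>{0..T}. \<omega> t = avg"
  proof (rule ccontr)
    assume no: "\<not> ?thesis"
    have "AE t in da. False" using ae by eventually_elim (use no in auto)
    then show False using da.AE_False by simp
  qed
  then have end_avg: "\<omega> T = avg" using stuck[of _ T] False by force
  have "cost = (LINT t|da. 0)"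
    unfolding cost_def set_lebesgue_integral_def
  proof (rule integral_cong_AE)
    show "AE t in da. indicator {0..T} t *\<^sub>R (psi' (\<omega> t) * (\<omega> T - \<omega> t)) = 0"
      using ae by eventually_elim (simp add: end_avg)
  qed (use measurable_integrand in auto)
  then show ?thesis by (simp add: end_avg)
qed

context
  fixes hh :: "real \<Rightarrow> real"
  assumes hh0: "hh 0 = phi' (\<omega> 0) * (1 - a 0) - psi' (\<omega> 0) * a 0"
    and hht: "\<And>t. t \<in> {0<..T} \<Longrightarrow> hh t = - phi' (\<omega> 0) - psi' (\<omega> t)"
begin

lemma hedge_measurable: "(\<lambda>t. indicator {0<..T} t *\<^sub>R ((\<omega> T - \<omega> t) * hh t)) \<in> borel_measurable borel"
proof -
  have "(\<lambda>t. indicator {0<..T} t * (indicator {0..T} t * ((\<omega> T - \<omega> t) * (- phi' (\<omega> 0) - psi' (\<omega> t)))))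
      \<in> borel_measurable borel"
    using measurable_path_compose[of "\<lambda>x. (\<omega> T - x) * (- phi' (\<omega> 0) - psi' x)"] by measurable
  then show ?thesis
    by (rule measurable_cong[THEN iffD1, rotated]) (auto simp: indicator_def hht)
qed

lemma integrable_hedge:
  "integrable da (\<lambda>t. indicator {0..T} t * ((\<omega> T - \<omega> t) * (- phi' (\<omega> 0) - psi' (\<omega> t))))"
proof -
  have "integrable da (\<lambda>t. - phi' (\<omega> 0) * (indicator {0..T} t * \<omega> T - indicator {0..T} t * \<omega> t) -
      indicator {0..T} t * (psi' (\<omega> t) * (\<omega> T - \<omega> t)))"
    using integrable_path integrable_integrand
      integrable_da_bounded[of "\<lambda>t. \<omega> T" "\<bar>\<omega> T\<bar>"]
    by (intro Bochner_Integration.integrable_diff integrable_mult_right) auto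
  then show ?thesis by (simp add: algebra_simps)
qed

lemma hedge_stieltjes_integrable: "stieltjes_integrable T a (\<lambda>t. (\<omega> T - \<omega> t) * hh t)"
proof -
  have "set_integrable da {0<..T} (\<lambda>t. (\<omega> T - \<omega> t) * (- phi' (\<omega> 0) - psi' (\<omega> t)))"
    by (rule integral_da_split[OF integrable_hedge])
  then have "set_integrable da {0<..T} (\<lambda>t. (\<omega> T - \<omega> t) * hh t)"
    by (rule set_integrable_cong[THEN iffD1, rotated 3]) (auto simp: hht)
  then show ?thesis using stieltjes_integrable_iff[OF hedge_measurable] by simp
qed

text \<open>The position at time \<open>0\<close> carries \<open>1 - a 0\<close> and \<open>a 0\<close> because the integral over \<open>(0, T]\<close> misses the
  mass \<open>a 0\<close> at time \<open>0\<close>.\<close>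

lemma hedge_gain:
  "(\<omega> T - \<omega> 0) * hh 0 + stieltjes_integral T a (\<lambda>t. (\<omega> T - \<omega> t) * hh t) =
    phi' (\<omega> 0) * (avg - \<omega> 0) - cost"
proof -
  define k where "k t = (\<omega> T - \<omega> t) * (- phi' (\<omega> 0) - psi' (\<omega> t))" for t
  have ind: "AE t in da. indicator {0..T} t = (1::real)" using AE_da_in by eventually_elim simp
  have "stieltjes_integral T a (\<lambda>t. (\<omega> T - \<omega> t) * hh t) = (LINT t:{0<..T}|da. k t)"
    unfolding stieltjes_integral_eq[OF hedge_measurable]
    by (rule set_lebesgue_integral_cong) (auto simp: k_def hht)
  also have "\<dots> = (LINT t:{0..T}|da. k t) - a 0 * k 0"
    using integral_da_split(2)[of k] integrable_hedge by (simp add: k_def)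
  also have "(LINT t:{0..T}|da. k t) =
      (LINT t|da. - phi' (\<omega> 0) * (\<omega> T - indicator {0..T} t * \<omega> t) - indicator {0..T} t * (psi' (\<omega> t) * (\<omega> T - \<omega> t)))"
    unfolding set_lebesgue_integral_def
  proof (rule integral_cong_AE)
    show "(\<lambda>t. indicator {0..T} t *\<^sub>R k t) \<in> borel_measurable da"
      using integrable_hedge by (auto simp: k_def dest: borel_measurable_integrable)
    show "(\<lambda>t. - phi' (\<omega> 0) * (\<omega> T - indicator {0..T} t * \<omega> t) - indicator {0..T} t * (psi' (\<omega> t) * (\<omega> T - \<omega> t)))
        \<in> borel_measurable da"
      using measurable_path measurable_integrand by simp
    show "AE t in da. indicator {0..T} t *\<^sub>R k t =
        - phi' (\<omega> 0) * (\<omega> T - indicator {0..T} t * \<omega> t) - indicator {0..T} t * (psi' (\<omega> t) * (\<omega> T - \<omega> t))"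
      using ind by eventually_elim (simp add: k_def algebra_simps)
  qed
  also have "\<dots> = - phi' (\<omega> 0) * (\<omega> T - avg) - cost"
    using integrable_path integrable_integrand
    by (simp add: cost_def set_lebesgue_integral_def avg_eq measure_da_UNIV)
  finally show ?thesis by (simp add: k_def hh0 algebra_simps)
qed

end

end

section \<open>Martingales with cadlag paths\<close>

lemma integrable_times_bounded:
  fixes k \<eta> :: "'a \<Rightarrow> real"
  assumes k: "integrable M k" and \<eta>: "\<eta> \<in> borel_measurable M"
    and bound: "\<And>x. x \<in> space M \<Longrightarrow> \<bar>\<eta> x\<bar> \<le> C"
  shows "integrable M (\<lambda>x. k x * \<eta> x)"
proof (rule Bochner_Integration.integrable_bound)
  show "integrable M (\<lambda>x. C * k x)" using k by simp
  show "(\<lambda>x. k x * \<eta> x) \<in> borel_measurable M" using k \<eta> by (intro borel_measurable_times) auto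
  show "AE x in M. norm (k x * \<eta> x) \<le> norm (C * k x)"
  proof (rule AE_I2)
    fix x assume "x \<in> space M"
    then have "\<bar>\<eta> x\<bar> * \<bar>k x\<bar> \<le> \<bar>C\<bar> * \<bar>k x\<bar>" using bound[of x] by (intro mult_right_mono) auto
    then show "norm (k x * \<eta> x) \<le> norm (C * k x)" by (simp add: abs_mult mult.commute)
  qed
qed

lemma raw_filtration_coordinate:
  assumes "s \<in> {0..t}"
  shows "(\<lambda>w. Z w s) \<in> borel_measurable (raw_filtration S Z t)"
proof (rule measurableI)
  have sub: "{(\<lambda>w. Z w s) -` B \<inter> S | s B. s \<in> {0..t} \<and> B \<in> sets borel} \<subseteq> Pow S" by auto
  fix A assume "A \<in> sets (borel :: 'b measure)"
  then show "(\<lambda>w. Z w s) -` A \<inter> space (raw_filtration S Z t) \<in> sets (raw_filtration S Z t)"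
    unfolding raw_filtration_def using assms sub
    by (simp add: space_measure_of sets_measure_of) (blast intro: sigma_sets.Basic)
qed simp

lemma space_raw_filtration [simp]: "space (raw_filtration S Z t) = S"
  unfolding raw_filtration_def by (rule space_measure_of) auto

lemma path_filtration_coordinate:
  "s \<in> {0..t} \<Longrightarrow> (\<lambda>\<omega>. \<omega> s) \<in> borel_measurable (path_filtration T t)"
  unfolding path_filtration_def by (rule raw_filtration_coordinate)

lemma space_path_filtration [simp]: "space (path_filtration T t) = cadlag_paths T"
  by (simp add: path_filtration_def)

lemma right_continuous_zero_after:
  fixes y :: "real \<Rightarrow> real"
  assumes y: "cadlag_on T y" and t: "0 \<le> t" "t \<le> u" "u < T"
    and zero: "\<And>q. q \<in> \<rat> \<Longrightarrow> t < q \<Longrightarrow> q < T \<Longrightarrow> y q = 0"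
  shows "y u = 0"
proof (rule ccontr)
  assume nz: "y u \<noteq> 0"
  have lim: "(y \<longlongrightarrow> y u) (at_right u)" using y t by (auto simp: cadlag_on_def)
  have "\<forall>\<^sub>F s in at_right u. dist (y s) (y u) < \<bar>y u\<bar>" using tendstoD[OF lim] nz by simp
  then obtain b where b: "b > u" "\<And>s. u < s \<Longrightarrow> s < b \<Longrightarrow> dist (y s) (y u) < \<bar>y u\<bar>"
    by (auto simp: eventually_at_right_field)
  obtain q where q: "q \<in> \<rat>" "u < q" "q < min b T" using Rats_dense_in_real[of u "min b T"] b t by auto
  have "dist (y q) (y u) < \<bar>y u\<bar>" using b(2)[of q] q by simp
  moreover have "y q = 0" using zero[of q] q t by simp
  ultimately show False by (simp add: dist_real_def)
qed

locale path_martingale =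
  fixes T :: real and P :: "path measure"
  assumes T_pos: "0 < T" and finite_P: "finite_measure P" and space_P: "space P = cadlag_paths T"
    and martingale: "is_martingale T (path_filtration T) P (\<lambda>\<omega>. \<omega>)"
begin

sublocale finite_measure P by (rule finite_P)

abbreviation "\<F> \<equiv> path_filtration T"

lemma subalgebra: "t \<in> {0..T} \<Longrightarrow> subalgebra P (\<F> t)"
  and integrable_coordinate: "t \<in> {0..T} \<Longrightarrow> integrable P (\<lambda>\<omega>. \<omega> t)"
  using martingale by (auto simp: is_martingale_def)

lemma measurable_from_filtration:
  "t \<in> {0..T} \<Longrightarrow> f \<in> measurable (\<F> t) N \<Longrightarrow> f \<in> measurable P N"
  using subalgebra measurable_from_subalg by blast

lemma measurable_coordinate: "t \<in> {0..T} \<Longrightarrow> (\<lambda>\<omega>. \<omega> t) \<in> borel_measurable P"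
  using integrable_coordinate by auto

lemma increment_orthogonal:
  assumes su: "0 \<le> s" "s \<le> u" "u \<le> T"
    and Z: "Z \<in> borel_measurable (\<F> s)" and bound: "\<And>\<omega>. \<omega> \<in> space P \<Longrightarrow> \<bar>Z \<omega>\<bar> \<le> C"
  shows "integrable P (\<lambda>\<omega>. Z \<omega> * (\<omega> u - \<omega> s))"
    and "(LINT \<omega>|P. Z \<omega> * (\<omega> u - \<omega> s)) = 0"
proof -
  have sT: "s \<in> {0..T}" and uT: "u \<in> {0..T}" using su by auto
  interpret finite_measure_subalgebra P "\<F> s"
    by unfold_locales (use subalgebra[OF sT] in \<open>auto simp: subalgebra_def\<close>)
  have ZP: "Z \<in> borel_measurable P" by (rule measurable_from_filtration[OF sT Z])
  have int: "integrable P (\<lambda>\<omega>. Z \<omega> * \<omega> t)" if t: "t \<in> {0..T}" for t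
    using integrable_times_bounded[OF integrable_coordinate[OF t] ZP bound] by (simp add: mult.commute)
  show "integrable P (\<lambda>\<omega>. Z \<omega> * (\<omega> u - \<omega> s))"
    using int[OF sT] int[OF uT] by (simp add: right_diff_distrib)
  have "(LINT \<omega>|P. Z \<omega> * \<omega> u) = (LINT \<omega>|P. Z \<omega> * real_cond_exp P (\<F> s) (\<lambda>\<omega>. \<omega> u) \<omega>)"
    by (rule real_cond_exp_intg(2)[OF int[OF uT] Z measurable_coordinate[OF uT], symmetric])
  also have "\<dots> = (LINT \<omega>|P. Z \<omega> * \<omega> s)"
  proof (rule integral_cong_AE)
    have "AE \<omega> in P. real_cond_exp P (\<F> s) (\<lambda>\<omega>. \<omega> u) \<omega> = \<omega> s"
      using martingale su by (auto simp: is_martingale_def)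
    then show "AE \<omega> in P. Z \<omega> * real_cond_exp P (\<F> s) (\<lambda>\<omega>. \<omega> u) \<omega> = Z \<omega> * \<omega> s"
      by eventually_elim simp
  qed (use ZP measurable_coordinate[OF sT] in auto)
  finally show "(LINT \<omega>|P. Z \<omega> * (\<omega> u - \<omega> s)) = 0"
    using int[OF sT] int[OF uT] by (simp add: right_diff_distrib)
qed

context
  fixes \<alpha> c :: real
  assumes end_nonneg: "AE \<omega> in P. 0 \<le> \<alpha> * (\<omega> T - c)"
begin

definition shifted :: "real \<Rightarrow> path \<Rightarrow> real" where
  "shifted t \<omega> = \<alpha> * (\<omega> t - c)"

lemma shifted_measurable_filtration: "s \<in> {0..t} \<Longrightarrow> shifted s \<in> borel_measurable (\<F> t)"
  unfolding shifted_def[abs_def] using path_filtration_coordinate[of s t T] by simp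

lemma integrable_shifted: "t \<in> {0..T} \<Longrightarrow> integrable P (shifted t)"
  unfolding shifted_def[abs_def] using integrable_coordinate[of t] by simp

lemma integrable_shifted_indicator:
  "t \<in> {0..T} \<Longrightarrow> E \<in> sets P \<Longrightarrow> integrable P (\<lambda>\<omega>. indicator E \<omega> * shifted t \<omega>)"
  using integrable_mult_indicator[OF _ integrable_shifted] by simp

lemma shifted_integral_eq:
  assumes su: "0 \<le> s" "s \<le> u" "u \<le> T" and E: "E \<in> sets (\<F> s)"
  shows "(LINT \<omega>|P. indicator E \<omega> * shifted u \<omega>) = (LINT \<omega>|P. indicator E \<omega> * shifted s \<omega>)"
proof -
  have EP: "E \<in> sets P" using subalgebra[of s] su E by (auto simp: subalgebra_def)
  have "(LINT \<omega>|P. indicator E \<omega> * (\<omega> u - \<omega> s)) = 0"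
    by (rule increment_orthogonal(2)[OF su, of _ 1]) (use E in \<open>auto simp: indicator_def\<close>)
  then have "(LINT \<omega>|P. \<alpha> * (indicator E \<omega> * (\<omega> u - \<omega> s))) = 0" by simp
  also have "(\<lambda>\<omega>. \<alpha> * (indicator E \<omega> * (\<omega> u - \<omega> s))) =
      (\<lambda>\<omega>. indicator E \<omega> * shifted u \<omega> - indicator E \<omega> * shifted s \<omega>)"
    by (auto simp: shifted_def algebra_simps)
  finally show ?thesis
    using integrable_shifted_indicator[of u E] integrable_shifted_indicator[of s E] su EP by simp
qed

lemma shifted_nonneg_AE:
  assumes t: "t \<in> {0..T}"
  shows "AE \<omega> in P. 0 \<le> shifted t \<omega>"
proof -
  define E where "E = {\<omega> \<in> space (\<F> t). shifted t \<omega> < 0}"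
  have E: "E \<in> sets (\<F> t)"
    unfolding E_def using shifted_measurable_filtration[of t t] t by (simp del: space_path_filtration)
  have EP: "E \<in> sets P" using subalgebra[OF t] E by (auto simp: subalgebra_def)
  have "0 \<le> (LINT \<omega>|P. indicator E \<omega> * shifted T \<omega>)"
    using end_nonneg by (intro integral_nonneg_AE) (auto simp: shifted_def elim!: eventually_mono)
  also have "\<dots> = (LINT \<omega>|P. indicator E \<omega> * shifted t \<omega>)"
    using t by (intro shifted_integral_eq E) auto
  finally have "0 \<le> (LINT \<omega>|P. indicator E \<omega> * shifted t \<omega>)" .
  moreover have neg: "indicator E \<omega> * shifted t \<omega> \<le> 0" for \<omega>
    by (auto simp: E_def indicator_def)
  moreover have "0 \<le> (LINT \<omega>|P. - (indicator E \<omega> * shifted t \<omega>))"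
    using neg by (intro Bochner_Integration.integral_nonneg) simp
  ultimately have "(LINT \<omega>|P. - (indicator E \<omega> * shifted t \<omega>)) = 0"
    by simp
  then have "AE \<omega> in P. - (indicator E \<omega> * shifted t \<omega>) = 0"
    using integral_nonneg_eq_0_iff_AE[OF Bochner_Integration.integrable_minus[OF integrable_shifted_indicator[OF t EP]]] neg
    by simp
  then show ?thesis using AE_space
    by eventually_elim (auto simp: E_def indicator_def space_P not_less split: if_splits)
qed

lemma low_visit_measurable:
  assumes S: "finite S" "S \<subseteq> {0..t}"
  shows "{\<omega> \<in> cadlag_paths T. \<exists>s\<in>S. shifted s \<omega> < \<epsilon>} \<in> sets (\<F> t)"
proof -
  have "{\<omega> \<in> cadlag_paths T. \<exists>s\<in>S. shifted s \<omega> < \<epsilon>} = (\<Union>s\<in>S. {\<omega> \<in> space (\<F> t). shifted s \<omega> < \<epsilon>})"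
    by auto
  also have "\<dots> \<in> sets (\<F> t)"
  proof (rule sets.finite_UN[OF S(1)])
    fix s assume "s \<in> S"
    then show "{\<omega> \<in> space (\<F> t). shifted s \<omega> < \<epsilon>} \<in> sets (\<F> t)"
      using S shifted_measurable_filtration[of s t] by (auto simp del: space_path_filtration)
  qed
  finally show ?thesis .
qed

text \<open>Optional stopping at the first time of \<open>S\<close> at which the martingale is below \<open>\<epsilon>\<close>: the induction adds
  the times in increasing order, so a new time contributes the event that no earlier time was low.\<close>

lemma low_visit_finite:
  assumes "finite S" "S \<subseteq> {0..u}" "u \<le> T"
  shows "(LINT \<omega>|P. indicator {\<omega> \<in> cadlag_paths T. \<exists>s\<in>S. shifted s \<omega> < \<epsilon>} \<omega> * shifted u \<omega>)
      \<le> \<epsilon> * measure P {\<omega> \<in> cadlag_paths T. \<exists>s\<in>S. shifted s \<omega> < \<epsilon>}"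
  using assms(1,2)
proof (induction rule: finite_linorder_max_induct)
    case (insert b A)
    define E where "E = {\<omega> \<in> cadlag_paths T. \<exists>s\<in>A. shifted s \<omega> < \<epsilon>}"
    define N where "N = {\<omega> \<in> space (\<F> b). shifted b \<omega> < \<epsilon>} - E"
    have b: "b \<in> {0..T}" "b \<in> {0..u}" using insert assms by auto
    have uT: "u \<in> {0..T}" using b assms by auto
    have E: "E \<in> sets (\<F> b)" unfolding E_def using insert by (intro low_visit_measurable) force+
    have N: "N \<in> sets (\<F> b)"
      unfolding N_def using E shifted_measurable_filtration[of b b] b by (simp del: space_path_filtration)
    have EP: "E \<in> sets P" "N \<in> sets P" using subalgebra[OF b(1)] E N by (auto simp: subalgebra_def)
    have un: "{\<omega> \<in> cadlag_paths T. \<exists>s\<in>insert b A. shifted s \<omega> < \<epsilon>} = E \<union> N"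
      by (auto simp: E_def N_def)
    have disj: "E \<inter> N = {}" by (auto simp: N_def)
    have "(LINT \<omega>|P. indicator (E \<union> N) \<omega> * shifted u \<omega>) =
        (LINT \<omega>|P. indicator E \<omega> * shifted u \<omega> + indicator N \<omega> * shifted u \<omega>)"
      using disj by (intro Bochner_Integration.integral_cong) (auto simp: indicator_def)
    also have "\<dots> = (LINT \<omega>|P. indicator E \<omega> * shifted u \<omega>) + (LINT \<omega>|P. indicator N \<omega> * shifted u \<omega>)"
      using integrable_shifted_indicator[OF uT] EP by simp
    also have "(LINT \<omega>|P. indicator N \<omega> * shifted u \<omega>) = (LINT \<omega>|P. indicator N \<omega> * shifted b \<omega>)"
      using b assms by (intro shifted_integral_eq N) auto
    also have "\<dots> \<le> (LINT \<omega>|P. indicator N \<omega> * \<epsilon>)"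
    proof (rule integral_mono)
      show "integrable P (\<lambda>\<omega>. indicator N \<omega> * shifted b \<omega>)" by (rule integrable_shifted_indicator[OF b(1) EP(2)])
      show "integrable P (\<lambda>\<omega>. indicator N \<omega> * \<epsilon>)"
        using EP by (intro integrable_mult_left integrable_real_indicator) (auto simp: less_top[symmetric])
    qed (auto simp: indicator_def N_def)
    also have "\<dots> = \<epsilon> * measure P N" using EP sets.sets_into_space[OF EP(2)] by (simp add: Int_absorb2)
    also have "(LINT \<omega>|P. indicator E \<omega> * shifted u \<omega>) \<le> \<epsilon> * measure P E"
      using insert unfolding E_def by simp
    finally have "(LINT \<omega>|P. indicator (E \<union> N) \<omega> * shifted u \<omega>) \<le> \<epsilon> * (measure P E + measure P N)"
      by (simp add: algebra_simps)
    also have "measure P E + measure P N = measure P (E \<union> N)"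
      using disj EP by (simp add: finite_measure_Union)
    finally show ?case unfolding un .
qed simp

lemma low_visit_countable:
  assumes D: "countable D" "D \<subseteq> {0..u}" and u: "0 \<le> u" "u \<le> T" and eps: "0 \<le> \<epsilon>"
  shows "{\<omega> \<in> cadlag_paths T. \<exists>s\<in>D. shifted s \<omega> < \<epsilon>} \<in> sets P"
    and "(LINT \<omega>|P. indicator {\<omega> \<in> cadlag_paths T. \<exists>s\<in>D. shifted s \<omega> < \<epsilon>} \<omega> * shifted u \<omega>)
      \<le> \<epsilon> * measure P (space P)"
proof -
  have uT: "u \<in> {0..T}" using u by auto
  let ?B = "\<lambda>S. {\<omega> \<in> cadlag_paths T. \<exists>s\<in>S. shifted s \<omega> < \<epsilon>}"
  have "?B D \<in> sets P \<and> (LINT \<omega>|P. indicator (?B D) \<omega> * shifted u \<omega>) \<le> \<epsilon> * measure P (space P)"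
  proof (cases "D = {}")
    case True
    then show ?thesis using eps by simp
  next
    case False
    define S where "S n = from_nat_into D ` {..n}" for n
    have S: "finite (S n)" "S n \<subseteq> {0..u}" "S n \<subseteq> D" for n
      using from_nat_into[OF False] D by (auto simp: S_def)
    have SP: "?B (S n) \<in> sets P" for n
      using low_visit_measurable[OF S(1,2)[of n]] subalgebra[OF uT] by (auto simp: subalgebra_def)
    have un: "?B D = (\<Union>n. ?B (S n))"
    proof (intro equalityI subsetI)
      fix \<omega> assume "\<omega> \<in> ?B D"
      then obtain s where s: "\<omega> \<in> cadlag_paths T" "s \<in> D" "shifted s \<omega> < \<epsilon>" by auto
      obtain n where "from_nat_into D n = s" using from_nat_into_surj[OF D(1) s(2)] by blast
      then have "s \<in> S n" by (auto simp: S_def)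
      then show "\<omega> \<in> (\<Union>n. ?B (S n))" using s by auto
    qed (use S(3) in auto)
    have DP: "?B D \<in> sets P" unfolding un using SP by (intro sets.countable_UN) auto
    have "(\<lambda>n. LINT \<omega>|P. indicator (?B (S n)) \<omega> * shifted u \<omega>) \<longlonglongrightarrow>
        (LINT \<omega>|P. indicator (?B D) \<omega> * shifted u \<omega>)"
    proof (rule integral_dominated_convergence[where w = "\<lambda>\<omega>. \<bar>shifted u \<omega>\<bar>"])
      show "integrable P (\<lambda>\<omega>. \<bar>shifted u \<omega>\<bar>)" using integrable_shifted[OF uT] by simp
      show "AE \<omega> in P. (\<lambda>n. indicator (?B (S n)) \<omega> * shifted u \<omega>) \<longlonglongrightarrow> indicator (?B D) \<omega> * shifted u \<omega>"
      proof (intro AE_I2 tendsto_mult tendsto_const)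
        fix \<omega>
        have "incseq (\<lambda>n. ?B (S n))" unfolding incseq_def S_def by force
        then show "(\<lambda>n. indicator (?B (S n)) \<omega> :: real) \<longlonglongrightarrow> indicator (?B D) \<omega>"
          unfolding un by (rule LIMSEQ_indicator_incseq)
      qed
      show "(\<lambda>\<omega>. indicator (?B D) \<omega> * shifted u \<omega>) \<in> borel_measurable P"
        using integrable_shifted_indicator[OF uT DP] by auto
      show "(\<lambda>\<omega>. indicator (?B (S n)) \<omega> * shifted u \<omega>) \<in> borel_measurable P" for n
        using integrable_shifted_indicator[OF uT SP] by auto
      show "AE \<omega> in P. norm (indicator (?B (S n)) \<omega> * shifted u \<omega>) \<le> \<bar>shifted u \<omega>\<bar>" for n
        by (auto simp: indicator_def)
    qed
    moreover have "(LINT \<omega>|P. indicator (?B (S n)) \<omega> * shifted u \<omega>) \<le> \<epsilon> * measure P (space P)" for n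
    proof -
      have "measure P (?B (S n)) \<le> measure P (space P)" using SP bounded_measure by blast
      then show ?thesis
        using low_visit_finite[OF S(1,2)[of n] u(2), of \<epsilon>] eps by (meson mult_left_mono order_trans)
    qed
    ultimately have "(LINT \<omega>|P. indicator (?B D) \<omega> * shifted u \<omega>) \<le> \<epsilon> * measure P (space P)"
      by (intro LIMSEQ_le_const2) auto
    with DP show ?thesis by simp
  qed
  then show "?B D \<in> sets P" "(LINT \<omega>|P. indicator (?B D) \<omega> * shifted u \<omega>) \<le> \<epsilon> * measure P (space P)"
    by auto
qed

text \<open>Apply the previous bound with \<open>\<epsilon> = 1 / (k + 1)\<close> and let \<open>k\<close> tend to infinity.\<close>

lemma visits_zero_AE:
  assumes D: "countable D" "D \<subseteq> {0..u}" and u: "0 \<le> u" "u \<le> T"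
  shows "AE \<omega> in P. (\<forall>k. \<exists>s\<in>D. shifted s \<omega> < 1 / real (Suc k)) \<longrightarrow> shifted u \<omega> = 0"
proof -
  have uT: "u \<in> {0..T}" using u by auto
  let ?B = "\<lambda>k. {\<omega> \<in> cadlag_paths T. \<exists>s\<in>D. shifted s \<omega> < 1 / real (Suc k)}"
  note low = low_visit_countable[OF assms]
  have BP: "?B k \<in> sets P" for k by (rule low(1)) simp
  define N where "N = (\<Inter>k. ?B k)"
  have NP: "N \<in> sets P" unfolding N_def using BP by (intro sets.countable_INT) auto
  have pos: "AE \<omega> in P. 0 \<le> indicator N \<omega> * shifted u \<omega>"
    using shifted_nonneg_AE[OF uT] by eventually_elim (auto simp: indicator_def)
  have le: "(LINT \<omega>|P. indicator N \<omega> * shifted u \<omega>) \<le> 1 / real (Suc k) * measure P (space P)" for k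
  proof -
    have "(LINT \<omega>|P. indicator N \<omega> * shifted u \<omega>) \<le> (LINT \<omega>|P. indicator (?B k) \<omega> * shifted u \<omega>)"
    proof (rule integral_mono_AE)
      show "AE \<omega> in P. indicator N \<omega> * shifted u \<omega> \<le> indicator (?B k) \<omega> * shifted u \<omega>"
        using shifted_nonneg_AE[OF uT] by eventually_elim (auto simp: indicator_def N_def)
    qed (intro integrable_shifted_indicator uT NP BP)+
    also have "\<dots> \<le> 1 / real (Suc k) * measure P (space P)" by (rule low(2)) simp
    finally show ?thesis .
  qed
  have "(\<lambda>k. 1 / real (Suc k) * measure P (space P)) \<longlonglongrightarrow> 0 * measure P (space P)"
    by (intro tendsto_mult tendsto_const LIMSEQ_Suc[OF lim_1_over_n])
  then have "(LINT \<omega>|P. indicator N \<omega> * shifted u \<omega>) \<le> 0"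
    using le by (intro LIMSEQ_le_const) auto
  moreover have "0 \<le> (LINT \<omega>|P. indicator N \<omega> * shifted u \<omega>)" using pos by (rule integral_nonneg_AE)
  ultimately have "(LINT \<omega>|P. indicator N \<omega> * shifted u \<omega>) = 0" by simp
  then have "AE \<omega> in P. indicator N \<omega> * shifted u \<omega> = 0"
    using integral_nonneg_eq_0_iff_AE[OF integrable_shifted_indicator[OF uT NP] pos] by simp
  then show ?thesis using AE_space
    by eventually_elim (auto simp: N_def indicator_def space_P split: if_splits)
qed

text \<open>Reaching \<open>c\<close>, or approaching it from the left, means visiting every neighbourhood of \<open>c\<close> at rational
  times, after which the path equals \<open>c\<close> at all later rational times. Right-continuity does the rest;
  the time \<open>T\<close> has no later times and is added to the rational ones.\<close>

lemma absorbed_AE: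
  assumes \<alpha>: "\<alpha> \<noteq> 0"
  shows "AE \<omega> in P. \<forall>t\<in>{0..T}. 0 \<le> \<alpha> * (\<omega> t - c) \<and> (\<omega> t = c \<longrightarrow> (\<forall>u\<in>{t..T}. \<omega> u = c)) \<and>
    (0 < t \<longrightarrow> (\<omega> \<longlongrightarrow> c) (at_left t) \<longrightarrow> (\<forall>u\<in>{t..T}. \<omega> u = c))"
proof -
  define D where "D = insert T (\<rat> \<inter> {0..T})"
  have D: "countable D" "D \<subseteq> {0..T}" using countable_rat T_pos by (auto simp: D_def)
  have "AE \<omega> in P. \<forall>u\<in>D. 0 \<le> shifted u \<omega>"
    using D shifted_nonneg_AE by (subst AE_ball_countable) auto
  moreover have "AE \<omega> in P. \<forall>u\<in>D. (\<forall>k. \<exists>s\<in>D \<inter> {0..u}. shifted s \<omega> < 1 / real (Suc k)) \<longrightarrow> shifted u \<omega> = 0"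
    using D visits_zero_AE by (subst AE_ball_countable) auto
  ultimately show ?thesis using AE_space
  proof eventually_elim
    case (elim \<omega>)
    have cad: "cadlag_on T \<omega>" using elim(3) by (simp add: space_P cadlag_paths_def)
    have zero: "\<omega> u = c" if "u \<in> D" "\<And>e. e > 0 \<Longrightarrow> \<exists>s\<in>D \<inter> {0..u}. shifted s \<omega> < e" for u
    proof -
      have "\<forall>k. \<exists>s\<in>D \<inter> {0..u}. shifted s \<omega> < 1 / real (Suc k)" using that(2) by simp
      then have "shifted u \<omega> = 0" using elim(2) that(1) by blast
      then show ?thesis using \<alpha> by (simp add: shifted_def)
    qed
    have cady: "cadlag_on T (\<lambda>t. \<omega> t - c)"
      unfolding cadlag_on_def
    proof (intro conjI ballI)
      fix t assume "t \<in> {0..<T}"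
      then show "((\<lambda>t. \<omega> t - c) \<longlongrightarrow> \<omega> t - c) (at_right t)"
        using cad unfolding cadlag_on_def by (intro tendsto_intros) auto
    next
      fix t assume "t \<in> {0<..T}"
      then obtain l where "(\<omega> \<longlongrightarrow> l) (at_left t)" using cad unfolding cadlag_on_def by blast
      then show "\<exists>l. ((\<lambda>t. \<omega> t - c) \<longlongrightarrow> l) (at_left t)" using tendsto_diff[OF _ tendsto_const] by blast
    qed
    have after: "\<omega> u = c" if t: "0 \<le> t" "t < T" "u \<in> {t..T}"
      and *: "\<And>q. q \<in> D \<Longrightarrow> t < q \<Longrightarrow> \<omega> q = c" for t u
    proof (cases "u = T")
      case True
      then show ?thesis using *[of T] t by (simp add: D_def)
    next
      case False
      have "\<omega> u - c = 0"
        by (rule right_continuous_zero_after[OF cady t(1)]) (use t False * in \<open>auto simp: D_def\<close>)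
      then show ?thesis by simp
    qed
    show ?case
    proof (intro ballI conjI impI)
      fix t assume t: "t \<in> {0..T}"
      show "0 \<le> \<alpha> * (\<omega> t - c)"
      proof (rule ccontr)
        assume neg: "\<not> 0 \<le> \<alpha> * (\<omega> t - c)"
        then have "t \<noteq> T" using elim(1) by (auto simp: D_def shifted_def)
        then have "((\<lambda>s. \<alpha> * (\<omega> s - c)) \<longlongrightarrow> \<alpha> * (\<omega> t - c)) (at_right t)"
          using cad t unfolding cadlag_on_def by (intro tendsto_intros) auto
        then have "\<forall>\<^sub>F s in at_right t. \<alpha> * (\<omega> s - c) < 0"
          using neg by (intro order_tendstoD) auto
        then obtain b where b: "b > t" "\<And>s. t < s \<Longrightarrow> s < b \<Longrightarrow> \<alpha> * (\<omega> s - c) < 0"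
          by (auto simp: eventually_at_right_field)
        obtain q where q: "q \<in> \<rat>" "t < q" "q < min b T"
          using Rats_dense_in_real[of t "min b T"] b t \<open>t \<noteq> T\<close> by auto
        then have "q \<in> D" using t by (auto simp: D_def)
        then show False using elim(1) b(2)[of q] q by (force simp: shifted_def)
      qed
    next
      fix t u assume t: "t \<in> {0..T}" and tc: "\<omega> t = c" and u: "u \<in> {t..T}"
      show "\<omega> u = c"
      proof (cases "t = T")
        case False
        have "\<omega> q = c" if q: "q \<in> D" "t < q" for q
        proof (rule zero[OF q(1)])
          fix e :: real assume e: "e > 0"
          have qT: "q \<le> T" using q D by auto
          have "((\<lambda>s. \<alpha> * (\<omega> s - c)) \<longlongrightarrow> \<alpha> * (\<omega> t - c)) (at_right t)"
            using cad t False unfolding cadlag_on_def by (intro tendsto_intros) auto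
          then have "\<forall>\<^sub>F s in at_right t. \<alpha> * (\<omega> s - c) < e"
            using e tc by (intro order_tendstoD) auto
          then obtain b where b: "b > t" "\<And>s. t < s \<Longrightarrow> s < b \<Longrightarrow> \<alpha> * (\<omega> s - c) < e"
            by (auto simp: eventually_at_right_field)
          obtain s where s: "s \<in> \<rat>" "t < s" "s < min b q"
            using Rats_dense_in_real[of t "min b q"] b q by auto
          then have "s \<in> D \<inter> {0..q}" using t qT by (auto simp: D_def)
          then show "\<exists>s\<in>D \<inter> {0..q}. shifted s \<omega> < e" using b(2)[of s] s by (force simp: shifted_def)
        qed
        then show ?thesis using after[of t u] t u False by auto
      qed (use tc u in auto)
    next
      fix t u assume t: "t \<in> {0..T}" "0 < t" and lim: "(\<omega> \<longlongrightarrow> c) (at_left t)" and u: "u \<in> {t..T}"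
      have at: "\<omega> q = c" if q: "q \<in> D" "t \<le> q" for q
      proof (rule zero[OF q(1)])
        fix e :: real assume e: "e > 0"
        have qT: "q \<le> T" using q D by auto
        have "((\<lambda>s. \<alpha> * (\<omega> s - c)) \<longlongrightarrow> \<alpha> * (c - c)) (at_left t)"
          using lim by (intro tendsto_intros)
        then have "\<forall>\<^sub>F s in at_left t. \<alpha> * (\<omega> s - c) < e"
          using e by (intro order_tendstoD) auto
        then obtain b where b: "b < t" "\<And>s. b < s \<Longrightarrow> s < t \<Longrightarrow> \<alpha> * (\<omega> s - c) < e"
          by (auto simp: eventually_at_left_field)
        obtain s where s: "s \<in> \<rat>" "max b 0 < s" "s < t"
          using Rats_dense_in_real[of "max b 0" t] b t by auto
        then have "s \<in> D \<inter> {0..q}" using t q qT by (auto simp: D_def)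
        then show "\<exists>s\<in>D \<inter> {0..q}. shifted s \<omega> < e" using b(2)[of s] s by (force simp: shifted_def)
      qed
      show "\<omega> u = c"
      proof (cases "t = T")
        case True
        then show ?thesis using at[of T] u by (simp add: D_def)
      next
        case False
        then show ?thesis using after[of t u] at t u by auto
      qed
    qed
  qed
qed

end

end

section \<open>Averaging a martingale\<close>

definition grid_cell :: "nat \<Rightarrow> nat \<Rightarrow> real set" where
  "grid_cell n k = {(real k - 1) / real (Suc n)<..real k / real (Suc n)}"

definition grid_point :: "real \<Rightarrow> nat \<Rightarrow> nat \<Rightarrow> real" where
  "grid_point T n k = min T (real k / real (Suc n))"

lemma grid_decomposition:
  assumes t: "t \<in> {0..T}"
  shows "(G (grid_up T n t) :: real) =
    (\<Sum>k\<le>nat \<lceil>real (Suc n) * T\<rceil>. indicator (grid_cell n k) t * G (grid_point T n k))"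
proof -
  define k0 where "k0 = nat \<lceil>real (Suc n) * t\<rceil>"
  have nn: "0 \<le> \<lceil>real (Suc n) * t\<rceil>" using t by (simp add: ceiling_mono[of 0, simplified])
  have k0: "real k0 = of_int \<lceil>real (Suc n) * t\<rceil>" using nn by (simp add: k0_def)
  have le: "k0 \<le> nat \<lceil>real (Suc n) * T\<rceil>"
    unfolding k0_def using t by (intro nat_mono ceiling_mono mult_left_mono) auto
  have cell: "t \<in> grid_cell n k \<longleftrightarrow> k = k0" for k
  proof -
    have "t \<in> grid_cell n k \<longleftrightarrow> real k - 1 < real (Suc n) * t \<and> real (Suc n) * t \<le> real k"
      by (simp add: grid_cell_def pos_divide_less_eq pos_le_divide_eq mult.commute del: of_nat_Suc)
    also have "\<dots> \<longleftrightarrow> \<lceil>real (Suc n) * t\<rceil> = int k" by (simp add: ceiling_eq_iff del: of_nat_Suc)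
    also have "\<dots> \<longleftrightarrow> k = k0" using nn by (auto simp: k0_def simp del: of_nat_Suc)
    finally show ?thesis .
  qed
  have "(\<Sum>k\<le>nat \<lceil>real (Suc n) * T\<rceil>. indicator (grid_cell n k) t * G (grid_point T n k)) =
      (\<Sum>k\<le>nat \<lceil>real (Suc n) * T\<rceil>. if k = k0 then G (grid_point T n k0) else 0)"
    by (intro sum.cong) (auto simp: cell indicator_def)
  also have "\<dots> = G (grid_point T n k0)" using le by simp
  also have "grid_point T n k0 = grid_up T n t" by (simp add: grid_point_def grid_up_def k0)
  finally show ?thesis by simp
qed

lemma path_filtration_mono:
  assumes "s \<le> t" "f \<in> measurable (path_filtration T s) N"
  shows "f \<in> measurable (path_filtration T t) N"
proof -
  have "subalgebra (path_filtration T t) (path_filtration T s)"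
    unfolding subalgebra_def
  proof
    have sub: "{(\<lambda>w. w s) -` B \<inter> cadlag_paths T | s B. s \<in> {0..u} \<and> B \<in> sets borel} \<subseteq> Pow (cadlag_paths T)" for u :: real
      by auto
    show "sets (path_filtration T s) \<subseteq> sets (path_filtration T t)"
      unfolding path_filtration_def raw_filtration_def sets_measure_of[OF sub]
      by (rule sigma_sets_mono') (use assms(1) in fastforce)
  qed simp
  then show ?thesis using assms(2) measurable_from_subalg by blast
qed

lemma cadlag_paths_nonempty: "cadlag_paths T \<noteq> ({} :: path set)"
proof -
  have "restrict (\<lambda>t. 0 :: real) {0..T} \<in> cadlag_paths T"
  proof -
    let ?w = "restrict (\<lambda>t. 0 :: real) {0..T}"
    have "(?w \<longlongrightarrow> ?w t) (at_right t)" if "t \<in> {0..<T}" for t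
    proof (rule Lim_transform_eventually[OF tendsto_const])
      show "\<forall>\<^sub>F s in at_right t. ?w t = ?w s"
        using that by (auto simp: eventually_at_right_field intro!: exI[of _ T])
    qed
    moreover have "\<exists>l. (?w \<longlongrightarrow> l) (at_left t)" if "t \<in> {0<..T}" for t
    proof (rule exI, rule Lim_transform_eventually[OF tendsto_const])
      show "\<forall>\<^sub>F s in at_left t. 0 = ?w s"
        using that by (auto simp: eventually_at_left_field intro!: exI[of _ 0])
    qed
    ultimately show ?thesis unfolding cadlag_paths_def cadlag_on_def by (simp add: restrict_extensional)
  qed
  then show ?thesis by blast
qed

text \<open>Outside \<open>[0, T]\<close> a path has no meaningful value; with \<open>0\<close> there, the path is jointly measurable in
  the outcome and in time.\<close>

definition clip :: "real \<Rightarrow> path \<Rightarrow> real \<Rightarrow> real" where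
  "clip T \<omega> t = indicator {0..T} t * \<omega> t"

text \<open>The distance of \<open>x\<close> to the interval \<open>[-c, c]\<close>. It is convex in \<open>x\<close>, so it makes a submartingale of
  a martingale.\<close>

definition excess :: "real \<Rightarrow> real \<Rightarrow> real" where
  "excess c x = max 0 (\<bar>x\<bar> - c)"

definition clamp :: "real \<Rightarrow> real \<Rightarrow> real" where
  "clamp c x = max (- c) (min c x)"

lemma clamp_excess: "0 \<le> c \<Longrightarrow> \<bar>x - clamp c x\<bar> = excess c x" "0 \<le> c \<Longrightarrow> \<bar>clamp c x\<bar> \<le> c"
  and excess_nonneg: "0 \<le> excess c x" and excess_le: "0 \<le> c \<Longrightarrow> excess c x \<le> \<bar>x\<bar>"
  by (auto simp: clamp_def excess_def)

lemma excess_tangent: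
  "0 \<le> c \<Longrightarrow> (if c < x then 1 else if x < - c then -1 else 0) * (y - x) \<le> excess c y - excess c x"
  by (auto simp: excess_def)

lemma measurable_excess [measurable]: "excess c \<in> borel_measurable borel"
  and measurable_clamp [measurable]: "clamp c \<in> borel_measurable borel"
  unfolding excess_def clamp_def by measurable

locale averaged_martingale = path_martingale +
  fixes A :: "path \<Rightarrow> path"
  assumes A: "A \<in> averaging_processes T"
begin

lemma averaging_path: "\<omega> \<in> space P \<Longrightarrow> averaging_path T (A \<omega>)"
  using A T_pos by (auto simp: averaging_path_def averaging_processes_def space_P)

definition K :: "path \<Rightarrow> real measure" where
  "K \<omega> = stieltjes_measure T (A \<omega>)"

lemma K_prob:
  assumes "\<omega> \<in> space P"
  shows "prob_space (K \<omega>)"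
proof -
  interpret ap: averaging_path T "A \<omega>" by (rule averaging_path[OF assms])
  show ?thesis unfolding K_def by unfold_locales
qed

lemma K_sets: "\<omega> \<in> space P \<Longrightarrow> sets (K \<omega>) = sets borel"
  unfolding K_def by (rule averaging_path.sets_da[OF averaging_path])

lemma K_space: "\<omega> \<in> space P \<Longrightarrow> space (K \<omega>) = UNIV"
  unfolding K_def by (rule averaging_path.space_da[OF averaging_path])

definition cdf :: "real \<Rightarrow> path \<Rightarrow> real" where
  "cdf t \<omega> = (if t < 0 then 0 else A \<omega> (min t T))"

lemma measure_K_Ioc:
  "\<omega> \<in> space P \<Longrightarrow> s \<le> t \<Longrightarrow> measure (K \<omega>) {s<..t} = cdf t \<omega> - cdf s \<omega>"
  unfolding K_def cdf_def
  using averaging_path.measure_da_Ioc[OF averaging_path] averaging_path.cdf_a_def[OF averaging_path] by simp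

lemma cdf_measurable:
  assumes "min s T \<le> t" "0 \<le> t"
  shows "cdf s \<in> borel_measurable (\<F> t)"
proof (cases "s < 0")
  case False
  then have "min s T \<in> {0..T}" using T_pos by auto
  then have "(\<lambda>\<omega>. A \<omega> (min s T)) \<in> borel_measurable (\<F> (min s T))"
    using A by (auto simp: averaging_processes_def adapted_def)
  then show ?thesis using False path_filtration_mono[OF assms(1)] by (simp add: cdf_def[abs_def])
qed (simp add: cdf_def[abs_def])

lemma cdf_measurable_P: "cdf s \<in> borel_measurable P"
  by (rule measurable_from_filtration[of T]) (use T_pos cdf_measurable in auto)

lemma K_measurable: "K \<in> measurable P (subprob_algebra borel)"
proof (rule measurable_prob_algebraD)
  show "K \<in> measurable P (prob_algebra borel)"
  proof (rule measurable_prob_algebra_generated[OF sets_borel_Ioc Int_stable_Ioc])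
    fix B assume "B \<in> range (\<lambda>(a, b). {a<..b::real})"
    then obtain s t where B: "B = {s<..t}" by auto
    show "(\<lambda>\<omega>. emeasure (K \<omega>) B) \<in> borel_measurable P"
    proof (cases "s \<le> t")
      case True
      have "emeasure (K \<omega>) B = ennreal (cdf t \<omega> - cdf s \<omega>)" if \<omega>: "\<omega> \<in> space P" for \<omega>
      proof -
        interpret K: prob_space "K \<omega>" by (rule K_prob[OF \<omega>])
        show ?thesis using measure_K_Ioc[OF \<omega> True] by (simp add: K.emeasure_eq_measure B)
      qed
      then show ?thesis
        using cdf_measurable_P[of s] cdf_measurable_P[of t] by (subst measurable_cong) auto
    next
      case False
      then have "B = {}" using B by auto
      then show ?thesis by simp
    qed
  qed (use K_prob K_sets in auto)
qed

text \<open>The path at rounded times depends on time only through an integer, and it converges to the path.\<close>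

lemma clip_measurable: "(\<lambda>(\<omega>, t). clip T \<omega> t) \<in> borel_measurable (P \<Otimes>\<^sub>M borel)"
proof (rule borel_measurable_LIMSEQ_real)
  define f where "f n k z = indicator {0..T} (snd z) * fst z (max 0 (min T (of_int k / real (Suc n))))"
    for n :: nat and k :: int and z :: "path \<times> real"
  show "(\<lambda>n. f n \<lceil>real (Suc n) * snd z\<rceil> z) \<longlonglongrightarrow> (case z of (\<omega>, t) \<Rightarrow> clip T \<omega> t)"
    if "z \<in> space (P \<Otimes>\<^sub>M borel)" for z
  proof (cases "snd z \<in> {0..T}")
    case True
    have "fst z \<in> cadlag_paths T" using that by (auto simp: space_pair_measure space_P)
    then have "cadlag_on T (fst z)" by (simp add: cadlag_paths_def)
    then have "(\<lambda>n. fst z (grid_up T n (snd z))) \<longlonglongrightarrow> fst z (snd z)"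
      using True by (rule cadlag_grid_up_tendsto)
    moreover have "fst z (grid_up T n (snd z)) = f n \<lceil>real (Suc n) * snd z\<rceil> z" for n
      using True grid_up_bounds(1)[OF True, of n] by (simp add: f_def grid_up_def max_def)
    ultimately show ?thesis using True by (simp add: clip_def split_beta)
  next
    case False
    then show ?thesis by (auto simp: f_def clip_def split_beta indicator_def)
  qed
  show "(\<lambda>z. f n \<lceil>real (Suc n) * snd z\<rceil> z) \<in> borel_measurable (P \<Otimes>\<^sub>M borel)" for n
  proof (rule measurable_compose_countable)
    show "(\<lambda>z. f n k z) \<in> borel_measurable (P \<Otimes>\<^sub>M borel)" for k
    proof -
      have "(\<lambda>\<omega>. \<omega> (max 0 (min T (of_int k / real (Suc n))))) \<in> borel_measurable P"
        using T_pos by (intro measurable_coordinate) auto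
      then show ?thesis unfolding f_def by measurable
    qed
    show "(\<lambda>z. \<lceil>real (Suc n) * snd z\<rceil>) \<in> measurable (P \<Otimes>\<^sub>M borel) (count_space UNIV)"
      by measurable
  qed
qed

lemma clip_measurable': "(\<lambda>z. clip T (fst z) (snd z)) \<in> borel_measurable (P \<Otimes>\<^sub>M borel)"
  using clip_measurable by (simp add: split_beta')

text \<open>The joint law of the path and of a time drawn from the average.\<close>

definition Q :: "(path \<times> real) measure" where
  "Q = P \<bind> (\<lambda>\<omega>. distr (K \<omega>) (P \<Otimes>\<^sub>M borel) (\<lambda>t. (\<omega>, t)))"

lemma Q_kernel: "(\<lambda>\<omega>. distr (K \<omega>) (P \<Otimes>\<^sub>M borel) (\<lambda>t. (\<omega>, t))) \<in> measurable P (subprob_algebra (P \<Otimes>\<^sub>M borel))"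
  by (rule measurable_distr2[OF _ K_measurable]) simp

lemma space_P_nonempty: "space P \<noteq> {}"
  by (simp add: space_P cadlag_paths_nonempty)

lemma sets_Q [measurable_cong]: "sets Q = sets (P \<Otimes>\<^sub>M borel)"
  unfolding Q_def using space_P_nonempty by (intro sets_bind) auto

lemma space_Q: "space Q = space P \<times> UNIV"
  using sets_eq_imp_space_eq[OF sets_Q] by (simp add: space_pair_measure)

lemma measurable_Q_iff: "measurable Q N = measurable (P \<Otimes>\<^sub>M borel) N"
  by (rule measurable_cong_sets[OF sets_Q refl])

lemma nn_integral_Q:
  assumes f: "f \<in> borel_measurable (P \<Otimes>\<^sub>M borel)"
  shows "(\<integral>\<^sup>+z. f z \<partial>Q) = (\<integral>\<^sup>+\<omega>. \<integral>\<^sup>+t. f (\<omega>, t) \<partial>K \<omega> \<partial>P)"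
proof -
  have "(\<integral>\<^sup>+z. f z \<partial>Q) = (\<integral>\<^sup>+\<omega>. \<integral>\<^sup>+z. f z \<partial>distr (K \<omega>) (P \<Otimes>\<^sub>M borel) (\<lambda>t. (\<omega>, t)) \<partial>P)"
    unfolding Q_def by (rule nn_integral_bind[OF f Q_kernel])
  also have "\<dots> = (\<integral>\<^sup>+\<omega>. \<integral>\<^sup>+t. f (\<omega>, t) \<partial>K \<omega> \<partial>P)"
  proof (rule nn_integral_cong)
    fix \<omega> assume \<omega>: "\<omega> \<in> space P"
    have "(\<lambda>t. (\<omega>, t)) \<in> measurable (K \<omega>) (P \<Otimes>\<^sub>M borel)"
      unfolding measurable_cong_sets[OF K_sets[OF \<omega>] refl] using \<omega> by simp
    then show "(\<integral>\<^sup>+z. f z \<partial>distr (K \<omega>) (P \<Otimes>\<^sub>M borel) (\<lambda>t. (\<omega>, t))) = (\<integral>\<^sup>+t. f (\<omega>, t) \<partial>K \<omega>)"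
      by (rule nn_integral_distr) (use f in simp)
  qed
  finally show ?thesis .
qed

sublocale Q: finite_measure Q
proof
  have "emeasure Q (space Q) = (\<integral>\<^sup>+z. 1 \<partial>Q)" by simp
  also have "\<dots> = (\<integral>\<^sup>+\<omega>. \<integral>\<^sup>+t. 1 \<partial>K \<omega> \<partial>P)" by (rule nn_integral_Q) simp
  also have "\<dots> = (\<integral>\<^sup>+\<omega>. 1 \<partial>P)"
    by (intro nn_integral_cong) (simp add: prob_space.emeasure_space_1[OF K_prob])
  finally show "emeasure Q (space Q) \<noteq> \<infinity>" by simp
qed

lemma AE_Q_time: "AE z in Q. snd z \<in> {0..T}"
proof (rule AE_I')
  let ?N = "space P \<times> - {0..T}"
  have N: "?N \<in> sets (P \<Otimes>\<^sub>M borel)" by auto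
  have "emeasure Q ?N = (\<integral>\<^sup>+z. indicator ?N z \<partial>Q)" using N by (simp add: sets_Q)
  also have "\<dots> = (\<integral>\<^sup>+\<omega>. \<integral>\<^sup>+t. indicator ?N (\<omega>, t) \<partial>K \<omega> \<partial>P)"
    by (rule nn_integral_Q) (use N in simp)
  also have "\<dots> = (\<integral>\<^sup>+\<omega>. 0 \<partial>P)"
  proof (rule nn_integral_cong)
    fix \<omega> assume \<omega>: "\<omega> \<in> space P"
    have "AE t in K \<omega>. t \<in> {0..T}"
      unfolding K_def by (rule averaging_path.AE_da_in[OF averaging_path[OF \<omega>]])
    then have "(\<integral>\<^sup>+t. indicator ?N (\<omega>, t) \<partial>K \<omega>) = (\<integral>\<^sup>+t. 0 \<partial>K \<omega>)"
      by (intro nn_integral_cong_AE) (auto elim!: eventually_mono simp: indicator_def)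
    then show "(\<integral>\<^sup>+t. indicator ?N (\<omega>, t) \<partial>K \<omega>) = 0" by simp
  qed
  finally show "?N \<in> null_sets Q" using N by (simp add: null_sets_def sets_Q)
qed (auto simp: space_Q)

lemma AE_Q_path:
  assumes "AE \<omega> in P. R \<omega>"
  shows "AE z in Q. R (fst z)"
proof -
  obtain N where N: "{\<omega> \<in> space P. \<not> R \<omega>} \<subseteq> N" "emeasure P N = 0" "N \<in> sets P"
    using assms by (auto elim: AE_E)
  have NU: "N \<times> (UNIV :: real set) \<in> sets (P \<Otimes>\<^sub>M borel)" using N by auto
  have "emeasure Q (N \<times> (UNIV :: real set)) = (\<integral>\<^sup>+z. indicator (N \<times> (UNIV :: real set)) z \<partial>Q)" using NU by (simp add: sets_Q)
  also have "\<dots> = (\<integral>\<^sup>+\<omega>. \<integral>\<^sup>+t. indicator (N \<times> (UNIV :: real set)) (\<omega>, t) \<partial>K \<omega> \<partial>P)"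
    by (rule nn_integral_Q) (use NU in simp)
  also have "\<dots> = (\<integral>\<^sup>+\<omega>. indicator N \<omega> \<partial>P)"
    by (intro nn_integral_cong)
      (simp add: prob_space.emeasure_space_1[OF K_prob] indicator_times)
  also have "\<dots> = 0" using N by simp
  finally have "N \<times> (UNIV :: real set) \<in> null_sets Q" using NU by (simp add: null_sets_def sets_Q)
  then show ?thesis using N(1) by (intro AE_I'[of "N \<times> UNIV"]) (auto simp: space_Q)
qed

lemma measure_K_measurable:
  assumes "B \<in> sets borel"
  shows "(\<lambda>\<omega>. measure (K \<omega>) B) \<in> borel_measurable P"
proof -
  have "(\<lambda>\<omega>. emeasure (K \<omega>) B) \<in> borel_measurable P"
    by (rule measurable_compose[OF K_measurable]) (rule measurable_emeasure_subprob_algebra[OF assms])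
  then show ?thesis unfolding measure_def by simp
qed

lemma measure_K_le_1: "\<omega> \<in> space P \<Longrightarrow> measure (K \<omega>) B \<le> 1"
  using prob_space.prob_le_1[OF K_prob] .

lemma integrable_mult_measure_K:
  "integrable P h \<Longrightarrow> B \<in> sets borel \<Longrightarrow> integrable P (\<lambda>\<omega>. h \<omega> * measure (K \<omega>) B)"
  by (rule integrable_times_bounded[of _ _ _ 1]) (use measure_K_measurable measure_K_le_1 in auto)

lemma integral_Q_product_nonneg:
  assumes h: "integrable P h" "\<And>\<omega>. 0 \<le> h \<omega>" and B: "B \<in> sets borel"
  shows "integrable Q (\<lambda>z. h (fst z) * indicator B (snd z))"
    and "(LINT z|Q. h (fst z) * indicator B (snd z)) = (LINT \<omega>|P. h \<omega> * measure (K \<omega>) B)"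
proof -
  have hm[measurable]: "h \<in> borel_measurable P" using h by auto
  have m: "(\<lambda>z. h (fst z) * indicator B (snd z)) \<in> borel_measurable (P \<Otimes>\<^sub>M borel)" using B by measurable
  have int: "integrable P (\<lambda>\<omega>. h \<omega> * measure (K \<omega>) B)" by (rule integrable_mult_measure_K[OF h(1) B])
  have "(\<integral>\<^sup>+z. ennreal (h (fst z) * indicator B (snd z)) \<partial>Q) =
      (\<integral>\<^sup>+\<omega>. \<integral>\<^sup>+t. ennreal (h \<omega> * indicator B t) \<partial>K \<omega> \<partial>P)"
    using m by (subst nn_integral_Q) auto
  also have "\<dots> = (\<integral>\<^sup>+\<omega>. ennreal (h \<omega> * measure (K \<omega>) B) \<partial>P)"
  proof (rule nn_integral_cong)
    fix \<omega> assume \<omega>: "\<omega> \<in> space P"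
    interpret K: prob_space "K \<omega>" by (rule K_prob[OF \<omega>])
    have "(\<integral>\<^sup>+t. ennreal (h \<omega> * indicator B t) \<partial>K \<omega>) = (\<integral>\<^sup>+t. ennreal (h \<omega>) * indicator B t \<partial>K \<omega>)"
      using h(2) by (intro nn_integral_cong) (auto simp: indicator_def)
    also have "\<dots> = ennreal (h \<omega>) * emeasure (K \<omega>) B"
      using B K_sets[OF \<omega>] by (intro nn_integral_cmult_indicator) auto
    finally show "(\<integral>\<^sup>+t. ennreal (h \<omega> * indicator B t) \<partial>K \<omega>) = ennreal (h \<omega> * measure (K \<omega>) B)"
      using h(2) by (simp add: K.emeasure_eq_measure ennreal_mult)
  qed
  also have "\<dots> = ennreal (LINT \<omega>|P. h \<omega> * measure (K \<omega>) B)"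
    using int h(2) by (intro nn_integral_eq_integral) auto
  finally have eq: "(\<integral>\<^sup>+z. ennreal (h (fst z) * indicator B (snd z)) \<partial>Q) =
    ennreal (LINT \<omega>|P. h \<omega> * measure (K \<omega>) B)" .
  have nn: "0 \<le> (LINT \<omega>|P. h \<omega> * measure (K \<omega>) B)" using h(2) by simp
  show "integrable Q (\<lambda>z. h (fst z) * indicator B (snd z))"
    by (rule integrableI_nn_integral_finite[OF _ _ eq]) (use m nn h(2) in \<open>auto simp: measurable_Q_iff\<close>)
  show "(LINT z|Q. h (fst z) * indicator B (snd z)) = (LINT \<omega>|P. h \<omega> * measure (K \<omega>) B)"
    by (rule integral_eq_nn_integral[THEN trans]) (use m h(2) eq nn in \<open>auto simp: measurable_Q_iff\<close>)
qed

lemma integral_Q_product: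
  fixes h :: "path \<Rightarrow> real"
  assumes h: "integrable P h" and B: "B \<in> sets borel"
  shows "integrable Q (\<lambda>z. h (fst z) * indicator B (snd z))"
    and "(LINT z|Q. h (fst z) * indicator B (snd z)) = (LINT \<omega>|P. h \<omega> * measure (K \<omega>) B)"
    and "integrable P (\<lambda>\<omega>. h \<omega> * measure (K \<omega>) B)"
proof -
  have int: "integrable P (\<lambda>\<omega>. max 0 (h \<omega>))" "integrable P (\<lambda>\<omega>. max 0 (- h \<omega>))" using h by auto
  note kint = integrable_mult_measure_K[OF _ B]
  note pos = integral_Q_product_nonneg[OF int(1) _ B] and neg = integral_Q_product_nonneg[OF int(2) _ B]
  have split: "h \<omega> * r = max 0 (h \<omega>) * r - max 0 (- h \<omega>) * r" for \<omega> r
    by (simp add: max_def)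
  show "integrable Q (\<lambda>z. h (fst z) * indicator B (snd z))"
    unfolding split using pos(1) neg(1) by (intro Bochner_Integration.integrable_diff) auto
  show "(LINT z|Q. h (fst z) * indicator B (snd z)) = (LINT \<omega>|P. h \<omega> * measure (K \<omega>) B)"
    unfolding split using pos neg kint[OF int(1)] kint[OF int(2)] by simp
  show "integrable P (\<lambda>\<omega>. h \<omega> * measure (K \<omega>) B)" by (rule kint[OF h])
qed

lemma integral_Q_path:
  fixes h :: "path \<Rightarrow> real"
  assumes h: "integrable P h"
  shows "integrable Q (\<lambda>z. h (fst z))" and "(LINT z|Q. h (fst z)) = (LINT \<omega>|P. h \<omega>)"
proof -
  show "integrable Q (\<lambda>z. h (fst z))" using integral_Q_product(1)[OF h, of UNIV] by simp
  have "(LINT z|Q. h (fst z)) = (LINT \<omega>|P. h \<omega> * measure (K \<omega>) UNIV)"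
    using integral_Q_product(2)[OF h, of UNIV] by simp
  also have "\<dots> = (LINT \<omega>|P. h \<omega>)"
    using prob_space.prob_space[OF K_prob] K_space by (intro Bochner_Integration.integral_cong) auto
  finally show "(LINT z|Q. h (fst z)) = (LINT \<omega>|P. h \<omega>)" .
qed

lemma grid_point_in: "grid_point T n k \<in> {0..T}"
  using T_pos by (auto simp: grid_point_def)

lemma cell_weight_measurable:
  "(\<lambda>\<omega>. measure (K \<omega>) (grid_cell n k)) \<in> borel_measurable (\<F> (grid_point T n k))"
proof -
  have le: "(real k - 1) / real (Suc n) \<le> real k / real (Suc n)" by (intro divide_right_mono) auto
  have "(\<lambda>\<omega>. cdf (real k / real (Suc n)) \<omega> - cdf ((real k - 1) / real (Suc n)) \<omega>) \<in>
      borel_measurable (\<F> (grid_point T n k))"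
    using grid_point_in[of n k] le
    by (intro borel_measurable_diff cdf_measurable) (auto simp: grid_point_def min.coboundedI2 min_le_iff_disj)
  then show ?thesis
    by (rule measurable_cong[THEN iffD1, rotated])
      (use measure_K_Ioc[OF _ le] space_P in \<open>simp add: grid_cell_def\<close>)
qed

text \<open>A function of the rounded time takes finitely many values, so its integral is a sum over grid cells.\<close>

lemma grid_integral:
  fixes G :: "real \<Rightarrow> path \<Rightarrow> real"
  assumes G: "\<And>p. p \<in> {0..T} \<Longrightarrow> integrable P (G p)"
  shows "integrable Q (\<lambda>z. indicator {0..T} (snd z) * G (grid_up T n (snd z)) (fst z))"
    and "(LINT z|Q. indicator {0..T} (snd z) * G (grid_up T n (snd z)) (fst z)) =
      (\<Sum>k\<le>nat \<lceil>real (Suc n) * T\<rceil>. LINT \<omega>|P. G (grid_point T n k) \<omega> * measure (K \<omega>) (grid_cell n k))"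
proof -
  have cell: "grid_cell n k \<in> sets borel" for k by (simp add: grid_cell_def)
  note prod = integral_Q_product[OF G[OF grid_point_in] cell]
  have eq: "indicator {0..T} (snd z) * G (grid_up T n (snd z)) (fst z) = indicator {0..T} (snd z) *
      (\<Sum>k\<le>nat \<lceil>real (Suc n) * T\<rceil>. G (grid_point T n k) (fst z) * indicator (grid_cell n k) (snd z))" for z
  proof (cases "snd z \<in> {0..T}")
    case True
    then show ?thesis
      using grid_decomposition[OF True, of "\<lambda>p. G p (fst z)" n] by (simp add: mult.commute)
  qed simp
  have int: "integrable Q (\<lambda>z. \<Sum>k\<le>nat \<lceil>real (Suc n) * T\<rceil>. G (grid_point T n k) (fst z) * indicator (grid_cell n k) (snd z))"
    by (intro Bochner_Integration.integrable_sum prod)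
  have ind: "(\<lambda>z. indicator {0..T} (snd z) :: real) \<in> borel_measurable Q" unfolding measurable_Q_iff by measurable
  have ae: "AE z in Q. (\<Sum>k\<le>nat \<lceil>real (Suc n) * T\<rceil>. G (grid_point T n k) (fst z) * indicator (grid_cell n k) (snd z)) =
      indicator {0..T} (snd z) * G (grid_up T n (snd z)) (fst z)"
    unfolding eq using AE_Q_time by eventually_elim simp
  have meas: "(\<lambda>z. indicator {0..T} (snd z) * G (grid_up T n (snd z)) (fst z)) \<in> borel_measurable Q"
    unfolding eq using ind int by (intro borel_measurable_times) auto
  show "integrable Q (\<lambda>z. indicator {0..T} (snd z) * G (grid_up T n (snd z)) (fst z))"
    by (rule integrable_cong_AE_imp[OF int meas]) (use ae in \<open>auto elim!: eventually_mono\<close>)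
  have "(LINT z|Q. indicator {0..T} (snd z) * G (grid_up T n (snd z)) (fst z)) =
      (LINT z|Q. (\<Sum>k\<le>nat \<lceil>real (Suc n) * T\<rceil>. G (grid_point T n k) (fst z) * indicator (grid_cell n k) (snd z)))"
    by (rule integral_cong_AE) (use meas int ae in \<open>auto elim!: eventually_mono\<close>)
  also have "\<dots> = (\<Sum>k\<le>nat \<lceil>real (Suc n) * T\<rceil>. LINT z|Q. G (grid_point T n k) (fst z) * indicator (grid_cell n k) (snd z))"
    by (rule Bochner_Integration.integral_sum) (rule prod)
  also have "\<dots> = (\<Sum>k\<le>nat \<lceil>real (Suc n) * T\<rceil>. LINT \<omega>|P. G (grid_point T n k) \<omega> * measure (K \<omega>) (grid_cell n k))"
    by (simp add: prod)
  finally show "(LINT z|Q. indicator {0..T} (snd z) * G (grid_up T n (snd z)) (fst z)) =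
      (\<Sum>k\<le>nat \<lceil>real (Suc n) * T\<rceil>. LINT \<omega>|P. G (grid_point T n k) \<omega> * measure (K \<omega>) (grid_cell n k))" .
qed

lemma T_in: "T \<in> {0..T}" and zero_in: "0 \<in> {0..T}"
  using T_pos by auto

lemma integrable_excess:
  assumes "0 \<le> c" "t \<in> {0..T}"
  shows "integrable P (\<lambda>\<omega>. excess c (\<omega> t))"
proof (rule Bochner_Integration.integrable_bound[OF integrable_coordinate[OF assms(2)]])
  show "(\<lambda>\<omega>. excess c (\<omega> t)) \<in> borel_measurable P"
    by (rule measurable_compose[OF measurable_coordinate[OF assms(2)] measurable_excess])
  show "AE \<omega> in P. norm (excess c (\<omega> t)) \<le> norm (\<omega> t)"
    using excess_le[OF assms(1)] excess_nonneg[of c] by simp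
qed

lemma weighted_increment_zero:
  assumes Z: "Z \<in> borel_measurable (\<F> (grid_point T n k))" and bound: "\<And>\<omega>. \<bar>Z \<omega>\<bar> \<le> C"
  shows "integrable P (\<lambda>\<omega>. (Z \<omega> * measure (K \<omega>) (grid_cell n k)) * (\<omega> T - \<omega> (grid_point T n k)))"
    and "(LINT \<omega>|P. (Z \<omega> * measure (K \<omega>) (grid_cell n k)) * (\<omega> T - \<omega> (grid_point T n k))) = 0"
proof -
  have "(\<lambda>\<omega>. Z \<omega> * measure (K \<omega>) (grid_cell n k)) \<in> borel_measurable (\<F> (grid_point T n k))"
    using Z cell_weight_measurable by simp
  moreover have "\<bar>Z \<omega> * measure (K \<omega>) (grid_cell n k)\<bar> \<le> C * 1" if "\<omega> \<in> space P" for \<omega>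
    unfolding abs_mult using bound[of \<omega>] measure_K_le_1[OF that]
    by (intro mult_mono) (auto intro: order_trans[OF abs_ge_zero])
  ultimately show "integrable P (\<lambda>\<omega>. (Z \<omega> * measure (K \<omega>) (grid_cell n k)) * (\<omega> T - \<omega> (grid_point T n k)))"
    "(LINT \<omega>|P. (Z \<omega> * measure (K \<omega>) (grid_cell n k)) * (\<omega> T - \<omega> (grid_point T n k))) = 0"
    using grid_point_in[of n k] increment_orthogonal[of "grid_point T n k" T "\<lambda>\<omega>. Z \<omega> * measure (K \<omega>) (grid_cell n k)" "C * 1"]
    by auto
qed

text \<open>Each grid cell has a weight that is known at the grid point, so the tangent of the convex function
  \<open>excess c\<close> at the path value has zero weighted expectation.\<close>

lemma excess_grid_le:
  assumes c: "0 \<le> c"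
  shows "(LINT z|Q. indicator {0..T} (snd z) * excess c (fst z (grid_up T n (snd z)))) \<le> (LINT \<omega>|P. excess c (\<omega> T))"
proof -
  define G where "G p \<omega> = excess c (\<omega> T) - excess c (\<omega> p)" for p and \<omega> :: path
  have int: "integrable P (G p)" if "p \<in> {0..T}" for p
    unfolding G_def using integrable_excess[OF c T_in] integrable_excess[OF c that] by simp
  have "0 \<le> (\<Sum>k\<le>nat \<lceil>real (Suc n) * T\<rceil>. LINT \<omega>|P. G (grid_point T n k) \<omega> * measure (K \<omega>) (grid_cell n k))"
  proof (rule sum_nonneg)
    fix k assume "k \<in> {..nat \<lceil>real (Suc n) * T\<rceil>}"
    let ?p = "grid_point T n k" and ?V = "\<lambda>\<omega>. measure (K \<omega>) (grid_cell n k)"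
    define s where "s x = (if c < x then 1 else if x < - c then -1 else 0 :: real)" for x
    have s: "s \<in> borel_measurable borel" unfolding s_def by measurable
    have coord: "(\<lambda>\<omega>. \<omega> ?p) \<in> borel_measurable (\<F> ?p)"
      using grid_point_in[of n k] by (intro path_filtration_coordinate) auto
    have Z: "(\<lambda>\<omega>. s (\<omega> ?p)) \<in> borel_measurable (\<F> ?p)" by (rule measurable_compose[OF coord s])
    have b: "\<bar>s (\<omega> ?p)\<bar> \<le> 1" for \<omega> by (simp add: s_def)
    have "0 = (LINT \<omega>|P. (s (\<omega> ?p) * ?V \<omega>) * (\<omega> T - \<omega> ?p))"
      using weighted_increment_zero(2)[OF Z, where C = 1] b by simp
    also have "\<dots> \<le> (LINT \<omega>|P. G ?p \<omega> * ?V \<omega>)"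
    proof (rule integral_mono)
      show "integrable P (\<lambda>\<omega>. (s (\<omega> ?p) * ?V \<omega>) * (\<omega> T - \<omega> ?p))" using weighted_increment_zero(1)[OF Z, where C = 1] b by simp
      show "integrable P (\<lambda>\<omega>. G ?p \<omega> * ?V \<omega>)"
        by (rule integral_Q_product(3)[OF int[OF grid_point_in]]) (simp add: grid_cell_def)
      fix \<omega>
      have "(s (\<omega> ?p) * (\<omega> T - \<omega> ?p)) * ?V \<omega> \<le> G ?p \<omega> * ?V \<omega>"
        unfolding s_def G_def by (intro mult_right_mono excess_tangent c) auto
      then show "(s (\<omega> ?p) * ?V \<omega>) * (\<omega> T - \<omega> ?p) \<le> G ?p \<omega> * ?V \<omega>" by (simp add: ac_simps)
    qed
    finally show "0 \<le> (LINT \<omega>|P. G ?p \<omega> * ?V \<omega>)" .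
  qed
  also have "\<dots> = (LINT z|Q. indicator {0..T} (snd z) * G (grid_up T n (snd z)) (fst z))"
    by (rule grid_integral(2)[OF int, symmetric])
  also have "\<dots> = (LINT z|Q. indicator {0..T} (snd z) * excess c (fst z T) - indicator {0..T} (snd z) * excess c (fst z (grid_up T n (snd z))))"
    by (simp add: G_def right_diff_distrib)
  also have "\<dots> = (LINT z|Q. indicator {0..T} (snd z) * excess c (fst z T)) -
      (LINT z|Q. indicator {0..T} (snd z) * excess c (fst z (grid_up T n (snd z))))"
    using grid_integral(1)[of "\<lambda>p \<omega>. excess c (\<omega> T)" n] grid_integral(1)[of "\<lambda>p \<omega>. excess c (\<omega> p)" n]
      integrable_excess[OF c] T_in by (intro Bochner_Integration.integral_diff) auto
  also have "(LINT z|Q. indicator {0..T} (snd z) * excess c (fst z T)) = (LINT z|Q. excess c (fst z T))"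
  proof (rule integral_cong_AE)
    show "AE z in Q. indicator {0..T} (snd z) * excess c (fst z T) = excess c (fst z T)"
      using AE_Q_time by eventually_elim simp
    show "(\<lambda>z. indicator {0..T} (snd z) * excess c (fst z T)) \<in> borel_measurable Q"
      using grid_integral(1)[of "\<lambda>p \<omega>. excess c (\<omega> T)" n] integrable_excess[OF c T_in] by auto
    show "(\<lambda>z. excess c (fst z T)) \<in> borel_measurable Q"
      using integral_Q_path(1)[OF integrable_excess[OF c T_in]] by auto
  qed
  also have "\<dots> = (LINT \<omega>|P. excess c (\<omega> T))" by (rule integral_Q_path(2)[OF integrable_excess[OF c T_in]])
  finally show ?thesis by simp
qed

lemma excess_clip:
  assumes c: "0 \<le> c"
  shows "integrable Q (\<lambda>z. excess c (clip T (fst z) (snd z)))"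
    and "(LINT z|Q. excess c (clip T (fst z) (snd z))) \<le> (LINT \<omega>|P. excess c (\<omega> T))"
proof -
  have m: "(\<lambda>z. excess c (clip T (fst z) (snd z))) \<in> borel_measurable Q"
    unfolding measurable_Q_iff by (rule measurable_compose[OF clip_measurable' measurable_excess])
  note gi = grid_integral(1)[of "\<lambda>p \<omega>. excess c (\<omega> p)", OF integrable_excess[OF c]]
  have nn: "0 \<le> (LINT \<omega>|P. excess c (\<omega> T))" using excess_nonneg by simp
  have cont: "isCont (excess c) x" for x unfolding excess_def by (intro continuous_intros)
  have "(\<integral>\<^sup>+z. ennreal (excess c (clip T (fst z) (snd z))) \<partial>Q) =
      (\<integral>\<^sup>+z. liminf (\<lambda>n. ennreal (indicator {0..T} (snd z) * excess c (fst z (grid_up T n (snd z))))) \<partial>Q)"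
  proof (rule nn_integral_cong_AE)
    show "AE z in Q. ennreal (excess c (clip T (fst z) (snd z))) =
        liminf (\<lambda>n. ennreal (indicator {0..T} (snd z) * excess c (fst z (grid_up T n (snd z)))))"
      using AE_Q_time AE_space
    proof eventually_elim
      case (elim z)
      then have "cadlag_on T (fst z)" by (auto simp: space_Q space_P cadlag_paths_def)
      then have "(\<lambda>n. fst z (grid_up T n (snd z))) \<longlonglongrightarrow> fst z (snd z)"
        using elim by (intro cadlag_grid_up_tendsto)
      then have "(\<lambda>n. excess c (fst z (grid_up T n (snd z)))) \<longlonglongrightarrow> excess c (fst z (snd z))"
        using cont isCont_tendsto_compose by blast
      then have "(\<lambda>n. ennreal (excess c (fst z (grid_up T n (snd z))))) \<longlonglongrightarrow> ennreal (excess c (fst z (snd z)))"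
        by (rule tendsto_ennrealI)
      then have "liminf (\<lambda>n. ennreal (excess c (fst z (grid_up T n (snd z))))) = ennreal (excess c (fst z (snd z)))"
        by (intro lim_imp_Liminf) simp_all
      then show ?case using elim by (simp add: clip_def)
    qed
  qed
  also have "\<dots> \<le> liminf (\<lambda>n. \<integral>\<^sup>+z. ennreal (indicator {0..T} (snd z) * excess c (fst z (grid_up T n (snd z)))) \<partial>Q)"
    by (rule nn_integral_liminf) (use gi in auto)
  also have "\<dots> \<le> liminf (\<lambda>n. ennreal (LINT \<omega>|P. excess c (\<omega> T)))"
  proof (rule Liminf_mono, rule always_eventually, rule allI)
    fix n
    have "(\<integral>\<^sup>+z. ennreal (indicator {0..T} (snd z) * excess c (fst z (grid_up T n (snd z)))) \<partial>Q) =
        ennreal (LINT z|Q. indicator {0..T} (snd z) * excess c (fst z (grid_up T n (snd z))))"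
      using gi excess_nonneg by (intro nn_integral_eq_integral) auto
    also have "\<dots> \<le> ennreal (LINT \<omega>|P. excess c (\<omega> T))" by (intro ennreal_leI excess_grid_le c)
    finally show "(\<integral>\<^sup>+z. ennreal (indicator {0..T} (snd z) * excess c (fst z (grid_up T n (snd z)))) \<partial>Q)
      \<le> ennreal (LINT \<omega>|P. excess c (\<omega> T))" .
  qed
  finally have le: "(\<integral>\<^sup>+z. ennreal (excess c (clip T (fst z) (snd z))) \<partial>Q) \<le> ennreal (LINT \<omega>|P. excess c (\<omega> T))"
    by (simp add: Liminf_const)
  show int: "integrable Q (\<lambda>z. excess c (clip T (fst z) (snd z)))"
    using m le excess_nonneg by (intro integrableI_nonneg) (auto intro: le_less_trans)
  have "ennreal (LINT z|Q. excess c (clip T (fst z) (snd z))) = (\<integral>\<^sup>+z. ennreal (excess c (clip T (fst z) (snd z))) \<partial>Q)"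
    using int excess_nonneg by (intro nn_integral_eq_integral[symmetric]) auto
  then show "(LINT z|Q. excess c (clip T (fst z) (snd z))) \<le> (LINT \<omega>|P. excess c (\<omega> T))"
    using le by (simp only: ennreal_le_iff[OF nn, symmetric])
qed

lemma integrable_clip: "integrable Q (\<lambda>z. clip T (fst z) (snd z))"
proof (rule Bochner_Integration.integrable_bound[OF excess_clip(1)[of 0]])
  show "(\<lambda>z. clip T (fst z) (snd z)) \<in> borel_measurable Q" unfolding measurable_Q_iff by (rule clip_measurable')
qed (auto simp: excess_def)

abbreviation "gap z \<equiv> fst z T - clip T (fst z) (snd z)"

lemma integrable_gap: "integrable Q gap"
  using integral_Q_path(1)[OF integrable_coordinate[OF T_in]] integrable_clip by simp

abbreviation "pair z \<equiv> (fst z 0, clip T (fst z) (snd z))"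

lemma pair_measurable: "pair \<in> borel_measurable Q"
  using integral_Q_path(1)[OF integrable_coordinate[OF zero_in]] integrable_clip
  by (intro borel_measurable_Pair) auto

lemma excess_vanishes: "(\<lambda>c. LINT \<omega>|P. excess (real c) (\<omega> T)) \<longlonglongrightarrow> 0"
proof -
  have "(\<lambda>c. LINT \<omega>|P. excess (real c) (\<omega> T)) \<longlonglongrightarrow> (LINT \<omega>|P. 0)"
  proof (rule integral_dominated_convergence[where w = "\<lambda>\<omega>. \<bar>\<omega> T\<bar>"])
    show "AE \<omega> in P. (\<lambda>c. excess (real c) (\<omega> T)) \<longlonglongrightarrow> 0"
    proof (rule AE_I2)
      fix \<omega> :: path
      obtain N :: nat where N: "\<bar>\<omega> T\<bar> < real N" using reals_Archimedean2 by blast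
      have "\<forall>\<^sub>F c in sequentially. 0 = excess (real c) (\<omega> T)"
        using eventually_ge_at_top[of N] by eventually_elim (use N in \<open>auto simp: excess_def\<close>)
      then show "(\<lambda>c. excess (real c) (\<omega> T)) \<longlonglongrightarrow> 0" by (rule Lim_transform_eventually[OF tendsto_const])
    qed
    show "integrable P (\<lambda>\<omega>. \<bar>\<omega> T\<bar>)" using integrable_coordinate[OF T_in] by simp
    show "(\<lambda>\<omega>. excess (real c) (\<omega> T)) \<in> borel_measurable P" for c
      using integrable_excess[of "real c" T] T_in by auto
    show "AE \<omega> in P. norm (excess (real c) (\<omega> T)) \<le> \<bar>\<omega> T\<bar>" for c
      using excess_le[of "real c"] excess_nonneg by simp
  qed simp
  then show ?thesis by simp
qed

lemma integrable_gap_bounded: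
  assumes "\<eta> \<in> borel_measurable borel" "\<And>x. \<bar>\<eta> x\<bar> \<le> (C :: real)"
  shows "integrable Q (\<lambda>z. gap z * \<eta> (pair z))"
  by (rule integrable_times_bounded[OF integrable_gap measurable_compose[OF pair_measurable assms(1)] assms(2)])

text \<open>Riemann sums of the gap vanish by the martingale property. Their limit is taken after
  clamping the path, as the running maximum of the path need not be integrable.\<close>

lemma gap_continuous_zero:
  assumes cont: "continuous_on UNIV \<eta>" and bound: "\<And>x. \<bar>\<eta> x\<bar> \<le> (C :: real)"
  shows "(LINT z|Q. gap z * \<eta> (pair z)) = 0"
proof -
  have C0: "0 \<le> C" using bound[of undefined] by linarith
  have eta[measurable]: "\<eta> \<in> borel_measurable borel" by (rule borel_measurable_continuous_onI[OF cont])
  define e where "e c = (LINT \<omega>|P. excess (real c) (\<omega> T))" for c :: nat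
  have le: "\<bar>LINT z|Q. gap z * \<eta> (pair z)\<bar> \<le> 2 * C * e c" for c
  proof -
    define cz where "cz n z = indicator {0..T} (snd z) * ((fst z T - clamp (real c) (fst z (grid_up T n (snd z)))) * \<eta> (fst z 0, fst z (grid_up T n (snd z))))"
      for n and z :: "path \<times> real"
    define limz where "limz z = (fst z T - clamp (real c) (clip T (fst z) (snd z))) * \<eta> (pair z)" for z
    have eta_P: "(\<lambda>\<omega>. \<eta> (\<omega> 0, \<omega> p)) \<in> borel_measurable P" if p: "p \<in> {0..T}" for p
      by (rule measurable_compose[OF borel_measurable_Pair eta])
        (rule measurable_coordinate[OF zero_in] measurable_coordinate[OF p])+
    have Gi: "integrable P (\<lambda>\<omega>. (\<omega> T - \<omega> p) * \<eta> (\<omega> 0, \<omega> p))" if p: "p \<in> {0..T}" for p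
      using integrable_coordinate[OF T_in] integrable_coordinate[OF p]
      by (intro integrable_times_bounded[OF _ eta_P[OF p] bound]) simp
    have zero: "(LINT z|Q. indicator {0..T} (snd z) * ((fst z T - fst z (grid_up T n (snd z))) * \<eta> (fst z 0, fst z (grid_up T n (snd z))))) = 0" for n
    proof (subst grid_integral(2)[OF Gi], simp, rule sum.neutral, rule ballI)
      fix k
      let ?p = "grid_point T n k"
      have "(\<lambda>\<omega>. (\<omega> 0, \<omega> ?p)) \<in> borel_measurable (\<F> ?p)"
        using grid_point_in[of n k] by (intro borel_measurable_Pair path_filtration_coordinate) auto
      then have "(\<lambda>\<omega>. \<eta> (\<omega> 0, \<omega> ?p)) \<in> borel_measurable (\<F> ?p)" by (rule measurable_compose[OF _ eta])
      from weighted_increment_zero(2)[OF this bound]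
      show "(LINT \<omega>|P. (\<omega> T - \<omega> ?p) * \<eta> (\<omega> 0, \<omega> ?p) * measure (K \<omega>) (grid_cell n k)) = 0"
        by (simp add: ac_simps)
    qed
    have czi: "integrable P (\<lambda>\<omega>. (\<omega> T - clamp (real c) (\<omega> p)) * \<eta> (\<omega> 0, \<omega> p))" if p: "p \<in> {0..T}" for p
    proof (rule integrable_times_bounded[OF _ eta_P[OF p] bound])
      have "integrable P (\<lambda>\<omega>. clamp (real c) (\<omega> p))"
        by (rule integrable_const_bound[of _ "real c"])
          (use clamp_excess(2) measurable_compose[OF measurable_coordinate[OF p] measurable_clamp] in auto)
      then show "integrable P (\<lambda>\<omega>. \<omega> T - clamp (real c) (\<omega> p))" using integrable_coordinate[OF T_in] by simp
    qed
    have cint: "integrable Q (cz n)" for n unfolding cz_def by (rule grid_integral(1)[OF czi])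
    have pm: "(\<lambda>z. \<eta> (pair z)) \<in> borel_measurable Q" by (rule measurable_compose[OF pair_measurable eta])
    have clm: "(\<lambda>z. clamp (real c) (clip T (fst z) (snd z))) \<in> borel_measurable Q"
      using integrable_clip by (intro measurable_compose[OF _ measurable_clamp]) auto
    have XTi: "integrable Q (\<lambda>z. fst z T)" by (rule integral_Q_path(1)[OF integrable_coordinate[OF T_in]])
    have lm: "limz \<in> borel_measurable Q"
      unfolding limz_def using pm clm XTi by (intro borel_measurable_times borel_measurable_diff) auto
    have bnd: "\<bar>(x - clamp (real c) y) * \<eta> w\<bar> \<le> C * (\<bar>x\<bar> + real c)" for x y w
    proof -
      have "\<bar>x - clamp (real c) y\<bar> \<le> \<bar>x\<bar> + real c" using clamp_excess(2)[of "real c" y] by linarith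
      then have "\<bar>x - clamp (real c) y\<bar> * \<bar>\<eta> w\<bar> \<le> (\<bar>x\<bar> + real c) * C"
        using bound by (intro mult_mono) auto
      then show ?thesis by (simp add: abs_mult mult.commute)
    qed
    have lim: "(\<lambda>n. LINT z|Q. cz n z) \<longlonglongrightarrow> (LINT z|Q. limz z)"
    proof (rule integral_dominated_convergence[where w = "\<lambda>z. C * (\<bar>fst z T\<bar> + real c)"])
      show "integrable Q (\<lambda>z. C * (\<bar>fst z T\<bar> + real c))" using XTi by simp
      show "AE z in Q. (\<lambda>n. cz n z) \<longlonglongrightarrow> limz z"
        using AE_Q_time AE_space
      proof eventually_elim
        case (elim z)
        then have "cadlag_on T (fst z)" by (auto simp: space_Q space_P cadlag_paths_def)
        then have l: "(\<lambda>n. fst z (grid_up T n (snd z))) \<longlonglongrightarrow> fst z (snd z)"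
          using elim by (intro cadlag_grid_up_tendsto)
        have "(\<lambda>n. \<eta> (fst z 0, fst z (grid_up T n (snd z)))) \<longlonglongrightarrow> \<eta> (fst z 0, fst z (snd z))"
          using cont l by (intro continuous_on_tendsto_compose[OF cont] tendsto_intros) auto
        moreover have "(\<lambda>n. clamp (real c) (fst z (grid_up T n (snd z)))) \<longlonglongrightarrow> clamp (real c) (fst z (snd z))"
          unfolding clamp_def by (intro tendsto_intros l)
        ultimately have "(\<lambda>n. (fst z T - clamp (real c) (fst z (grid_up T n (snd z)))) * \<eta> (fst z 0, fst z (grid_up T n (snd z))))
            \<longlonglongrightarrow> (fst z T - clamp (real c) (fst z (snd z))) * \<eta> (fst z 0, fst z (snd z))"
          by (intro tendsto_intros)
        then show ?case using elim by (simp add: cz_def limz_def clip_def)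
      qed
      show "AE z in Q. norm (cz n z) \<le> C * (\<bar>fst z T\<bar> + real c)" for n
        using bnd C0 by (intro AE_I2) (auto simp: cz_def indicator_def)
      show "cz n \<in> borel_measurable Q" for n using cint by auto
    qed (rule lm)
    have "\<bar>LINT z|Q. cz n z\<bar> \<le> C * e c" for n
    proof -
      let ?g = "\<lambda>z. indicator {0..T} (snd z) * ((fst z T - fst z (grid_up T n (snd z))) * \<eta> (fst z 0, fst z (grid_up T n (snd z))))"
      have gi: "integrable Q ?g" by (rule grid_integral(1)[OF Gi])
      have xi: "integrable Q (\<lambda>z. indicator {0..T} (snd z) * excess (real c) (fst z (grid_up T n (snd z))))"
        by (rule grid_integral(1)[OF integrable_excess]) auto
      have "\<bar>LINT z|Q. cz n z\<bar> = \<bar>LINT z|Q. cz n z - ?g z\<bar>" using zero[of n] gi cint[of n] by simp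
      also have "\<dots> \<le> (LINT z|Q. \<bar>cz n z - ?g z\<bar>)" by (rule integral_abs_bound)
      also have "\<dots> \<le> (LINT z|Q. C * (indicator {0..T} (snd z) * excess (real c) (fst z (grid_up T n (snd z)))))"
      proof (rule integral_mono)
        show "integrable Q (\<lambda>z. \<bar>cz n z - ?g z\<bar>)" using gi cint[of n] by simp
        show "integrable Q (\<lambda>z. C * (indicator {0..T} (snd z) * excess (real c) (fst z (grid_up T n (snd z)))))" using xi by simp
        fix z
        let ?x = "fst z (grid_up T n (snd z))" and ?h = "\<eta> (fst z 0, fst z (grid_up T n (snd z)))"
        have "cz n z - ?g z = indicator {0..T} (snd z) * ((?x - clamp (real c) ?x) * ?h)"
          by (simp add: cz_def algebra_simps)
        then have "\<bar>cz n z - ?g z\<bar> = indicator {0..T} (snd z) * (excess (real c) ?x * \<bar>?h\<bar>)"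
          using clamp_excess(1)[of "real c" ?x] by (simp add: abs_mult)
        also have "\<dots> \<le> indicator {0..T} (snd z) * (excess (real c) ?x * C)"
          using bound excess_nonneg by (intro mult_left_mono) auto
        finally show "\<bar>cz n z - ?g z\<bar> \<le> C * (indicator {0..T} (snd z) * excess (real c) ?x)"
          by (simp add: ac_simps)
      qed
      also have "\<dots> = C * (LINT z|Q. indicator {0..T} (snd z) * excess (real c) (fst z (grid_up T n (snd z))))"
        by simp
      also have "\<dots> \<le> C * e c" unfolding e_def using C0 by (intro mult_left_mono excess_grid_le) auto
      finally show ?thesis .
    qed
    then have "\<bar>LINT z|Q. limz z\<bar> \<le> C * e c"
      by (intro LIMSEQ_le_const2[OF tendsto_rabs[OF lim]]) auto
    moreover have "\<bar>(LINT z|Q. gap z * \<eta> (pair z)) - (LINT z|Q. limz z)\<bar> \<le> C * e c"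
    proof -
      have li: "integrable Q limz"
      proof (rule Bochner_Integration.integrable_bound[OF _ lm])
        show "integrable Q (\<lambda>z. C * (\<bar>fst z T\<bar> + real c))" using XTi by simp
        show "AE z in Q. norm (limz z) \<le> norm (C * (\<bar>fst z T\<bar> + real c))"
        proof (rule AE_I2)
          fix z
          show "norm (limz z) \<le> norm (C * (\<bar>fst z T\<bar> + real c))"
            using bnd[of "fst z T" "clip T (fst z) (snd z)" "pair z"] by (simp add: limz_def)
        qed
      qed
      have gi: "integrable Q (\<lambda>z. gap z * \<eta> (pair z))" by (rule integrable_gap_bounded[OF eta bound])
      have xi: "integrable Q (\<lambda>z. excess (real c) (clip T (fst z) (snd z)))" by (rule excess_clip(1)) simp
      have "\<bar>(LINT z|Q. gap z * \<eta> (pair z)) - (LINT z|Q. limz z)\<bar> = \<bar>LINT z|Q. gap z * \<eta> (pair z) - limz z\<bar>"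
        using gi li by simp
      also have "\<dots> \<le> (LINT z|Q. \<bar>gap z * \<eta> (pair z) - limz z\<bar>)" by (rule integral_abs_bound)
      also have "\<dots> \<le> (LINT z|Q. C * excess (real c) (clip T (fst z) (snd z)))"
      proof (rule integral_mono)
        show "integrable Q (\<lambda>z. \<bar>gap z * \<eta> (pair z) - limz z\<bar>)" using gi li by simp
        show "integrable Q (\<lambda>z. C * excess (real c) (clip T (fst z) (snd z)))" using xi by simp
        fix z
        let ?x = "clip T (fst z) (snd z)"
        have "gap z * \<eta> (pair z) - limz z = (clamp (real c) ?x - ?x) * \<eta> (pair z)"
          by (simp add: limz_def algebra_simps)
        then have "\<bar>gap z * \<eta> (pair z) - limz z\<bar> = excess (real c) ?x * \<bar>\<eta> (pair z)\<bar>"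
          using clamp_excess(1)[of "real c" ?x] by (simp add: abs_mult abs_minus_commute)
        also have "\<dots> \<le> excess (real c) ?x * C" using bound excess_nonneg by (intro mult_left_mono) auto
        finally show "\<bar>gap z * \<eta> (pair z) - limz z\<bar> \<le> C * excess (real c) ?x" by (simp add: mult.commute)
      qed
      also have "\<dots> = C * (LINT z|Q. excess (real c) (clip T (fst z) (snd z)))" by simp
      also have "\<dots> \<le> C * e c" unfolding e_def using C0 by (intro mult_left_mono excess_clip(2)) auto
      finally show ?thesis .
    qed
    \<comment> \<open>Clamping at \<open>c\<close> costs \<open>C * e c\<close> before and once more after the limit in \<open>n\<close>.\<close>
    ultimately show ?thesis by linarith
  qed
  have "(\<lambda>c. 2 * C * e c) \<longlonglongrightarrow> 2 * C * 0"
    unfolding e_def by (intro tendsto_mult tendsto_const excess_vanishes)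
  then have "\<bar>LINT z|Q. gap z * \<eta> (pair z)\<bar> \<le> 0"
    using le by (intro LIMSEQ_le_const) auto
  then show ?thesis by simp
qed

lemma gap_open_zero:
  assumes U: "open U"
  shows "(LINT z|Q. gap z * indicator U (pair z)) = 0"
proof (cases "U = UNIV")
  case True
  then show ?thesis using gap_continuous_zero[of "\<lambda>_. 1" 1] by simp
next
  case False
  then have ne: "- U \<noteq> {}" by auto
  define \<eta> where "\<eta> k x = min 1 (real k * infdist x (- U))" for k and x :: "real \<times> real"
  have eta01: "0 \<le> \<eta> k x" "\<eta> k x \<le> 1" for k x by (simp_all add: \<eta>_def infdist_nonneg)
  have gm: "gap \<in> borel_measurable Q" using integrable_gap by (rule borel_measurable_integrable)
  have lim: "(\<lambda>k. LINT z|Q. gap z * \<eta> k (pair z)) \<longlonglongrightarrow> (LINT z|Q. gap z * indicator U (pair z))"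
  proof (rule integral_dominated_convergence[where w = "\<lambda>z. \<bar>gap z\<bar>"])
    show "integrable Q (\<lambda>z. \<bar>gap z\<bar>)" using integrable_gap by simp
    show "AE z in Q. (\<lambda>k. gap z * \<eta> k (pair z)) \<longlonglongrightarrow> gap z * indicator U (pair z)"
    proof (intro AE_I2 tendsto_mult tendsto_const)
      fix z
      show "(\<lambda>k. \<eta> k (pair z)) \<longlonglongrightarrow> indicator U (pair z)"
      proof (cases "pair z \<in> U")
        case True
        have "infdist (pair z) (- U) \<noteq> 0"
          using True in_closed_iff_infdist_zero[of "- U" "pair z"] U ne by (simp add: closed_Compl)
        then have pos: "0 < infdist (pair z) (- U)" using infdist_nonneg[of "pair z" "- U"] by linarith
        obtain N :: nat where N: "1 / infdist (pair z) (- U) < real N" using reals_Archimedean2 by blast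
        have "\<forall>\<^sub>F k in sequentially. 1 = \<eta> k (pair z)"
          using eventually_ge_at_top[of N]
        proof eventually_elim
          case (elim k)
          then have "1 / infdist (pair z) (- U) < real k" using N by linarith
          then have "1 < real k * infdist (pair z) (- U)" using pos by (simp add: pos_divide_less_eq)
          then show ?case by (simp add: \<eta>_def)
        qed
        then have "(\<lambda>k. \<eta> k (pair z)) \<longlonglongrightarrow> 1" by (rule Lim_transform_eventually[OF tendsto_const])
        then show ?thesis using True by simp
      next
        case False
        then have "\<eta> k (pair z) = 0" for k by (simp add: \<eta>_def)
        then show ?thesis using False by simp
      qed
    qed
    show "AE z in Q. norm (gap z * \<eta> k (pair z)) \<le> \<bar>gap z\<bar>" for k
    proof (rule AE_I2)
      fix z
      have "\<bar>gap z\<bar> * \<bar>\<eta> k (pair z)\<bar> \<le> \<bar>gap z\<bar> * 1" using eta01[of k "pair z"] by (intro mult_left_mono) auto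
      then show "norm (gap z * \<eta> k (pair z)) \<le> \<bar>gap z\<bar>" by (simp add: abs_mult)
    qed
    show "(\<lambda>z. gap z * \<eta> k (pair z)) \<in> borel_measurable Q" for k
    proof -
      have "\<eta> k \<in> borel_measurable borel" unfolding \<eta>_def
        by (intro borel_measurable_continuous_onI continuous_intros)
      then show ?thesis by (intro borel_measurable_times[OF gm] measurable_compose[OF pair_measurable])
    qed
    have "(indicator U :: _ \<Rightarrow> real) \<in> borel_measurable borel" using U by simp
    then show "(\<lambda>z. gap z * indicator U (pair z)) \<in> borel_measurable Q"
      by (intro borel_measurable_times[OF gm] measurable_compose[OF pair_measurable])
  qed
  have "(LINT z|Q. gap z * \<eta> k (pair z)) = 0" for k
  proof (rule gap_continuous_zero)
    show "continuous_on UNIV (\<eta> k)" unfolding \<eta>_def by (intro continuous_intros)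
    show "\<bar>\<eta> k x\<bar> \<le> 1" for x using eta01[of k x] by simp
  qed
  with lim show ?thesis by (simp add: LIMSEQ_const_iff)
qed

text \<open>The positive and the negative part of the gap have the same image under \<open>(X\<^sub>0, X\<^sub>t)\<close>, since
  the two image measures agree on open sets.\<close>

lemma gap_orthogonal:
  assumes eta: "\<eta> \<in> borel_measurable borel" and bound: "\<And>x. \<bar>\<eta> x\<bar> \<le> (C :: real)"
  shows "integrable Q (\<lambda>z. gap z * \<eta> (pair z))" and "(LINT z|Q. gap z * \<eta> (pair z)) = 0"
proof -
  show "integrable Q (\<lambda>z. gap z * \<eta> (pair z))" by (rule integrable_gap_bounded[OF eta bound])
  define p n where "p z = max 0 (gap z)" and "n z = max 0 (- gap z)" for z
  have pos_part: "integrable Q (\<lambda>z. max 0 (k z))" if "integrable Q k" for k :: "path \<times> real \<Rightarrow> real"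
    using that by auto
  have pn: "integrable Q p" "integrable Q n"
    unfolding p_def[abs_def] n_def[abs_def]
    by (rule pos_part[OF integrable_gap], rule pos_part[OF Bochner_Integration.integrable_minus[OF integrable_gap]])
  have nonneg: "0 \<le> p z" "0 \<le> n z" "gap z = p z - n z" for z by (auto simp: p_def n_def)
  define \<rho> where "\<rho> g = distr (density Q (\<lambda>z. ennreal (g z))) borel pair" for g :: "path \<times> real \<Rightarrow> real"
  have pd: "pair \<in> borel_measurable (density Q f)" for f using pair_measurable by simp
  have em: "emeasure (\<rho> g) U = ennreal (LINT z|Q. g z * indicator U (pair z))"
    if g: "integrable Q g" "\<And>z. 0 \<le> g z" and U: "U \<in> sets borel" for g U
  proof -
    have m: "(\<lambda>z. indicator U (pair z) :: real) \<in> borel_measurable Q"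
      using measurable_compose[OF pair_measurable, of "indicator U :: _ \<Rightarrow> real"] U by auto
    have pre: "pair -` U \<inter> space Q \<in> sets Q" using pair_measurable U by (rule measurable_sets)
    have "emeasure (\<rho> g) U = emeasure (density Q (\<lambda>z. ennreal (g z))) (pair -` U \<inter> space Q)"
      unfolding \<rho>_def using U by (subst emeasure_distr[OF pd]) auto
    also have "\<dots> = (\<integral>\<^sup>+z. ennreal (g z) * indicator (pair -` U \<inter> space Q) z \<partial>Q)"
      using g pre by (intro emeasure_density) auto
    also have "\<dots> = (\<integral>\<^sup>+z. ennreal (g z * indicator U (pair z)) \<partial>Q)"
      using g by (intro nn_integral_cong) (auto simp: indicator_def)
    also have "\<dots> = ennreal (LINT z|Q. g z * indicator U (pair z))"
    proof (rule nn_integral_eq_integral)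
      show "integrable Q (\<lambda>z. g z * indicator U (pair z))"
        by (rule Bochner_Integration.integrable_bound[OF g(1)]) (use g m in \<open>auto simp: indicator_def\<close>)
    qed (use g in auto)
    finally show ?thesis .
  qed
  have "\<rho> p = \<rho> n"
  proof (rule measure_eqI_generator_eq[where E = "{S. open S}" and \<Omega> = UNIV and A = "\<lambda>_. UNIV"])
    show "Int_stable {S :: (real \<times> real) set. open S}" by (auto simp: Int_stable_def)
    show "emeasure (\<rho> p) U = emeasure (\<rho> n) U" if "U \<in> {S. open S}" for U
    proof -
      have U: "open U" "U \<in> sets borel" using that by auto
      have m: "(\<lambda>z. indicator U (pair z) :: real) \<in> borel_measurable Q"
        using measurable_compose[OF pair_measurable, of "indicator U :: _ \<Rightarrow> real"] U by auto
      have int: "integrable Q (\<lambda>z. g z * indicator U (pair z))" if "integrable Q g" for g :: "path \<times> real \<Rightarrow> real"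
        by (rule Bochner_Integration.integrable_bound[OF that]) (use that m in \<open>auto simp: indicator_def\<close>)
      have "(LINT z|Q. p z * indicator U (pair z)) - (LINT z|Q. n z * indicator U (pair z)) =
          (LINT z|Q. p z * indicator U (pair z) - n z * indicator U (pair z))"
        using int pn by simp
      also have "\<dots> = (LINT z|Q. gap z * indicator U (pair z))"
        unfolding nonneg(3) by (simp add: left_diff_distrib)
      also have "\<dots> = 0" by (rule gap_open_zero[OF U(1)])
      finally show ?thesis using em[OF pn(1) nonneg(1) U(2)] em[OF pn(2) nonneg(2) U(2)] by simp
    qed
    show "emeasure (\<rho> p) UNIV \<noteq> \<infinity>" for i :: nat using em[OF pn(1) nonneg(1), of UNIV] by simp
    show "sets (\<rho> p) = sigma_sets UNIV {S. open S}" "sets (\<rho> n) = sigma_sets UNIV {S. open S}"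
      by (simp_all add: \<rho>_def sets_borel)
  qed auto
  moreover have int_eq: "integral\<^sup>L (\<rho> g) \<eta> = (LINT z|Q. g z * \<eta> (pair z))"
    if g: "integrable Q g" "\<And>z. 0 \<le> g z" for g
  proof -
    have "integral\<^sup>L (\<rho> g) \<eta> = integral\<^sup>L (density Q (\<lambda>z. ennreal (g z))) (\<lambda>z. \<eta> (pair z))"
      unfolding \<rho>_def by (rule integral_distr[OF pd eta])
    also have "\<dots> = (LINT z|Q. g z *\<^sub>R \<eta> (pair z))"
      using measurable_compose[OF pair_measurable eta] g by (intro integral_density) auto
    finally show ?thesis by simp
  qed
  ultimately have eq: "(LINT z|Q. p z * \<eta> (pair z)) = (LINT z|Q. n z * \<eta> (pair z))"
    using int_eq[OF pn(1) nonneg(1)] int_eq[OF pn(2) nonneg(2)] by simp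
  have int: "integrable Q (\<lambda>z. g z * \<eta> (pair z))" if "integrable Q g" for g
    by (rule integrable_times_bounded[OF that measurable_compose[OF pair_measurable eta] bound])
  show "(LINT z|Q. gap z * \<eta> (pair z)) = 0"
    unfolding nonneg(3) left_diff_distrib using eq int[OF pn(1)] int[OF pn(2)] by simp
qed

end

section \<open>Martingale transports of an irreducible pair\<close>

lemma borel_measurable_finite_support:
  fixes k :: "real \<Rightarrow> real"
  assumes "finite S"
  shows "(\<lambda>x. indicator S x * k x) \<in> borel_measurable borel"
proof -
  have "indicator S x * k x = (\<Sum>c\<in>S. k c * indicator {c} x)" for x
  proof (cases "x \<in> S")
    case True
    have "(\<Sum>c\<in>S. k c * indicator {c} x) = (\<Sum>c\<in>S. if c = x then k c else 0)"
      by (intro sum.cong) (auto simp: indicator_def)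
    then show ?thesis using assms True by simp
  next
    case False
    then have "(\<Sum>c\<in>S. k c * indicator {c} x) = 0"
      by (intro sum.neutral) (auto simp: indicator_def)
    then show ?thesis using False by simp
  qed
  then show ?thesis by simp
qed

locale transport_martingale = irreducible_measures + path_martingale +
  assumes law_0: "distr P borel (\<lambda>\<omega>. \<omega> 0) = \<mu>" and law_T: "distr P borel (\<lambda>\<omega>. \<omega> T) = \<nu>"
begin

lemma times_in: "0 \<in> {0..T}" "T \<in> {0..T}"
  using T_pos by auto

lemma AE_start:
  assumes "AE x in \<mu>. R x"
  shows "AE \<omega> in P. R (\<omega> 0)"
proof -
  have "AE x in distr P borel (\<lambda>\<omega>. \<omega> 0). R x" unfolding law_0 by (rule assms)
  then show ?thesis by (rule AE_distrD[OF measurable_coordinate[OF times_in(1)]])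
qed

lemma AE_end:
  assumes "AE x in \<nu>. R x"
  shows "AE \<omega> in P. R (\<omega> T)"
proof -
  have "AE x in distr P borel (\<lambda>\<omega>. \<omega> T). R x" unfolding law_T by (rule assms)
  then show ?thesis by (rule AE_distrD[OF measurable_coordinate[OF times_in(2)]])
qed

lemma integral_start:
  fixes k :: "real \<Rightarrow> real"
  assumes "k \<in> borel_measurable borel"
  shows "(LINT \<omega>|P. k (\<omega> 0)) = (LINT x|\<mu>. k x)" "integrable P (\<lambda>\<omega>. k (\<omega> 0)) \<longleftrightarrow> integrable \<mu> k"
  using integral_distr[OF measurable_coordinate[OF times_in(1)] assms]
    integrable_distr_eq[OF measurable_coordinate[OF times_in(1)] assms] by (simp_all add: law_0)

lemma integral_end:
  fixes k :: "real \<Rightarrow> real"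
  assumes "k \<in> borel_measurable borel"
  shows "(LINT \<omega>|P. k (\<omega> T)) = (LINT x|\<nu>. k x)" "integrable P (\<lambda>\<omega>. k (\<omega> T)) \<longleftrightarrow> integrable \<nu> k"
  using integral_distr[OF measurable_coordinate[OF times_in(2)] assms]
    integrable_distr_eq[OF measurable_coordinate[OF times_in(2)] assms] by (simp_all add: law_T)

text \<open>Up to a sign \<open>\<sigma> b\<close>, the difference to an endpoint \<open>b\<close> of \<open>I\<close> is a nonnegative martingale, so the
  path is absorbed in \<open>b\<close> and cannot cross it. A path that is absorbed in \<open>b\<close> ends there, and the
  final value lies in \<open>J\<close>.\<close>

lemma AE_relevant: "AE \<omega> in P. \<omega> \<in> relevant_paths T I J"
proof (cases "I = {}")
  case True
  have "AE \<omega> in P. \<omega> 0 \<in> I" by (rule AE_start[OF AE_mu_I])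
  then show ?thesis by eventually_elim (simp add: True)
next
  case ne: False
  define \<sigma> where "\<sigma> b = (if \<forall>x\<in>I. x < b then -1 else 1 :: real)" for b
  have side: "0 \<le> \<sigma> b * (x - b)" if "b \<in> frontier I" "x \<in> I" for b x
    using frontier_open_interval[OF open_I connected_I ne that(1)] that(2)
    by (auto simp: \<sigma>_def less_imp_le)
  have "AE \<omega> in P. \<forall>b\<in>frontier I. \<forall>t\<in>{0..T}. 0 \<le> \<sigma> b * (\<omega> t - b) \<and>
      (\<omega> t = b \<longrightarrow> (\<forall>u\<in>{t..T}. \<omega> u = b)) \<and>
      (0 < t \<longrightarrow> (\<omega> \<longlongrightarrow> b) (at_left t) \<longrightarrow> (\<forall>u\<in>{t..T}. \<omega> u = b))"
  proof (rule AE_finite_allI[OF finite_frontier_open_interval[OF open_I connected_I]])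
    fix b assume b: "b \<in> frontier I"
    have "AE y in \<nu>. 0 \<le> \<sigma> b * (y - b)"
      by (rule AE_nu_beyond_frontier[OF _ b side[OF b]]) (simp_all add: \<sigma>_def)
    then have "AE \<omega> in P. 0 \<le> \<sigma> b * (\<omega> T - b)" by (rule AE_end)
    then show "AE \<omega> in P. \<forall>t\<in>{0..T}. 0 \<le> \<sigma> b * (\<omega> t - b) \<and>
      (\<omega> t = b \<longrightarrow> (\<forall>u\<in>{t..T}. \<omega> u = b)) \<and>
      (0 < t \<longrightarrow> (\<omega> \<longlongrightarrow> b) (at_left t) \<longrightarrow> (\<forall>u\<in>{t..T}. \<omega> u = b))"
      by (rule absorbed_AE) (simp add: \<sigma>_def)
  qed
  then show ?thesis using AE_space AE_start[OF AE_mu_I] AE_end[OF AE_nu_J]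
  proof eventually_elim
    case (elim \<omega>)
    note absorb = elim(1)
    have cad: "cadlag_on T \<omega>" "\<omega> \<in> cadlag_paths T" using elim(2) by (auto simp: space_P cadlag_paths_def)
    have cl: "\<omega> t \<in> closure I" if t: "t \<in> {0..T}" for t
    proof (rule mem_closure_I[OF ne])
      fix b assume b: "b \<in> frontier I"
      have nn: "0 \<le> \<sigma> b * (\<omega> t - b)" using absorb b t by blast
      show "\<omega> t \<le> b" if "\<forall>x\<in>I. x < b" using nn that by (simp add: \<sigma>_def)
      show "b \<le> \<omega> t" if *: "\<forall>x\<in>I. b < x"
      proof -
        obtain x where "x \<in> I" using ne by blast
        then have "\<not> (\<forall>x\<in>I. x < b)" using * by force
        then have "\<sigma> b = 1" unfolding \<sigma>_def by (rule if_not_P)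
        then show ?thesis using nn by simp
      qed
    qed
    have stay: "\<omega> u = \<omega> t" if "t \<in> {0..T}" "\<omega> t \<in> frontier I" "u \<in> {t..T}" for t u
      using absorb that by metis
    have inJ: "\<omega> t \<in> J" if t: "t \<in> {0..T}" for t
    proof (cases "\<omega> t \<in> I")
      case False
      then have "\<omega> t \<in> frontier I" using cl[OF t] open_I by (simp add: frontier_def interior_open)
      then have "\<omega> T = \<omega> t" using stay[OF t, of T] t by auto
      then show ?thesis using elim(4) by simp
    qed (use I_subset_J in auto)
    have left: "\<omega> u = Lim (at_left t) \<omega>"
      if t: "t \<in> {0<..T}" "Lim (at_left t) \<omega> \<in> frontier I" "u \<in> {t..T}" for t u
    proof -
      obtain l where l: "(\<omega> \<longlongrightarrow> l) (at_left t)" using cad t unfolding cadlag_on_def by blast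
      then have Lim: "Lim (at_left t) \<omega> = l" by (intro tendsto_Lim) auto
      have "\<forall>u\<in>{t..T}. \<omega> u = l"
        using bspec[OF bspec[OF absorb, of l], of t] t l unfolding Lim by simp
      then show ?thesis using t(3) Lim by simp
    qed
    show ?case
      unfolding relevant_paths_def using cad elim(3) inJ stay left by (auto simp: frontier_J)
  qed
qed

text \<open>The kernel is half of \<open>\<bar>s - y\<bar> - \<bar>s - x\<bar> + (y - x)\<close>, minus \<open>y - x\<close> if \<open>s \<le> x\<close>; the martingale property
  cancels the terms without absolute values.\<close>

lemma nn_integral_kernel:
  "(\<integral>\<^sup>+\<omega>. ennreal (max 0 (if \<omega> 0 < s then \<omega> T - s else s - \<omega> T)) \<partial>P) =
    ennreal ((potential \<nu> s - potential \<mu> s) / 2)"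
proof -
  let ?k = "\<lambda>\<omega> :: path. max 0 (if \<omega> 0 < s then \<omega> T - s else s - \<omega> T)"
  let ?Z = "\<lambda>\<omega> :: path. indicator {s..} (\<omega> 0) :: real"
  note c0 = measurable_coordinate[OF times_in(1)] and cT = measurable_coordinate[OF times_in(2)]
  note i0 = integrable_coordinate[OF times_in(1)] and iT = integrable_coordinate[OF times_in(2)]
  have Z: "?Z \<in> borel_measurable (\<F> 0)"
    by (rule measurable_compose[OF path_filtration_coordinate]) auto
  have T0: "0 \<le> T" using T_pos by simp
  note orth = increment_orthogonal[OF order_refl T0 order_refl Z, of 1]
  have oi: "integrable P (\<lambda>\<omega>. ?Z \<omega> * (\<omega> T - \<omega> 0))" and oz: "(LINT \<omega>|P. ?Z \<omega> * (\<omega> T - \<omega> 0)) = 0"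
    using orth by (auto simp: indicator_def)
  have mean: "(LINT \<omega>|P. \<omega> T - \<omega> 0) = 0"
    using increment_orthogonal(2)[OF order_refl T0 order_refl, of "\<lambda>_. 1" 1] by simp
  have split: "?k \<omega> = (\<bar>s - \<omega> T\<bar> - \<bar>s - \<omega> 0\<bar> + (\<omega> T - \<omega> 0)) / 2 - ?Z \<omega> * (\<omega> T - \<omega> 0)" for \<omega>
    by (auto simp: indicator_def max_def abs_if field_simps)
  have int: "integrable P ?k"
    unfolding split using i0 iT oi by (intro Bochner_Integration.integrable_diff Bochner_Integration.integrable_add integrable_divide integrable_abs) auto
  have "(LINT \<omega>|P. ?k \<omega>) = ((LINT \<omega>|P. \<bar>s - \<omega> T\<bar>) - (LINT \<omega>|P. \<bar>s - \<omega> 0\<bar>) + (LINT \<omega>|P. \<omega> T - \<omega> 0)) / 2 -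
      (LINT \<omega>|P. ?Z \<omega> * (\<omega> T - \<omega> 0))"
    unfolding split using i0 iT oi by simp
  also have "\<dots> = (potential \<nu> s - potential \<mu> s) / 2"
    using integral_start(1)[of "\<lambda>x. \<bar>s - x\<bar>"] integral_end(1)[of "\<lambda>x. \<bar>s - x\<bar>"] oz mean
    by (simp add: potential_def)
  finally have "(LINT \<omega>|P. ?k \<omega>) = (potential \<nu> s - potential \<mu> s) / 2" .
  moreover have "(\<integral>\<^sup>+\<omega>. ennreal (?k \<omega>) \<partial>P) = ennreal (LINT \<omega>|P. ?k \<omega>)"
    by (rule nn_integral_eq_integral[OF int]) simp
  ultimately show ?thesis by (simp only:)
qed

lemma boundary_integral_mu: "(LINT b:(J - I)|\<mu>. \<bar>jump b\<bar>) = 0" for jump :: "real \<Rightarrow> real"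
proof -
  have "(LINT b:(J - I)|\<mu>. \<bar>jump b\<bar>) = (LINT b|\<mu>. 0)"
    unfolding set_lebesgue_integral_def
  proof (rule integral_cong_AE)
    show "AE b in \<mu>. indicator (J - I) b *\<^sub>R \<bar>jump b\<bar> = 0" using AE_mu_I by eventually_elim simp
    show "(\<lambda>b. indicator (J - I) b *\<^sub>R \<bar>jump b\<bar>) \<in> borel_measurable \<mu>"
      using borel_measurable_finite_support[OF finite_J_diff_I, of "\<lambda>b. \<bar>jump b\<bar>"]
        measurable_cong_sets[OF sets_mu refl, of "borel :: real measure"] by simp
  qed simp
  then show ?thesis by simp
qed

lemma boundary_integral:
  "(\<integral>\<^sup>+\<omega>. ennreal (indicator (J - I) (\<omega> T) * \<bar>jump (\<omega> T)\<bar>) \<partial>P) =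
    ennreal ((LINT b:(J - I)|\<nu>. \<bar>jump b\<bar>) - (LINT b:(J - I)|\<mu>. \<bar>jump b\<bar>))"
proof -
  let ?k = "\<lambda>b. indicator (J - I) b * \<bar>jump b\<bar>"
  have m: "?k \<in> borel_measurable borel" by (rule borel_measurable_finite_support[OF finite_J_diff_I])
  interpret n: finite_measure \<nu> using admissible_measureD(1)[OF adm_nu] .
  define C where "C = (\<Sum>b\<in>J - I. \<bar>jump b\<bar>)"
  have bound: "\<bar>?k b\<bar> \<le> C" for b
    unfolding C_def using finite_J_diff_I
    by (cases "b \<in> J - I") (auto intro!: member_le_sum sum_nonneg)
  have int: "integrable \<nu> ?k"
    by (rule n.integrable_const_bound[of _ C]) (use bound m sets_nu in \<open>auto cong: measurable_cong_sets\<close>)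
  have "(LINT b:(J - I)|\<mu>. \<bar>jump b\<bar>) = 0" by (rule boundary_integral_mu)
  then have "(LINT b:(J - I)|\<nu>. \<bar>jump b\<bar>) - (LINT b:(J - I)|\<mu>. \<bar>jump b\<bar>) = (LINT b|\<nu>. ?k b)"
    by (simp add: set_lebesgue_integral_def)
  moreover have "(\<integral>\<^sup>+\<omega>. ennreal (?k (\<omega> T)) \<partial>P) = ennreal (LINT \<omega>|P. ?k (\<omega> T))"
    using integral_end(2)[OF m] int by (intro nn_integral_eq_integral) auto
  ultimately show ?thesis using integral_end(1)[OF m] by simp
qed

text \<open>Tonelli's theorem allows to take the expectation of the kernel first. At the endpoints of \<open>I\<close> only
  \<open>\<nu>\<close> contributes to the difference, since \<open>\<mu>\<close> lives on \<open>I\<close>.\<close>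

lemma bregman_expectation_le:
  assumes conc: "concave_on J \<kappa>" and fin: "concave_difference I J \<mu> \<nu> \<kappa> \<noteq> \<infinity>"
  obtains c where "0 \<le> c" "concave_difference I J \<mu> \<nu> \<kappa> = ereal c"
    "(\<integral>\<^sup>+\<omega>. ennreal (convex_profile.bregman (\<lambda>x. - \<kappa> x) (\<omega> 0) (\<omega> T)) \<partial>P) \<le> ennreal c"
proof -
  interpret g: convex_profile I J "\<lambda>x. - \<kappa> x"
    by unfold_locales (use conc in \<open>simp add: concave_on_def\<close>)
  let ?M = "second_deriv_measure I (\<lambda>x. - \<kappa> x)"
  define N where "N = (\<integral>\<^sup>+x. ennreal (potential \<nu> x - potential \<mu> x) \<partial>?M)"
  define j where "j = (LINT b:(J - I)|\<nu>. \<bar>boundary_jump I \<kappa> b\<bar>) - (LINT b:(J - I)|\<mu>. \<bar>boundary_jump I \<kappa> b\<bar>)"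
  have cd: "concave_difference I J \<mu> \<nu> \<kappa> = ereal (1/2) * enn2ereal N + ereal j"
    by (simp add: concave_difference_def N_def j_def)
  have j0: "0 \<le> j"
  proof -
    have "0 \<le> (LINT b:(J - I)|\<nu>. \<bar>boundary_jump I \<kappa> b\<bar>)"
      unfolding set_lebesgue_integral_def by (intro Bochner_Integration.integral_nonneg) auto
    then show ?thesis by (simp add: j_def boundary_integral_mu)
  qed
  have "N \<noteq> \<infinity>"
  proof
    assume "N = \<infinity>"
    then show False using fin cd by simp
  qed
  then obtain r where r: "N = ennreal r" "0 \<le> r" by (metis ennreal_cases infinity_ennreal_def)
  have c: "concave_difference I J \<mu> \<nu> \<kappa> = ereal (r / 2 + j)" using cd r by (simp add: enn2ereal_ennreal)
  have k: "g.kernel x y s = max 0 (if x < s then y - s else s - y)" for x y s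
    by (simp add: g.kernel_def)
  have cM: "(\<lambda>x. potential \<nu> x - potential \<mu> x) \<in> borel_measurable ?M"
  proof -
    have "(\<lambda>x. potential \<nu> x - potential \<mu> x) \<in> borel_measurable borel"
      using continuous_potential[OF adm_mu] continuous_potential[OF adm_nu]
      by (intro borel_measurable_diff borel_measurable_continuous_onI)
    then show ?thesis by (rule measurable_compose[OF g.measurable_ident_M])
  qed
  interpret pair: pair_sigma_finite P ?M by unfold_locales
  have km: "(\<lambda>(\<omega>, s). ennreal (g.kernel (\<omega> 0) (\<omega> T) s)) \<in> borel_measurable (P \<Otimes>\<^sub>M ?M)"
    unfolding split_beta'
    using measurable_compose[OF measurable_fst measurable_coordinate[OF times_in(1)], of ?M]
      measurable_compose[OF measurable_fst measurable_coordinate[OF times_in(2)], of ?M]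
      measurable_compose[OF measurable_snd g.measurable_ident_M, of P]
    by (intro measurable_compose[OF _ measurable_ennreal] g.measurable_kernel) auto
  let ?j = "\<lambda>\<omega>. ennreal (indicator (J - I) (\<omega> T) * \<bar>boundary_jump I \<kappa> (\<omega> T)\<bar>)"
  have jm: "?j \<in> borel_measurable P"
    by (intro measurable_compose[OF _ measurable_ennreal]
        measurable_compose[OF measurable_coordinate[OF times_in(2)] borel_measurable_finite_support[OF finite_J_diff_I]])
  have "(\<integral>\<^sup>+\<omega>. ennreal (g.bregman (\<omega> 0) (\<omega> T)) \<partial>P) \<le>
      (\<integral>\<^sup>+\<omega>. (\<integral>\<^sup>+s. ennreal (g.kernel (\<omega> 0) (\<omega> T) s) \<partial>?M) + ?j \<omega> \<partial>P)"
  proof (rule nn_integral_mono_AE)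
    show "AE \<omega> in P. ennreal (g.bregman (\<omega> 0) (\<omega> T)) \<le>
        (\<integral>\<^sup>+s. ennreal (g.kernel (\<omega> 0) (\<omega> T) s) \<partial>?M) + ?j \<omega>"
      using AE_start[OF AE_mu_I] AE_end[OF AE_nu_J]
    proof eventually_elim
      case (elim \<omega>)
      then show ?case using g.bregman_le_kernel_boundary[of "\<omega> 0" "\<omega> T"] by simp
    qed
  qed
  also have "\<dots> = (\<integral>\<^sup>+\<omega>. \<integral>\<^sup>+s. ennreal (g.kernel (\<omega> 0) (\<omega> T) s) \<partial>?M \<partial>P) + (\<integral>\<^sup>+\<omega>. ?j \<omega> \<partial>P)"
    using g.M.borel_measurable_nn_integral_fst[OF km] by (intro nn_integral_add jm) simp
  also have "(\<integral>\<^sup>+\<omega>. \<integral>\<^sup>+s. ennreal (g.kernel (\<omega> 0) (\<omega> T) s) \<partial>?M \<partial>P) =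
      (\<integral>\<^sup>+s. \<integral>\<^sup>+\<omega>. ennreal (g.kernel (\<omega> 0) (\<omega> T) s) \<partial>P \<partial>?M)"
    by (rule pair.Fubini'[OF km, symmetric])
  also have "\<dots> = (\<integral>\<^sup>+s. ennreal (1/2) * ennreal (potential \<nu> s - potential \<mu> s) \<partial>?M)"
    unfolding k nn_integral_kernel
    by (intro nn_integral_cong, subst ennreal_mult'[symmetric]) simp_all
  also have "\<dots> = ennreal (1/2) * N"
    unfolding N_def by (rule nn_integral_cmult) (use cM in simp)
  also have "\<dots> = ennreal (r / 2)" using r by (subst r(1), subst ennreal_mult'[symmetric]) simp_all
  also have "(\<integral>\<^sup>+\<omega>. ?j \<omega> \<partial>P) = ennreal j" unfolding j_def by (rule boundary_integral)
  also have "ennreal (r / 2) + ennreal j = ennreal (r / 2 + j)" using r j0 by simp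
  finally show thesis using that[of "r / 2 + j"] c r j0 by simp
qed

end

section \<open>The expected payoff of the hedge\<close>

lemma borel_measurable_restrict_indicator:
  fixes k :: "real \<Rightarrow> real"
  assumes "S \<in> sets borel"
  shows "k \<in> borel_measurable (restrict_space borel S) \<longleftrightarrow> (\<lambda>x. indicator S x * k x) \<in> borel_measurable borel"
  using borel_measurable_restrict_space_iff[of S borel k] assms by simp

locale hedged_transport = transport_martingale \<mu> \<nu> T P + averaged_martingale T P A +
  hedge_functions "domain_I \<mu> \<nu>" "domain_J \<mu> \<nu>" phi psi phi' psi'
  for \<mu> \<nu> T P A phi psi phi' psi' +
  fixes \<kappa> :: "real \<Rightarrow> real"
  assumes sum_nonneg: "\<And>x. x \<in> J \<Longrightarrow> 0 \<le> phi x + psi x"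
    and phi_measurable [measurable]: "phi \<in> borel_measurable borel"
    and psi_measurable [measurable]: "psi \<in> borel_measurable borel"
    and kappa_measurable: "\<kappa> \<in> borel_measurable (restrict_space borel J)"
    and kappa_concave: "concave_on J \<kappa>"
    and integrable_mu: "integrable \<mu> (\<lambda>x. phi x - indicator J x * \<kappa> x)"
    and integrable_nu: "integrable \<nu> (\<lambda>x. psi x + indicator J x * \<kappa> x)"
    and difference_finite: "concave_difference I J \<mu> \<nu> \<kappa> \<noteq> \<infinity>"
begin

sublocale g: convex_profile I J "\<lambda>x. - \<kappa> x"
  by unfold_locales (use kappa_concave in \<open>simp add: concave_on_def\<close>)

definition kap :: "real \<Rightarrow> real" where "kap x = indicator J x * \<kappa> x"
definition slope :: "real \<Rightarrow> real" where "slope x = indicator I x * right_deriv (\<lambda>x. - \<kappa> x) x"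

lemma kap_measurable [measurable]: "kap \<in> borel_measurable borel"
  using kappa_measurable borel_measurable_restrict_indicator[OF borel_J] by (simp add: kap_def[abs_def])

lemma slope_measurable [measurable]: "slope \<in> borel_measurable borel"
  using g.F_measurable borel_measurable_restrict_indicator[OF borel_I] by (simp add: slope_def[abs_def])

text \<open>Restricting \<open>X\<^sub>0\<close> to such a set preserves the martingale property and turns every function of
  \<open>X\<^sub>0\<close> in the hedge into a bounded one.\<close>

definition tame :: "nat \<Rightarrow> real set" where
  "tame m = {x. \<bar>phi x\<bar> \<le> m \<and> \<bar>phi' x\<bar> \<le> m \<and> \<bar>psi x\<bar> \<le> m \<and> \<bar>psi' x\<bar> \<le> m \<and> \<bar>kap x\<bar> \<le> m \<and> \<bar>slope x\<bar> \<le> m}"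

abbreviation one :: "nat \<Rightarrow> real \<Rightarrow> real" where "one m x \<equiv> indicator (tame m) x"

lemma tame_bounds:
  assumes "x \<in> tame m"
  shows "\<bar>phi x\<bar> \<le> real m" "\<bar>phi' x\<bar> \<le> real m" "\<bar>psi x\<bar> \<le> real m" "\<bar>psi' x\<bar> \<le> real m"
    "\<bar>kap x\<bar> \<le> real m" "\<bar>slope x\<bar> \<le> real m"
  using assms by (simp_all add: tame_def)

lemma tame_measurable [measurable]: "tame m \<in> sets borel"
  unfolding tame_def by measurable

lemma tame_tendsto: "(\<lambda>m. one m x) \<longlonglongrightarrow> 1"
proof -
  obtain N :: nat where N: "\<bar>phi x\<bar> + \<bar>phi' x\<bar> + \<bar>psi x\<bar> + \<bar>psi' x\<bar> + \<bar>kap x\<bar> + \<bar>slope x\<bar> < real N"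
    using reals_Archimedean2 by blast
  have "\<forall>\<^sub>F m in sequentially. 1 = one m x"
    using eventually_ge_at_top[of N]
  proof eventually_elim
    case (elim m)
    then have Nm: "real N \<le> real m" by simp
    have "a \<le> r \<and> b \<le> r \<and> c \<le> r \<and> d \<le> r \<and> e \<le> r \<and> f \<le> r"
      if "a + b + c + d + e + f < n" "n \<le> r" "0 \<le> a" "0 \<le> b" "0 \<le> c" "0 \<le> d" "0 \<le> e" "0 \<le> f"
      for a b c d e f n r :: real using that by auto
    from this[OF N Nm] have "x \<in> tame m" unfolding tame_def by simp
    then show ?case by simp
  qed
  then show ?thesis by (rule Lim_transform_eventually[OF tendsto_const])
qed

lemma bounded_start:
  fixes k :: "real \<Rightarrow> real"
  assumes "k \<in> borel_measurable borel" "\<And>x. \<bar>k x\<bar> \<le> C"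
  shows "integrable P (\<lambda>\<omega>. k (\<omega> 0))" "integrable P (\<lambda>\<omega>. k (\<omega> 0) * (\<omega> T - \<omega> 0))"
    "(LINT \<omega>|P. k (\<omega> 0) * (\<omega> T - \<omega> 0)) = 0"
proof -
  have "(\<lambda>\<omega>. k (\<omega> 0)) \<in> borel_measurable (\<F> 0)"
    by (rule measurable_compose[OF path_filtration_coordinate assms(1)]) simp
  then show "integrable P (\<lambda>\<omega>. k (\<omega> 0) * (\<omega> T - \<omega> 0))" "(LINT \<omega>|P. k (\<omega> 0) * (\<omega> T - \<omega> 0)) = 0"
    using increment_orthogonal[of 0 T "\<lambda>\<omega>. k (\<omega> 0)" C] T_pos assms(2) by auto
  show "integrable P (\<lambda>\<omega>. k (\<omega> 0))"
    by (rule integrable_const_bound[of _ C])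
      (use assms measurable_compose[OF measurable_coordinate[OF times_in(1)] assms(1)] in auto)
qed

lemma one_times_bounded:
  assumes "\<And>x. x \<in> tame m \<Longrightarrow> \<bar>k x\<bar> \<le> real m"
  shows "\<bar>one m x * k x\<bar> \<le> real m"
  using assms[of x] by (auto simp: indicator_def)

lemma tame_start:
  fixes k :: "real \<Rightarrow> real"
  assumes k: "k \<in> borel_measurable borel" and bound: "\<And>x. x \<in> tame m \<Longrightarrow> \<bar>k x\<bar> \<le> real m"
  shows "integrable P (\<lambda>\<omega>. one m (\<omega> 0) * k (\<omega> 0))"
    and "integrable P (\<lambda>\<omega>. one m (\<omega> 0) * k (\<omega> 0) * (\<omega> T - \<omega> 0))"
    and "(LINT \<omega>|P. one m (\<omega> 0) * k (\<omega> 0) * (\<omega> T - \<omega> 0)) = 0"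
proof -
  have "(\<lambda>x. one m x * k x) \<in> borel_measurable borel"
    by (intro borel_measurable_times borel_measurable_indicator tame_measurable k)
  note m = this
  have "\<bar>one m x * k x\<bar> \<le> real m" for x by (rule one_times_bounded[where k = k]) (rule bound)
  note bounded = bounded_start[where k = "\<lambda>x. one m x * k x", OF m this]
  show "integrable P (\<lambda>\<omega>. one m (\<omega> 0) * k (\<omega> 0))"
    "integrable P (\<lambda>\<omega>. one m (\<omega> 0) * k (\<omega> 0) * (\<omega> T - \<omega> 0))"
    "(LINT \<omega>|P. one m (\<omega> 0) * k (\<omega> 0) * (\<omega> T - \<omega> 0)) = 0"
    by (rule bounded)+
qed

lemma moderated_start: "integrable P (\<lambda>\<omega>. phi (\<omega> 0) - kap (\<omega> 0))"
    "(LINT \<omega>|P. phi (\<omega> 0) - kap (\<omega> 0)) = (LINT x|\<mu>. phi x - kap x)"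
  and moderated_end: "integrable P (\<lambda>\<omega>. psi (\<omega> T) + kap (\<omega> T))"
    "(LINT \<omega>|P. psi (\<omega> T) + kap (\<omega> T)) = (LINT x|\<nu>. psi x + kap x)"
proof -
  have m: "(\<lambda>x. phi x - kap x) \<in> borel_measurable borel" "(\<lambda>x. psi x + kap x) \<in> borel_measurable borel"
    by (intro borel_measurable_diff borel_measurable_add phi_measurable psi_measurable kap_measurable)+
  show "integrable P (\<lambda>\<omega>. phi (\<omega> 0) - kap (\<omega> 0))"
    unfolding integral_start(2)[OF m(1)] using integrable_mu by (simp only: kap_def)
  show "integrable P (\<lambda>\<omega>. psi (\<omega> T) + kap (\<omega> T))"
    unfolding integral_end(2)[OF m(2)] using integrable_nu by (simp only: kap_def)
  show "(LINT \<omega>|P. phi (\<omega> 0) - kap (\<omega> 0)) = (LINT x|\<mu>. phi x - kap x)" by (rule integral_start(1)[OF m(1)])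
  show "(LINT \<omega>|P. psi (\<omega> T) + kap (\<omega> T)) = (LINT x|\<nu>. psi x + kap x)" by (rule integral_end(1)[OF m(2)])
qed

lemma integrable_one_mult:
  fixes k :: "path \<Rightarrow> real"
  assumes "integrable P k"
  shows "integrable P (\<lambda>\<omega>. one m (\<omega> 0) * k \<omega>)"
proof (rule Bochner_Integration.integrable_bound[OF assms])
  have "(\<lambda>\<omega>. one m (\<omega> 0)) \<in> borel_measurable P"
    by (rule measurable_compose[OF measurable_coordinate[OF times_in(1)]]) simp
  then show "(\<lambda>\<omega>. one m (\<omega> 0) * k \<omega>) \<in> borel_measurable P" using assms by auto
qed (auto simp: indicator_def)

text \<open>On a tame start the terminal payoff is integrable, although \<open>\<psi>\<close> need not be
  \<open>\<nu>\<close>-integrable: the Bregman distance of the moderator is, and it differs from \<open>-\<kappa>(X\<^sub>T)\<close> by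
  integrable terms.\<close>

lemma tame_expectation:
  assumes c: "(\<integral>\<^sup>+\<omega>. ennreal (g.bregman (\<omega> 0) (\<omega> T)) \<partial>P) \<le> ennreal c" "0 \<le> c"
  shows "integrable P (\<lambda>\<omega>. one m (\<omega> 0) * psi (\<omega> T))"
    and "(LINT \<omega>|P. one m (\<omega> 0) * (phi (\<omega> 0) + psi (\<omega> T))) \<le>
      (LINT \<omega>|P. one m (\<omega> 0) * ((phi (\<omega> 0) - kap (\<omega> 0)) + (psi (\<omega> T) + kap (\<omega> T)))) + c"
proof -
  define br where "br \<omega> = kap (\<omega> 0) - kap (\<omega> T) - slope (\<omega> 0) * (\<omega> T - \<omega> 0)" for \<omega> :: path
  note c0 = measurable_coordinate[OF times_in(1)] and cT = measurable_coordinate[OF times_in(2)]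
  have br_m: "br \<in> borel_measurable P"
    unfolding br_def[abs_def]
    using c0 cT measurable_compose[OF c0 kap_measurable] measurable_compose[OF cT kap_measurable]
      measurable_compose[OF c0 slope_measurable] by simp
  have br_eq: "AE \<omega> in P. br \<omega> = g.bregman (\<omega> 0) (\<omega> T) \<and> 0 \<le> br \<omega>"
    using AE_start[OF AE_mu_I] AE_end[OF AE_nu_J]
  proof eventually_elim
    case (elim \<omega>)
    then have "\<omega> 0 \<in> J" using I_subset_J by auto
    with elim have "br \<omega> = g.bregman (\<omega> 0) (\<omega> T)"
      by (simp add: br_def kap_def slope_def g.bregman_def)
    with g.bregman_nonneg[OF elim] show ?case by simp
  qed
  have br_nn: "(\<integral>\<^sup>+\<omega>. ennreal (br \<omega>) \<partial>P) \<le> ennreal c"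
  proof -
    have "(\<integral>\<^sup>+\<omega>. ennreal (br \<omega>) \<partial>P) = (\<integral>\<^sup>+\<omega>. ennreal (g.bregman (\<omega> 0) (\<omega> T)) \<partial>P)"
      by (rule nn_integral_cong_AE) (use br_eq in \<open>eventually_elim, simp\<close>)
    with c show ?thesis by simp
  qed
  have br_pos: "AE \<omega> in P. 0 \<le> br \<omega>" using br_eq by eventually_elim simp
  have br_i: "integrable P br"
    by (rule integrableI_nonneg[OF br_m br_pos]) (use br_nn in \<open>auto intro: le_less_trans\<close>)
  have br_le: "(LINT \<omega>|P. br \<omega>) \<le> c"
  proof -
    have "ennreal (LINT \<omega>|P. br \<omega>) = (\<integral>\<^sup>+\<omega>. ennreal (br \<omega>) \<partial>P)"
      by (rule nn_integral_eq_integral[OF br_i br_pos, symmetric])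
    then have "ennreal (LINT \<omega>|P. br \<omega>) \<le> ennreal c" using br_nn by (simp only:)
    then show ?thesis by (rule ennreal_le_iff[OF c(2), THEN iffD1])
  qed
  let ?o = "\<lambda>\<omega> :: path. one m (\<omega> 0)"
  have obr_i: "integrable P (\<lambda>\<omega>. ?o \<omega> * br \<omega>)" by (rule integrable_one_mult[OF br_i])
  have obr_le: "(LINT \<omega>|P. ?o \<omega> * br \<omega>) \<le> c"
  proof -
    have "(LINT \<omega>|P. ?o \<omega> * br \<omega>) \<le> (LINT \<omega>|P. br \<omega>)"
      by (rule integral_mono_AE[OF obr_i br_i]) (use br_pos in \<open>eventually_elim, simp add: indicator_def\<close>)
    with br_le show ?thesis by simp
  qed
  have k0: "integrable P (\<lambda>\<omega>. ?o \<omega> * kap (\<omega> 0))"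
    by (rule tame_start(1)[OF kap_measurable tame_bounds(5)])
  have sl: "integrable P (\<lambda>\<omega>. ?o \<omega> * slope (\<omega> 0) * (\<omega> T - \<omega> 0))" "(LINT \<omega>|P. ?o \<omega> * slope (\<omega> 0) * (\<omega> T - \<omega> 0)) = 0"
    using tame_start(2,3)[where k = slope and m = m, OF slope_measurable tame_bounds(6)] by simp_all
  have kT_eq: "?o \<omega> * kap (\<omega> T) = ?o \<omega> * kap (\<omega> 0) - ?o \<omega> * slope (\<omega> 0) * (\<omega> T - \<omega> 0) - ?o \<omega> * br \<omega>" for \<omega>
    by (simp add: br_def algebra_simps)
  have kT: "integrable P (\<lambda>\<omega>. ?o \<omega> * kap (\<omega> T))"
    unfolding kT_eq using k0 sl(1) obr_i by simp
  have kdiff: "(LINT \<omega>|P. ?o \<omega> * kap (\<omega> 0)) - (LINT \<omega>|P. ?o \<omega> * kap (\<omega> T)) = (LINT \<omega>|P. ?o \<omega> * br \<omega>)"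
    unfolding kT_eq using k0 sl obr_i by simp
  have pk: "integrable P (\<lambda>\<omega>. ?o \<omega> * (psi (\<omega> T) + kap (\<omega> T)))" by (rule integrable_one_mult[OF moderated_end(1)])
  have psi_eq: "?o \<omega> * psi (\<omega> T) = ?o \<omega> * (psi (\<omega> T) + kap (\<omega> T)) - ?o \<omega> * kap (\<omega> T)" for \<omega>
    by (simp add: algebra_simps)
  show "integrable P (\<lambda>\<omega>. ?o \<omega> * psi (\<omega> T))"
    unfolding psi_eq using pk kT by simp
  have fk: "integrable P (\<lambda>\<omega>. ?o \<omega> * (phi (\<omega> 0) - kap (\<omega> 0)))" by (rule integrable_one_mult[OF moderated_start(1)])
  have eq: "?o \<omega> * (phi (\<omega> 0) + psi (\<omega> T)) = (?o \<omega> * (phi (\<omega> 0) - kap (\<omega> 0)) + ?o \<omega> * (psi (\<omega> T) + kap (\<omega> T))) +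
      (?o \<omega> * kap (\<omega> 0) - ?o \<omega> * kap (\<omega> T))" for \<omega>
    by (simp add: algebra_simps)
  have "(LINT \<omega>|P. ?o \<omega> * (phi (\<omega> 0) + psi (\<omega> T))) =
      (LINT \<omega>|P. ?o \<omega> * (phi (\<omega> 0) - kap (\<omega> 0)) + ?o \<omega> * (psi (\<omega> T) + kap (\<omega> T))) +
      ((LINT \<omega>|P. ?o \<omega> * kap (\<omega> 0)) - (LINT \<omega>|P. ?o \<omega> * kap (\<omega> T)))"
    unfolding eq using fk pk k0 kT by simp
  also have "\<dots> \<le> (LINT \<omega>|P. ?o \<omega> * (phi (\<omega> 0) - kap (\<omega> 0)) + ?o \<omega> * (psi (\<omega> T) + kap (\<omega> T))) + c"
    unfolding kdiff using obr_le by simp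
  finally show "(LINT \<omega>|P. ?o \<omega> * (phi (\<omega> 0) + psi (\<omega> T))) \<le>
      (LINT \<omega>|P. ?o \<omega> * ((phi (\<omega> 0) - kap (\<omega> 0)) + (psi (\<omega> T) + kap (\<omega> T)))) + c"
    by (simp add: distrib_left)
qed

text \<open>The payoff of the hedge is the average of \<open>spot\<close> over the random time.\<close>

definition spot :: "path \<Rightarrow> real \<Rightarrow> real" where
  "spot \<omega> t = phi (\<omega> 0) + psi (\<omega> T) + phi' (\<omega> 0) * (clip T \<omega> t - \<omega> 0)
    - psi' (clip T \<omega> t) * (\<omega> T - clip T \<omega> t)"

text \<open>On relevant paths this is the Bochner integral of \<open>spot\<close>. In terms of nonnegative integrals it is
  visibly measurable in the path.\<close>

definition hedge_payoff :: "path \<Rightarrow> real" where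
  "hedge_payoff \<omega> = enn2real (\<integral>\<^sup>+t. ennreal (spot \<omega> t) \<partial>K \<omega>) - enn2real (\<integral>\<^sup>+t. ennreal (- spot \<omega> t) \<partial>K \<omega>)"

lemma relevant_space: "\<omega> \<in> relevant_paths T I J \<Longrightarrow> \<omega> \<in> space P"
  by (auto simp: space_P relevant_paths_def)

lemma relevant_hedge_path:
  "\<omega> \<in> relevant_paths T I J \<Longrightarrow> hedge_path I J phi psi phi' psi' T (A \<omega>) \<omega>"
  by (intro hedge_path.intro hedge_path_axioms.intro hedge_functions_axioms averaging_path relevant_space)

lemma spot_integral:
  assumes \<omega>: "\<omega> \<in> relevant_paths T I J"
  shows "integrable (K \<omega>) (spot \<omega>)" "(LINT t|K \<omega>. spot \<omega> t) = hedge_payoff \<omega>"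
    and "hedge_payoff \<omega> = phi (\<omega> 0) + psi (\<omega> T) +
      (phi' (\<omega> 0) * (path_average T (A \<omega>) \<omega> - \<omega> 0) - hedge_path.cost psi' T (A \<omega>) \<omega>)"
    and "0 \<le> hedge_payoff \<omega>" and "integrable (K \<omega>) (clip T \<omega>)"
proof -
  interpret hp: hedge_path I J phi psi phi' psi' T "A \<omega>" \<omega> by (rule relevant_hedge_path[OF \<omega>])
  have clip: "clip T \<omega> = (\<lambda>t. indicator {0..T} t * \<omega> t)" by (simp add: clip_def fun_eq_iff)
  show "integrable (K \<omega>) (clip T \<omega>)" unfolding clip K_def by (rule hp.integrable_path)
  let ?s = "\<lambda>t. (phi (\<omega> 0) + psi (\<omega> T) + phi' (\<omega> 0) * (indicator {0..T} t * \<omega> t - \<omega> 0)) -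
      indicator {0..T} t * (psi' (\<omega> t) * (\<omega> T - \<omega> t))"
  have s_i: "integrable hp.da ?s" using hp.integrable_path hp.integrable_integrand by simp
  have cm: "clip T \<omega> \<in> borel_measurable borel" unfolding clip by (rule hp.measurable_path)
  have "spot \<omega> \<in> borel_measurable borel"
    unfolding spot_def[abs_def] using cm measurable_compose[OF cm psi'_measurable] by simp
  then have spot_m: "spot \<omega> \<in> borel_measurable hp.da" by simp
  have ae: "AE t in hp.da. ?s t = spot \<omega> t"
    using hp.AE_da_in by eventually_elim (simp add: spot_def clip_def)
  show int: "integrable (K \<omega>) (spot \<omega>)" unfolding K_def
    by (rule integrable_cong_AE_imp[OF s_i spot_m]) (use ae in \<open>eventually_elim, simp\<close>)
  have "(LINT t|K \<omega>. spot \<omega> t) = (LINT t|hp.da. ?s t)"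
    unfolding K_def by (rule integral_cong_AE) (use spot_m s_i ae in \<open>auto elim!: eventually_mono\<close>)
  also have "\<dots> = phi (\<omega> 0) + psi (\<omega> T) + (phi' (\<omega> 0) * (hp.avg - \<omega> 0) - hp.cost)"
    using hp.integrable_path hp.integrable_integrand
    by (simp add: hp.cost_def set_lebesgue_integral_def hp.avg_eq hp.measure_da_UNIV)
  finally have eq: "(LINT t|K \<omega>. spot \<omega> t) = phi (\<omega> 0) + psi (\<omega> T) + (phi' (\<omega> 0) * (hp.avg - \<omega> 0) - hp.cost)" .
  show pay: "(LINT t|K \<omega>. spot \<omega> t) = hedge_payoff \<omega>"
    by (simp add: hedge_payoff_def real_lebesgue_integral_def[OF int])
  show "hedge_payoff \<omega> = phi (\<omega> 0) + psi (\<omega> T) + (phi' (\<omega> 0) * (hp.avg - \<omega> 0) - hp.cost)"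
    using eq pay by simp
  then show "0 \<le> hedge_payoff \<omega>"
    using hp.psi_avg_le super[OF hp.start_I hp.avg_in_J] sum_nonneg[OF hp.avg_in_J] by simp
qed

lemma spot_measurable: "(\<lambda>z. spot (fst z) (snd z)) \<in> borel_measurable (P \<Otimes>\<^sub>M borel)"
proof -
  note c0 = measurable_compose[OF measurable_fst measurable_coordinate[OF times_in(1)]]
    and cT = measurable_compose[OF measurable_fst measurable_coordinate[OF times_in(2)]]
  show ?thesis unfolding spot_def
    by (intro borel_measurable_diff borel_measurable_add borel_measurable_times c0 cT clip_measurable'
        measurable_compose[OF c0 phi_measurable] measurable_compose[OF cT psi_measurable]
        measurable_compose[OF c0 phi'_measurable] measurable_compose[OF clip_measurable' psi'_measurable])
qed

lemma hedge_payoff_measurable: "hedge_payoff \<in> borel_measurable P"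
  unfolding hedge_payoff_def[abs_def]
  by (intro borel_measurable_diff borel_measurable_enn2real
      nn_integral_measurable_subprob_algebra2[OF _ K_measurable])
    (use spot_measurable in \<open>simp_all add: split_beta'\<close>)

text \<open>Truncating \<open>\<psi>'\<close> at \<open>k\<close> makes the hedge bounded, so that its expectation vanishes. The
  truncated payoffs stay above a fixed integrable function by the tangent inequalities for \<open>\<psi>\<close>, and
  Fatou's lemma removes the truncation.\<close>

lemma tame_payoff_le:
  assumes psi_i: "integrable P (\<lambda>\<omega>. one m (\<omega> 0) * psi (\<omega> T))"
  defines "a \<equiv> (LINT \<omega>|P. one m (\<omega> 0) * (phi (\<omega> 0) + psi (\<omega> T)))"
  shows "(\<integral>\<^sup>+\<omega>. ennreal (one m (\<omega> 0) * hedge_payoff \<omega>) \<partial>P) \<le> ennreal a" and "0 \<le> a"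
proof -
  let ?o = "\<lambda>\<omega> :: path. one m (\<omega> 0)"
  define H where "H \<omega> = ?o \<omega> * (phi (\<omega> 0) + psi (\<omega> T)) + one m (\<omega> 0) * phi' (\<omega> 0) * (\<omega> T - \<omega> 0)" for \<omega> :: path
  define \<eta>0 where "\<eta>0 x = one m (fst x) * phi' (fst x)" for x :: "real \<times> real"
  define \<eta> where "\<eta> k x = one m (fst x) * (psi' (snd x) * indicator {y. \<bar>psi' y\<bar> \<le> real k} (snd x))"
    for k :: nat and x :: "real \<times> real"
  define y where "y k z = H (fst z) - gap z * \<eta>0 (pair z) - gap z * \<eta> k (pair z)" for k z
  define w where "w z = ?o (fst z) * (2 * m + 2 * m * \<bar>clip T (fst z) (snd z) - fst z 0\<bar> + 2 * \<bar>psi (fst z T)\<bar>)"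
    for z :: "path \<times> real"
  define s where "s z = ?o (fst z) * spot (fst z) (snd z)" for z
  have phi_i: "integrable P (\<lambda>\<omega>. ?o \<omega> * phi (\<omega> 0))"
    by (rule tame_start(1)[OF phi_measurable tame_bounds(1)])
  have phi'_i: "integrable P (\<lambda>\<omega>. ?o \<omega> * phi' (\<omega> 0) * (\<omega> T - \<omega> 0))"
    and phi'_z: "(LINT \<omega>|P. ?o \<omega> * phi' (\<omega> 0) * (\<omega> T - \<omega> 0)) = 0"
    using tame_start(2,3)[where k = phi' and m = m, OF phi'_measurable tame_bounds(2)] by simp_all
  have pp_i: "integrable P (\<lambda>\<omega>. ?o \<omega> * (phi (\<omega> 0) + psi (\<omega> T)))"
    using phi_i psi_i by (simp add: distrib_left)
  have H_i: "integrable P H" unfolding H_def[abs_def] using pp_i phi'_i by simp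
  have H_int: "(LINT \<omega>|P. H \<omega>) = a" unfolding H_def a_def using pp_i phi'_i phi'_z by simp
  have fst_m: "(fst :: real \<times> real \<Rightarrow> real) \<in> borel_measurable borel"
    and snd_m: "(snd :: real \<times> real \<Rightarrow> real) \<in> borel_measurable borel"
    by (intro borel_measurable_continuous_onI continuous_intros)+
  have one_m: "(\<lambda>x :: real \<times> real. one m (fst x) :: real) \<in> borel_measurable borel"
    by (rule measurable_compose[OF fst_m borel_measurable_indicator[OF tame_measurable]])
  have e0: "\<eta>0 \<in> borel_measurable borel" "\<And>x. \<bar>\<eta>0 x\<bar> \<le> real m"
  proof -
    show "\<eta>0 \<in> borel_measurable borel" unfolding \<eta>0_def[abs_def]
      by (intro borel_measurable_times one_m measurable_compose[OF fst_m phi'_measurable])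
    show "\<And>x. \<bar>\<eta>0 x\<bar> \<le> real m" unfolding \<eta>0_def by (rule one_times_bounded) (simp add: tame_def)
  qed
  have ek: "\<eta> k \<in> borel_measurable borel" "\<And>x. \<bar>\<eta> k x\<bar> \<le> real k" for k
  proof -
    have "{y. \<bar>psi' y\<bar> \<le> real k} \<in> sets borel" by measurable
    then show "\<eta> k \<in> borel_measurable borel" unfolding \<eta>_def[abs_def]
      by (intro borel_measurable_times one_m measurable_compose[OF snd_m psi'_measurable]
          measurable_compose[OF snd_m borel_measurable_indicator])
    show "\<And>x. \<bar>\<eta> k x\<bar> \<le> real k" unfolding \<eta>_def by (auto simp: indicator_def)
  qed
  note g0 = gap_orthogonal[OF e0] and gk = gap_orthogonal[OF ek]
  have y_i: "integrable Q (y k)" for k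
    unfolding y_def[abs_def] using integral_Q_path(1)[OF H_i] g0(1) gk(1)[of k] by simp
  have y_int: "(LINT z|Q. y k z) = a" for k
    unfolding y_def using integral_Q_path[OF H_i] g0 gk[of k] H_int by simp
  have o_m: "(\<lambda>z. ?o (fst z)) \<in> borel_measurable Q"
    using integral_Q_path(1)[OF bounded_start(1)[of "one m" 1]] by (auto simp: indicator_def)
  have w_i: "integrable Q w"
  proof -
    have "integrable Q (\<lambda>z. ?o (fst z) * \<bar>clip T (fst z) (snd z) - fst z 0\<bar>)"
    proof (rule Bochner_Integration.integrable_bound)
      show i: "integrable Q (\<lambda>z. clip T (fst z) (snd z) - fst z 0)"
        using integrable_clip integral_Q_path(1)[OF integrable_coordinate[OF times_in(1)]] by simp
      show "(\<lambda>z. ?o (fst z) * \<bar>clip T (fst z) (snd z) - fst z 0\<bar>) \<in> borel_measurable Q"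
        using o_m i by auto
    qed (auto simp: indicator_def)
    moreover have "integrable Q (\<lambda>z. \<bar>?o (fst z) * psi (fst z T)\<bar>)"
      using integral_Q_path(1)[OF psi_i] by simp
    moreover have "integrable Q (\<lambda>z. ?o (fst z))"
      by (rule integral_Q_path(1)[OF bounded_start(1)[of "one m" 1]]) (auto simp: indicator_def)
    ultimately have "integrable Q (\<lambda>z. 2 * m * ?o (fst z) + 2 * m * (?o (fst z) * \<bar>clip T (fst z) (snd z) - fst z 0\<bar>)
        + 2 * \<bar>?o (fst z) * psi (fst z T)\<bar>)"
      by (intro Bochner_Integration.integrable_add integrable_mult_right)
    then show ?thesis unfolding w_def[abs_def] by (simp add: algebra_simps abs_mult)
  qed
  have w_nn: "0 \<le> w z" for z unfolding w_def by (intro mult_nonneg_nonneg add_nonneg_nonneg) auto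
  have y_eq: "y k z = ?o (fst z) * (phi (fst z 0) + psi (fst z T) + phi' (fst z 0) * (clip T (fst z) (snd z) - fst z 0)
      - psi' (clip T (fst z) (snd z)) * indicator {y. \<bar>psi' y\<bar> \<le> real k} (clip T (fst z) (snd z)) * gap z)" for k z
    by (simp add: y_def H_def \<eta>0_def \<eta>_def algebra_simps)
  have low: "0 \<le> y k (\<omega>, t) + w (\<omega>, t)" if \<omega>: "\<omega> \<in> relevant_paths T I J" and t: "t \<in> {0..T}" for k \<omega> t
  proof (cases "\<omega> 0 \<in> tame m")
    case True
    interpret hp: hedge_path I J phi psi phi' psi' T "A \<omega>" \<omega> by (rule relevant_hedge_path[OF \<omega>])
    let ?x = "\<omega> 0" and ?y = "\<omega> t" and ?d = "\<bar>\<omega> t - \<omega> 0\<bar>"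
    have mult: "- (real m * ?d) \<le> b * (\<omega> t - \<omega> 0)" if "\<bar>b\<bar> \<le> real m" for b
    proof -
      have "\<bar>b * (\<omega> t - \<omega> 0)\<bar> \<le> real m * ?d" unfolding abs_mult using that by (rule mult_right_mono) simp
      then show ?thesis by linarith
    qed
    have b: "\<bar>phi ?x\<bar> \<le> real m" "\<bar>phi' ?x\<bar> \<le> real m" "\<bar>psi ?x\<bar> \<le> real m" "\<bar>psi' ?x\<bar> \<le> real m"
      using True by (auto simp: tame_def)
    \<comment> \<open>If the truncation is active, the term with \<open>\<psi>'\<close> is absent; otherwise tangents at \<open>\<omega> t\<close> and at
      \<open>\<omega> 0\<close> bound it from below.\<close>
    have yw: "y k (\<omega>, t) + w (\<omega>, t) = phi ?x + psi (\<omega> T) + phi' ?x * (\<omega> t - \<omega> 0)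
        - psi' ?y * indicator {y. \<bar>psi' y\<bar> \<le> real k} ?y * (\<omega> T - \<omega> t)
        + (2 * m + 2 * (m * ?d) + 2 * \<bar>psi (\<omega> T)\<bar>)"
      using True t by (simp add: y_eq w_def clip_def)
    have md: "0 \<le> real m * ?d" by simp
    show ?thesis
    proof (cases "?y \<in> I \<and> \<bar>psi' ?y\<bar> \<le> real k")
      case True
      have "psi ?x + psi' ?x * (?y - ?x) \<le> psi ?y" by (rule sub[OF hp.start_I hp.path_in_J[OF t]])
      moreover have "psi ?y + psi' ?y * (\<omega> T - ?y) \<le> psi (\<omega> T)" using True by (intro sub hp.end_J) simp
      ultimately have "psi ?x + psi' ?x * (?y - ?x) \<le> psi (\<omega> T) - psi' ?y * (\<omega> T - ?y)" by linarith
      then show ?thesis unfolding yw using True mult[OF b(2)] mult[OF b(4)] b(1,3)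
        by (simp add: abs_le_iff) linarith
    next
      case False
      then have "psi' ?y * indicator {y. \<bar>psi' y\<bar> \<le> real k} ?y = 0"
        using deriv_off by (auto simp: indicator_def)
      then have "psi' ?y * indicator {y. \<bar>psi' y\<bar> \<le> real k} ?y * (\<omega> T - \<omega> t) = 0" by simp
      then show ?thesis unfolding yw using mult[OF b(2)] b(1) md by linarith
    qed
  next
    case False
    then show ?thesis by (simp add: y_eq w_def)
  qed
  have s_eq: "s z = y k z" if "\<bar>psi' (clip T (fst z) (snd z))\<bar> \<le> real k" for k z
    using that by (simp add: s_def y_eq spot_def)
  have s_lim: "\<forall>\<^sub>F k in sequentially. s z = y k z" for z
  proof -
    obtain N :: nat where N: "\<bar>psi' (clip T (fst z) (snd z))\<bar> < real N" using reals_Archimedean2 by blast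
    show ?thesis using eventually_ge_at_top[of N]
    proof eventually_elim
      case (elim k)
      then have "real N \<le> real k" by simp
      then show ?case using N by (intro s_eq) simp
    qed
  qed
  have low_s: "0 \<le> s (\<omega>, t) + w (\<omega>, t)" if "\<omega> \<in> relevant_paths T I J" "t \<in> {0..T}" for \<omega> t
    using eventually_happens'[OF sequentially_bot s_lim[of "(\<omega>, t)"]] low[OF that] by metis
  have AE_low: "AE z in Q. 0 \<le> y k z + w z" for k
    using AE_Q_time AE_Q_path[OF AE_relevant]
    by eventually_elim (use low in \<open>metis prod.collapse\<close>)
  define W where "W = (LINT z|Q. w z)"
  have W0: "0 \<le> W" unfolding W_def using w_nn by simp
  have yw_i: "integrable Q (\<lambda>z. y k z + w z)" for k using y_i w_i by simp
  have yw_int: "(LINT z|Q. y k z + w z) = a + W" for k using y_i[of k] w_i y_int[of k] by (simp add: W_def)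
  have aW: "0 \<le> a + W"
    using integral_nonneg_AE[OF AE_low[of 0]] yw_int[of 0] by simp
  have sm: "s \<in> borel_measurable Q"
    unfolding s_def[abs_def] using o_m spot_measurable by (intro borel_measurable_times) (simp_all add: measurable_Q_iff)
  have wm: "w \<in> borel_measurable Q" using w_i by auto
  have fatou: "(\<integral>\<^sup>+z. ennreal (s z + w z) \<partial>Q) \<le> ennreal (a + W)"
  proof -
    have "(\<integral>\<^sup>+z. ennreal (s z + w z) \<partial>Q) = (\<integral>\<^sup>+z. liminf (\<lambda>k. ennreal (y k z + w z)) \<partial>Q)"
    proof (rule nn_integral_cong)
      fix z
      have "(\<lambda>k. ennreal (y k z + w z)) \<longlonglongrightarrow> ennreal (s z + w z)"
        by (rule Lim_transform_eventually[OF tendsto_const]) (use s_lim[of z] in eventually_elim, simp)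
      then show "ennreal (s z + w z) = liminf (\<lambda>k. ennreal (y k z + w z))"
        by (intro lim_imp_Liminf[symmetric]) simp_all
    qed
    also have "\<dots> \<le> liminf (\<lambda>k. \<integral>\<^sup>+z. ennreal (y k z + w z) \<partial>Q)"
      by (rule nn_integral_liminf) (use yw_i in auto)
    also have "(\<lambda>k. \<integral>\<^sup>+z. ennreal (y k z + w z) \<partial>Q) = (\<lambda>k. ennreal (a + W))"
      using nn_integral_eq_integral[OF yw_i AE_low] yw_int by simp
    finally show ?thesis by (simp add: Liminf_const)
  qed
  have w_nn_int: "(\<integral>\<^sup>+z. ennreal (w z) \<partial>Q) = ennreal W"
    unfolding W_def using w_i w_nn by (intro nn_integral_eq_integral) auto
  have "(\<integral>\<^sup>+z. ennreal (s z + w z) \<partial>Q) = (\<integral>\<^sup>+\<omega>. \<integral>\<^sup>+t. ennreal (s (\<omega>, t) + w (\<omega>, t)) \<partial>K \<omega> \<partial>P)"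
    using sm wm by (intro nn_integral_Q) (simp add: measurable_Q_iff)
  also have "\<dots> = (\<integral>\<^sup>+\<omega>. ennreal (?o \<omega> * hedge_payoff \<omega>) + (\<integral>\<^sup>+t. ennreal (w (\<omega>, t)) \<partial>K \<omega>) \<partial>P)"
  proof (rule nn_integral_cong_AE)
    show "AE \<omega> in P. (\<integral>\<^sup>+t. ennreal (s (\<omega>, t) + w (\<omega>, t)) \<partial>K \<omega>) =
        ennreal (?o \<omega> * hedge_payoff \<omega>) + (\<integral>\<^sup>+t. ennreal (w (\<omega>, t)) \<partial>K \<omega>)"
      using AE_relevant
    proof eventually_elim
      case (elim \<omega>)
      note \<omega>P = relevant_space[OF elim]
      interpret Kp: prob_space "K \<omega>" by (rule K_prob[OF \<omega>P])
      have si: "integrable (K \<omega>) (\<lambda>t. s (\<omega>, t))" and sint: "(LINT t|K \<omega>. s (\<omega>, t)) = ?o \<omega> * hedge_payoff \<omega>"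
        using spot_integral(1,2)[OF elim] by (simp_all add: s_def)
      have wi: "integrable (K \<omega>) (\<lambda>t. w (\<omega>, t))"
        using spot_integral(5)[OF elim] by (simp add: w_def)
      have K_time: "AE t in K \<omega>. t \<in> {0..T}"
        unfolding K_def by (rule averaging_path.AE_da_in[OF averaging_path[OF \<omega>P]])
      have "(\<integral>\<^sup>+t. ennreal (s (\<omega>, t) + w (\<omega>, t)) \<partial>K \<omega>) = ennreal (LINT t|K \<omega>. s (\<omega>, t) + w (\<omega>, t))"
      proof (rule nn_integral_eq_integral)
        show "AE t in K \<omega>. 0 \<le> s (\<omega>, t) + w (\<omega>, t)"
          using K_time by eventually_elim (rule low_s[OF elim])
      qed (use si wi in simp)
      also have "\<dots> = ennreal (?o \<omega> * hedge_payoff \<omega> + (LINT t|K \<omega>. w (\<omega>, t)))"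
        using si wi sint by simp
      also have "\<dots> = ennreal (?o \<omega> * hedge_payoff \<omega>) + ennreal (LINT t|K \<omega>. w (\<omega>, t))"
        using spot_integral(4)[OF elim] w_nn by (intro ennreal_plus) auto
      also have "ennreal (LINT t|K \<omega>. w (\<omega>, t)) = (\<integral>\<^sup>+t. ennreal (w (\<omega>, t)) \<partial>K \<omega>)"
        using wi w_nn by (intro nn_integral_eq_integral[symmetric]) auto
      finally show ?case .
    qed
  qed
  also have "\<dots> = (\<integral>\<^sup>+\<omega>. ennreal (?o \<omega> * hedge_payoff \<omega>) \<partial>P) + (\<integral>\<^sup>+\<omega>. \<integral>\<^sup>+t. ennreal (w (\<omega>, t)) \<partial>K \<omega> \<partial>P)"
  proof (rule nn_integral_add)
    have "?o \<in> borel_measurable P"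
      by (rule measurable_compose[OF measurable_coordinate[OF times_in(1)]]) simp
    then show "(\<lambda>\<omega>. ennreal (?o \<omega> * hedge_payoff \<omega>)) \<in> borel_measurable P"
      using hedge_payoff_measurable by simp
    show "(\<lambda>\<omega>. \<integral>\<^sup>+t. ennreal (w (\<omega>, t)) \<partial>K \<omega>) \<in> borel_measurable P"
      by (rule nn_integral_measurable_subprob_algebra2[OF _ K_measurable])
        (use wm in \<open>simp add: split_beta' measurable_Q_iff\<close>)
  qed
  also have "(\<integral>\<^sup>+\<omega>. \<integral>\<^sup>+t. ennreal (w (\<omega>, t)) \<partial>K \<omega> \<partial>P) = ennreal W"
    unfolding w_nn_int[symmetric] using wm by (intro nn_integral_Q[symmetric]) (simp add: measurable_Q_iff)
  finally have le: "(\<integral>\<^sup>+\<omega>. ennreal (?o \<omega> * hedge_payoff \<omega>) \<partial>P) + ennreal W \<le> ennreal (a + W)"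
    using fatou by simp
  have "ennreal W \<le> (\<integral>\<^sup>+\<omega>. ennreal (?o \<omega> * hedge_payoff \<omega>) \<partial>P) + ennreal W" by (simp add: add_increasing)
  also note le
  finally show a0: "0 \<le> a" using aW by (simp add: ennreal_le_iff)
  have "(\<integral>\<^sup>+\<omega>. ennreal (?o \<omega> * hedge_payoff \<omega>) \<partial>P) + ennreal W \<le> ennreal a + ennreal W"
    using le a0 W0 by simp
  then show "(\<integral>\<^sup>+\<omega>. ennreal (?o \<omega> * hedge_payoff \<omega>) \<partial>P) \<le> ennreal a"
    by (simp add: add.commute[of _ "ennreal W"] ennreal_add_left_cancel_le)
qed

text \<open>The payoff is nonnegative, so Fatou's lemma also removes the restriction to tame starting points. The
  bound is recorded as nonnegative because \<open>ennreal\<close> would hide its sign.\<close>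

lemma expected_payoff_le:
  obtains c where "concave_difference I J \<mu> \<nu> \<kappa> = ereal c"
    and "0 \<le> (LINT x|\<mu>. phi x - kap x) + (LINT x|\<nu>. psi x + kap x) + c"
    and "(\<integral>\<^sup>+\<omega>. ennreal (hedge_payoff \<omega>) \<partial>P) \<le>
      ennreal ((LINT x|\<mu>. phi x - kap x) + (LINT x|\<nu>. psi x + kap x) + c)"
proof -
  obtain c where c: "0 \<le> c" "concave_difference I J \<mu> \<nu> \<kappa> = ereal c"
    "(\<integral>\<^sup>+\<omega>. ennreal (g.bregman (\<omega> 0) (\<omega> T)) \<partial>P) \<le> ennreal c"
    using bregman_expectation_le[OF kappa_concave difference_finite] by blast
  note tame_e = tame_expectation[OF c(3,1)]
  note tame_p = tame_payoff_le[OF tame_e(1)]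
  let ?k = "\<lambda>\<omega> :: path. (phi (\<omega> 0) - kap (\<omega> 0)) + (psi (\<omega> T) + kap (\<omega> T))"
  define b where "b m = (LINT \<omega>|P. one m (\<omega> 0) * ?k \<omega>)" for m
  have ki: "integrable P ?k" using moderated_start(1) moderated_end(1) by (rule Bochner_Integration.integrable_add)
  have B: "(LINT \<omega>|P. ?k \<omega>) = (LINT x|\<mu>. phi x - kap x) + (LINT x|\<nu>. psi x + kap x)"
    using Bochner_Integration.integral_add[OF moderated_start(1) moderated_end(1)]
    unfolding moderated_start(2) moderated_end(2) .
  have lim: "b \<longlonglongrightarrow> (LINT \<omega>|P. ?k \<omega>)"
    unfolding b_def
  proof (rule integral_dominated_convergence[where w = "\<lambda>\<omega>. \<bar>?k \<omega>\<bar>"])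
    show "AE \<omega> in P. (\<lambda>m. one m (\<omega> 0) * ?k \<omega>) \<longlonglongrightarrow> ?k \<omega>"
      using tendsto_mult[OF tame_tendsto tendsto_const] by (intro AE_I2) fastforce
    show "(\<lambda>\<omega>. one m (\<omega> 0) * ?k \<omega>) \<in> borel_measurable P" for m
      using integrable_one_mult[OF ki] by auto
    show "AE \<omega> in P. norm (one m (\<omega> 0) * ?k \<omega>) \<le> \<bar>?k \<omega>\<bar>" for m by (auto simp: indicator_def)
  qed (use ki in auto)
  have lim_c: "(\<lambda>m. b m + c) \<longlonglongrightarrow> (LINT \<omega>|P. ?k \<omega>) + c" by (intro tendsto_intros lim)
  have le: "(LINT \<omega>|P. one m (\<omega> 0) * (phi (\<omega> 0) + psi (\<omega> T))) \<le> b m + c" for m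
    unfolding b_def by (rule tame_e(2))
  have "0 \<le> b m + c" for m using tame_p(2)[of m] le[of m] by linarith
  then have nn: "0 \<le> (LINT \<omega>|P. ?k \<omega>) + c" by (intro LIMSEQ_le_const[OF lim_c]) auto
  have "(\<integral>\<^sup>+\<omega>. ennreal (hedge_payoff \<omega>) \<partial>P) = (\<integral>\<^sup>+\<omega>. liminf (\<lambda>m. ennreal (one m (\<omega> 0) * hedge_payoff \<omega>)) \<partial>P)"
  proof (rule nn_integral_cong)
    fix \<omega>
    have "(\<lambda>m. one m (\<omega> 0) * hedge_payoff \<omega>) \<longlonglongrightarrow> 1 * hedge_payoff \<omega>" by (intro tendsto_mult tame_tendsto tendsto_const)
    then have "(\<lambda>m. ennreal (one m (\<omega> 0) * hedge_payoff \<omega>)) \<longlonglongrightarrow> ennreal (1 * hedge_payoff \<omega>)" by (rule tendsto_ennrealI)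
    then have "liminf (\<lambda>m. ennreal (one m (\<omega> 0) * hedge_payoff \<omega>)) = ennreal (1 * hedge_payoff \<omega>)"
      by (intro lim_imp_Liminf) simp_all
    then show "ennreal (hedge_payoff \<omega>) = liminf (\<lambda>m. ennreal (one m (\<omega> 0) * hedge_payoff \<omega>))" by simp
  qed
  also have "\<dots> \<le> liminf (\<lambda>m. \<integral>\<^sup>+\<omega>. ennreal (one m (\<omega> 0) * hedge_payoff \<omega>) \<partial>P)"
  proof (rule nn_integral_liminf)
    fix m
    have "(\<lambda>\<omega>. one m (\<omega> 0)) \<in> borel_measurable P"
      by (rule measurable_compose[OF measurable_coordinate[OF times_in(1)]]) simp
    then show "(\<lambda>\<omega>. ennreal (one m (\<omega> 0) * hedge_payoff \<omega>)) \<in> borel_measurable P"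
      using hedge_payoff_measurable by simp
  qed
  also have "\<dots> \<le> liminf (\<lambda>m. ennreal (b m + c))"
  proof (rule Liminf_mono, rule always_eventually, rule allI)
    fix m
    have "(\<integral>\<^sup>+\<omega>. ennreal (one m (\<omega> 0) * hedge_payoff \<omega>) \<partial>P) \<le>
        ennreal (LINT \<omega>|P. one m (\<omega> 0) * (phi (\<omega> 0) + psi (\<omega> T)))" by (rule tame_p(1))
    also have "\<dots> \<le> ennreal (b m + c)" by (rule ennreal_leI[OF le])
    finally show "(\<integral>\<^sup>+\<omega>. ennreal (one m (\<omega> 0) * hedge_payoff \<omega>) \<partial>P) \<le> ennreal (b m + c)" .
  qed
  also have "\<dots> = ennreal ((LINT \<omega>|P. ?k \<omega>) + c)"
    by (rule lim_imp_Liminf[OF sequentially_bot tendsto_ennrealI[OF lim_c]])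
  finally show thesis using that[OF c(2)] nn unfolding B by simp
qed

end

section \<open>The superhedge\<close>

lemma eintegrable_restrict_real:
  fixes k :: "real \<Rightarrow> real" and e :: "real \<Rightarrow> ereal"
  assumes sets: "sets \<theta> = sets borel" and S: "S \<in> sets borel"
    and on: "\<And>x. x \<in> S \<Longrightarrow> e x = ereal (k x)" and off: "\<And>x. x \<notin> S \<Longrightarrow> k x = 0"
    and e: "eintegrable (restrict_space \<theta> S) e"
  shows "integrable \<theta> k" and "eintegral (restrict_space \<theta> S) e = ereal (LINT x|\<theta>. k x)"
proof -
  have sp: "space (restrict_space \<theta> S) = S"
    using sets_eq_imp_space_eq[OF sets] by (simp add: space_restrict_space)
  have S': "S \<inter> space \<theta> \<in> sets \<theta>" using S sets sets_eq_imp_space_eq[OF sets] by simp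
  have "(\<lambda>x. real_of_ereal (e x)) \<in> borel_measurable (restrict_space \<theta> S)"
    using e by (intro borel_measurable_real_of_ereal) (simp add: eintegrable_def)
  then have km: "k \<in> borel_measurable (restrict_space \<theta> S)"
    by (rule measurable_cong[THEN iffD1, rotated]) (simp add: sp on)
  have "(\<integral>\<^sup>+x. ennreal (norm (k x)) \<partial>restrict_space \<theta> S) = (\<integral>\<^sup>+x. e2ennreal \<bar>e x\<bar> \<partial>restrict_space \<theta> S)"
    by (intro nn_integral_cong) (simp add: sp on e2ennreal_ereal)
  also have "\<dots> < \<infinity>" using e by (simp add: eintegrable_def)
  finally have ki: "integrable (restrict_space \<theta> S) k" by (rule integrableI_bounded[OF km])
  have ind: "indicator S x *\<^sub>R k x = k x" for x using off by (cases "x \<in> S") auto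
  show "integrable \<theta> k"
    using ki unfolding integrable_restrict_space[OF S'] set_integrable_def ind .
  have "eintegral (restrict_space \<theta> S) e = eintegral (restrict_space \<theta> S) (\<lambda>x. ereal (k x))"
    unfolding eintegral_def by (intro arg_cong2[where f = minus] arg_cong[where f = enn2ereal] nn_integral_cong) (simp_all add: sp on)
  also have "\<dots> = ereal (LINT x|restrict_space \<theta> S. k x)" by (rule eintegral_ereal[OF ki])
  also have "(LINT x|restrict_space \<theta> S. k x) = (LINT x|\<theta>. k x)"
    unfolding integral_restrict_space[OF S'] set_lebesgue_integral_def ind ..
  finally show "eintegral (restrict_space \<theta> S) e = ereal (LINT x|\<theta>. k x)" .
qed

lemma measurable_fst_pair: "(fst :: real \<times> real \<Rightarrow> real) \<in> borel_measurable borel"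
  and measurable_snd_pair: "(snd :: real \<times> real \<Rightarrow> real) \<in> borel_measurable borel"
  by (intro borel_measurable_continuous_onI continuous_intros)+

lemma hat_filtration_coordinate:
  assumes "s \<in> {0..t}"
  shows "(\<lambda>w. fst w s) \<in> borel_measurable (hat_filtration T t)"
    and "(\<lambda>w. snd w s) \<in> borel_measurable (hat_filtration T t)"
proof -
  have "(\<lambda>w. (\<lambda>(\<omega>, a) t. (\<omega> t, a t)) w s) \<in> borel_measurable (hat_filtration T t)"
    unfolding hat_filtration_def by (rule raw_filtration_coordinate[OF assms])
  from measurable_compose[OF this measurable_fst_pair] measurable_compose[OF this measurable_snd_pair]
  show "(\<lambda>w. fst w s) \<in> borel_measurable (hat_filtration T t)"
    "(\<lambda>w. snd w s) \<in> borel_measurable (hat_filtration T t)"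
    by (simp_all add: split_beta')
qed

lemma space_hat_filtration [simp]: "space (hat_filtration T t) = hat_space T"
  by (simp add: hat_filtration_def)

locale dual_hedge = irreducible_measures \<mu> \<nu> + hedge_functions "domain_I \<mu> \<nu>" "domain_J \<mu> \<nu>" phi psi phi' psi'
  for \<mu> \<nu> phi psi phi' psi' +
  fixes T :: real and \<phi> \<psi> :: "real \<Rightarrow> ereal" and h :: "path \<times> path \<Rightarrow> real \<Rightarrow> real"
  assumes T_pos: "0 < T"
    and phi_eq: "\<And>x. x \<in> J \<Longrightarrow> \<phi> x = ereal (phi x)" and psi_eq: "\<And>x. x \<in> J \<Longrightarrow> \<psi> x = ereal (psi x)"
    and phi_off: "\<And>x. x \<notin> J \<Longrightarrow> phi x = 0" and psi_off: "\<And>x. x \<notin> J \<Longrightarrow> psi x = 0"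
    and phi_m: "phi \<in> borel_measurable borel" and psi_m: "psi \<in> borel_measurable borel"
    and nonneg: "\<And>x. x \<in> J \<Longrightarrow> 0 \<le> phi x + psi x"
    and h0: "\<And>\<omega> a. (\<omega>, a) \<in> hat_space T \<Longrightarrow> h (\<omega>, a) 0 = phi' (\<omega> 0) * (1 - a 0) - psi' (\<omega> 0) * a 0"
    and ht: "\<And>\<omega> a t. (\<omega>, a) \<in> hat_space T \<Longrightarrow> t \<in> {0<..T} \<Longrightarrow> h (\<omega>, a) t = - phi' (\<omega> 0) - psi' (\<omega> t)"
begin

text \<open>Both filtrations make the position measurable for the same reason: it is a Borel function of
  the path at the times \<open>0\<close> and \<open>t\<close> and of the averaging path at time \<open>0\<close>.\<close>

lemma position_measurable:
  assumes t: "t \<in> {0..T}" and H: "\<And>w. w \<in> space F \<Longrightarrow> (U w, V w) \<in> hat_space T"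
    and m: "(\<lambda>w. U w 0) \<in> borel_measurable F" "(\<lambda>w. U w t) \<in> borel_measurable F"
      "(\<lambda>w. V w 0) \<in> borel_measurable F"
  shows "(\<lambda>w. h (U w, V w) t) \<in> borel_measurable F"
proof (cases "t = 0")
  case True
  have "(\<lambda>w. phi' (U w 0) * (1 - V w 0) - psi' (U w 0) * V w 0) \<in> borel_measurable F"
    using m measurable_compose[OF m(1) phi'_measurable] measurable_compose[OF m(1) psi'_measurable] by simp
  then show ?thesis
    by (rule measurable_cong[THEN iffD1, rotated]) (simp add: True h0[OF H])
next
  case False
  have "(\<lambda>w. - phi' (U w 0) - psi' (U w t)) \<in> borel_measurable F"
    using measurable_compose[OF m(1) phi'_measurable] measurable_compose[OF m(2) psi'_measurable] by simp
  then show ?thesis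
    by (rule measurable_cong[THEN iffD1, rotated]) (use t False in \<open>simp add: ht[OF H]\<close>)
qed

lemma adapted_hat: "adapted T (hat_filtration T) h" "adapted T (hat_filtration T) (\<lambda>(\<omega>, a). a)"
proof -
  have "(\<lambda>w. h (fst w, snd w) t) \<in> borel_measurable (hat_filtration T t)" if t: "t \<in> {0..T}" for t
    by (rule position_measurable[OF t]) (use t in \<open>auto intro!: hat_filtration_coordinate\<close>)
  then show "adapted T (hat_filtration T) h" by (simp add: adapted_def)
  show "adapted T (hat_filtration T) (\<lambda>(\<omega>, a). a)"
    using hat_filtration_coordinate(2)[of _ _ T] by (auto simp: adapted_def split_beta')
qed

lemma averaging_hat:
  assumes "A \<in> averaging_processes T" "\<omega> \<in> cadlag_paths T"
  shows "(\<omega>, A \<omega>) \<in> hat_space T" "averaging_path T (A \<omega>)"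
  using assms T_pos by (auto simp: hat_space_def averaging_processes_def averaging_path_def)

lemma hedge_path_A:
  assumes A: "A \<in> averaging_processes T" and \<omega>: "\<omega> \<in> relevant_paths T I J"
  shows "hedge_path I J phi psi phi' psi' T (A \<omega>) \<omega>" "\<omega> \<in> cadlag_paths T"
proof -
  show c: "\<omega> \<in> cadlag_paths T" using \<omega> by (simp add: relevant_paths_def)
  show "hedge_path I J phi psi phi' psi' T (A \<omega>) \<omega>"
    by (intro hedge_path.intro hedge_path_axioms.intro hedge_functions_axioms averaging_hat[OF A c] \<omega>)
qed

lemma pathwise_integrands_A:
  assumes A: "A \<in> averaging_processes T"
  shows "(along h A, along (\<lambda>(\<omega>, a). a) A) \<in> pathwise_integrands T (relevant_paths T I J)"
  unfolding pathwise_integrands_def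
proof (intro CollectI case_prodI conjI ballI)
  have al: "along (\<lambda>(\<omega>, a). a) A = A" by (simp add: along_def fun_eq_iff)
  have A_adapted: "(\<lambda>\<omega>. A \<omega> t) \<in> borel_measurable (path_filtration T t)" if "t \<in> {0..T}" for t
    using A that by (auto simp: averaging_processes_def adapted_def)
  show "adapted T (path_filtration T) (along (\<lambda>(\<omega>, a). a) A)"
    unfolding al using A by (simp add: averaging_processes_def)
  show "adapted T (path_filtration T) (along h A)"
    unfolding adapted_def along_def
  proof
    fix t assume t: "t \<in> {0..T}"
    show "(\<lambda>\<omega>. h (\<omega>, A \<omega>) t) \<in> borel_measurable (path_filtration T t)"
    proof (rule position_measurable[OF t])
      show "(\<omega>, A \<omega>) \<in> hat_space T" if "\<omega> \<in> space (path_filtration T t)" for \<omega>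
        using averaging_hat(1)[OF A] that by simp
      show "(\<lambda>\<omega>. A \<omega> 0) \<in> borel_measurable (path_filtration T t)"
        using path_filtration_mono[OF _ A_adapted[of 0]] t by auto
    qed (use t in \<open>auto intro: path_filtration_coordinate\<close>)
  qed
  fix \<omega> :: path
  show "cadlag_on T (along (\<lambda>(\<omega>, a). a) A \<omega>)" "finite_variation T (along (\<lambda>(\<omega>, a). a) A \<omega>)"
    if "\<omega> \<in> cadlag_paths T"
    unfolding al using averaging_path.a_cadlag averaging_path.finite_variation_a averaging_hat(2)[OF A that] by auto
  show "stieltjes_integrable T (along (\<lambda>(\<omega>, a). a) A \<omega>) (\<lambda>t. (\<omega> T - \<omega> t) * along h A \<omega> t)"
    if \<omega>: "\<omega> \<in> relevant_paths T I J"
  proof -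
    interpret hp: hedge_path I J phi psi phi' psi' T "A \<omega>" \<omega> by (rule hedge_path_A(1)[OF A \<omega>])
    note hat = averaging_hat(1)[OF A hedge_path_A(2)[OF A \<omega>]]
    show ?thesis unfolding al along_def
      by (rule hp.hedge_stieltjes_integrable) (use h0[OF hat] ht[OF hat] in auto)
  qed
qed

lemma payoff_relevant:
  assumes A: "A \<in> averaging_processes T" and \<omega>: "\<omega> \<in> relevant_paths T I J"
  shows "payoff T (\<phi>, \<psi>, (h, \<lambda>(\<omega>, a). a)) A \<omega> = ereal (phi (\<omega> 0) + psi (\<omega> T) +
      (phi' (\<omega> 0) * (path_average T (A \<omega>) \<omega> - \<omega> 0) - hedge_path.cost psi' T (A \<omega>) \<omega>))"
    and "\<phi> (path_average T (A \<omega>) \<omega>) + \<psi> (path_average T (A \<omega>) \<omega>) \<le> payoff T (\<phi>, \<psi>, (h, \<lambda>(\<omega>, a). a)) A \<omega>"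
    and "path_average T (A \<omega>) \<omega> \<in> J"
proof -
  interpret hp: hedge_path I J phi psi phi' psi' T "A \<omega>" \<omega> by (rule hedge_path_A(1)[OF A \<omega>])
  note hat = averaging_hat(1)[OF A hedge_path_A(2)[OF A \<omega>]]
  note hh = h0[OF hat] ht[OF hat]
  have J: "\<omega> 0 \<in> J" using hp.start_I I_subset_J by auto
  have "payoff T (\<phi>, \<psi>, (h, \<lambda>(\<omega>, a). a)) A \<omega> = ereal (phi (\<omega> 0) + psi (\<omega> T) +
      ((\<omega> T - \<omega> 0) * h (\<omega>, A \<omega>) 0 + stieltjes_integral T (A \<omega>) (\<lambda>t. (\<omega> T - \<omega> t) * h (\<omega>, A \<omega>) t)))"
    using phi_eq[OF J] psi_eq[OF hp.end_J] by (simp add: payoff_def pathwise_gain_def along_def)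
  also note hp.hedge_gain[of "h (\<omega>, A \<omega>)", OF hh]
  finally show pay: "payoff T (\<phi>, \<psi>, (h, \<lambda>(\<omega>, a). a)) A \<omega> = ereal (phi (\<omega> 0) + psi (\<omega> T) +
      (phi' (\<omega> 0) * (hp.avg - \<omega> 0) - hp.cost))" .
  show "hp.avg \<in> J" by (rule hp.avg_in_J)
  show "\<phi> hp.avg + \<psi> hp.avg \<le> payoff T (\<phi>, \<psi>, (h, \<lambda>(\<omega>, a). a)) A \<omega>"
    unfolding pay phi_eq[OF hp.avg_in_J] psi_eq[OF hp.avg_in_J]
    using hp.psi_avg_le super[OF hp.start_I hp.avg_in_J] by simp
qed

text \<open>Off the relevant paths the payoff is replaced by \<open>0\<close>. The exceptional set is null, but only the
  completion of \<open>P\<close> knows that it is measurable.\<close>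

lemma moderated_expectation:
  assumes A: "A \<in> averaging_processes T" and P: "P \<in> martingale_measures T \<mu> \<nu>"
    and mod: "concave_moderator J \<mu> \<nu> \<phi> \<psi> \<kappa>" and fin: "concave_difference I J \<mu> \<nu> \<kappa> \<noteq> \<infinity>"
  defines "Z \<equiv> \<lambda>\<omega>. if \<omega> \<in> relevant_paths T I J then payoff T (\<phi>, \<psi>, (h, \<lambda>(\<omega>, a). a)) A \<omega> else 0"
  shows "Z \<in> borel_measurable (completion P)"
    and "eintegral (completion P) Z \<le> eintegral (restrict_space \<mu> J) (\<lambda>x. \<phi> x - ereal (\<kappa> x)) +
      eintegral (restrict_space \<nu> J) (\<lambda>x. \<psi> x + ereal (\<kappa> x)) + concave_difference I J \<mu> \<nu> \<kappa>"
proof -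
  let ?k = "\<lambda>x. indicator J x * \<kappa> x"
  have mu: "eintegrable (restrict_space \<mu> J) (\<lambda>x. \<phi> x - ereal (\<kappa> x))"
    and nu: "eintegrable (restrict_space \<nu> J) (\<lambda>x. \<psi> x + ereal (\<kappa> x))"
    and conc: "concave_on J \<kappa>"
    using mod by (auto simp: concave_moderator_def)
  note mu_r = eintegrable_restrict_real[OF sets_mu borel_J _ _ mu, of "\<lambda>x. phi x - ?k x"]
  note nu_r = eintegrable_restrict_real[OF sets_nu borel_J _ _ nu, of "\<lambda>x. psi x + ?k x"]
  have mu_i: "integrable \<mu> (\<lambda>x. phi x - ?k x)"
    and mu_e: "eintegral (restrict_space \<mu> J) (\<lambda>x. \<phi> x - ereal (\<kappa> x)) = ereal (LINT x|\<mu>. phi x - ?k x)"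
    using mu_r by (simp_all add: phi_eq phi_off)
  have nu_i: "integrable \<nu> (\<lambda>x. psi x + ?k x)"
    and nu_e: "eintegral (restrict_space \<nu> J) (\<lambda>x. \<psi> x + ereal (\<kappa> x)) = ereal (LINT x|\<nu>. psi x + ?k x)"
    using nu_r by (simp_all add: psi_eq psi_off)
  have "(\<lambda>x. phi x - ?k x) \<in> borel_measurable borel"
    using mu_i measurable_cong_sets[OF sets_mu refl, of "borel :: real measure"] by auto
  from borel_measurable_diff[OF phi_m this] have "(\<lambda>x. phi x - (phi x - ?k x)) \<in> borel_measurable borel" .
  moreover have "phi x - (phi x - ?k x) = ?k x" for x by simp
  ultimately have kappa_m: "\<kappa> \<in> borel_measurable (restrict_space borel J)"
    unfolding borel_measurable_restrict_indicator[OF borel_J] by (simp only:)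
  have spP: "space P = cadlag_paths T"
  proof -
    have "sets P = sets (path_borel T)" using P by (simp add: martingale_measures_def)
    then have "space P = space (path_borel T)" by (rule sets_eq_imp_space_eq)
    then show ?thesis by (simp add: path_borel_def space_measure_of_conv)
  qed
  have mm: "finite_measure P" "is_martingale T (path_filtration T) P (\<lambda>\<omega>. \<omega>)"
    "distr P borel (\<lambda>\<omega>. \<omega> 0) = \<mu>" "distr P borel (\<lambda>\<omega>. \<omega> T) = \<nu>"
    using P by (simp_all add: martingale_measures_def)
  interpret finite_measure P by (rule mm(1))
  interpret ht: hedged_transport \<mu> \<nu> T P A phi psi phi' psi' \<kappa>
    by unfold_locales
      (rule T_pos mm spP A nonneg phi_m psi_m kappa_m conc mu_i nu_i fin; assumption)+
  have Z_eq: "Z \<omega> = ereal (ht.hedge_payoff \<omega>)" if "\<omega> \<in> relevant_paths T I J" for \<omega>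
    using payoff_relevant(1)[OF A that] ht.spot_integral(3)[OF that] that by (simp add: Z_def)
  have Z_if: "Z = (\<lambda>\<omega>. if \<omega> \<notin> relevant_paths T I J then 0 else ereal (ht.hedge_payoff \<omega>))"
    using Z_eq by (auto simp: Z_def fun_eq_iff)
  have pred: "Measurable.pred (completion P) (\<lambda>\<omega>. \<omega> \<notin> relevant_paths T I J)"
    by (rule sets_completion_AE) (use ht.AE_relevant in simp)
  show "Z \<in> borel_measurable (completion P)"
    unfolding Z_if
    by (intro measurable_If measurable_completion borel_measurable_ereal ht.hedge_payoff_measurable)
      (use pred in \<open>auto simp: pred_def\<close>)
  have Z_nonneg: "0 \<le> Z \<omega>" for \<omega>
    using Z_eq ht.spot_integral(4) by (cases "\<omega> \<in> relevant_paths T I J") (auto simp: Z_def)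
  have pos: "(\<integral>\<^sup>+\<omega>. e2ennreal (Z \<omega>) \<partial>completion P) = (\<integral>\<^sup>+\<omega>. ennreal (ht.hedge_payoff \<omega>) \<partial>P)"
    unfolding nn_integral_completion
  proof (rule nn_integral_cong_AE)
    show "AE \<omega> in P. e2ennreal (Z \<omega>) = ennreal (ht.hedge_payoff \<omega>)"
      using ht.AE_relevant by eventually_elim (simp add: Z_eq e2ennreal_ereal)
  qed
  have neg: "(\<integral>\<^sup>+\<omega>. e2ennreal (- Z \<omega>) \<partial>completion P) = 0"
    using Z_nonneg by (simp add: e2ennreal_neg)
  obtain c where c: "concave_difference I J \<mu> \<nu> \<kappa> = ereal c"
    "0 \<le> (LINT x|\<mu>. phi x - ht.kap x) + (LINT x|\<nu>. psi x + ht.kap x) + c"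
    "(\<integral>\<^sup>+\<omega>. ennreal (ht.hedge_payoff \<omega>) \<partial>P) \<le>
      ennreal ((LINT x|\<mu>. phi x - ht.kap x) + (LINT x|\<nu>. psi x + ht.kap x) + c)"
    using ht.expected_payoff_le by blast
  have "eintegral (completion P) Z = enn2ereal (\<integral>\<^sup>+\<omega>. ennreal (ht.hedge_payoff \<omega>) \<partial>P)"
    by (simp add: eintegral_def pos neg zero_ennreal.rep_eq)
  also have "\<dots> \<le> enn2ereal (ennreal ((LINT x|\<mu>. phi x - ht.kap x) + (LINT x|\<nu>. psi x + ht.kap x) + c))"
    using c(3) by (simp only: less_eq_ennreal.rep_eq)
  also have "\<dots> = ereal ((LINT x|\<mu>. phi x - ?k x) + (LINT x|\<nu>. psi x + ?k x) + c)"
    using c(2) by (simp only: enn2ereal_ennreal ht.kap_def)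
  finally show "eintegral (completion P) Z \<le> eintegral (restrict_space \<mu> J) (\<lambda>x. \<phi> x - ereal (\<kappa> x)) +
      eintegral (restrict_space \<nu> J) (\<lambda>x. \<psi> x + ereal (\<kappa> x)) + concave_difference I J \<mu> \<nu> \<kappa>"
    by (simp add: mu_e nu_e c(1))
qed

text \<open>The generalized integral is evaluated at one fixed moderator \<open>\<kappa>\<close>, for which \<open>(\<mu> - \<nu>)(\<kappa>)\<close> might be
  infinite. Measurability of the payoff is therefore taken from another moderator \<open>\<kappa>0\<close>, one with a
  finite difference.\<close>

lemma superhedge:
  assumes Lc: "(\<phi>, \<psi>) \<in> Lc I J \<mu> \<nu>" and f: "\<And>x. x \<in> J \<Longrightarrow> f x \<le> \<phi> x + \<psi> x"
    and \<A>: "\<A> \<subseteq> averaging_processes T"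
  shows "(\<phi>, \<psi>, (h, \<lambda>(\<omega>, a). a)) \<in> superhedges T \<mu> \<nu> f \<A>"
  unfolding superhedges_def
proof (intro CollectI case_prodI conjI ballI)
  show "(\<phi>, \<psi>, (h, \<lambda>(\<omega>, a). a)) \<in> semistatic_strategies T \<mu> \<nu>"
    unfolding semistatic_strategies_def using Lc adapted_hat pathwise_integrands_A by simp
next
  fix A \<omega> assume A: "A \<in> \<A>" and \<omega>: "\<omega> \<in> relevant_paths T I J"
  then have A': "A \<in> averaging_processes T" using \<A> by auto
  show "f (path_average T (A \<omega>) \<omega>) \<le> payoff T (\<phi>, \<psi>, (h, \<lambda>(\<omega>, a). a)) A \<omega>"
    using f[OF payoff_relevant(3)[OF A' \<omega>]] payoff_relevant(2)[OF A' \<omega>] by (rule order_trans)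
next
  fix A P assume A: "A \<in> \<A>" and P: "P \<in> martingale_measures T \<mu> \<nu>"
  then have A': "A \<in> averaging_processes T" using \<A> by auto
  note me = moderated_expectation[OF A' P]
  obtain \<kappa>0 where \<kappa>0: "concave_moderator J \<mu> \<nu> \<phi> \<psi> \<kappa>0" "concave_difference I J \<mu> \<nu> \<kappa>0 < \<infinity>"
    using Lc by (auto simp: Lc_def)
  define \<kappa> where "\<kappa> = (SOME \<kappa>. concave_moderator J \<mu> \<nu> \<phi> \<psi> \<kappa>)"
  have \<kappa>: "concave_moderator J \<mu> \<nu> \<phi> \<psi> \<kappa>" unfolding \<kappa>_def by (rule someI[of "concave_moderator J \<mu> \<nu> \<phi> \<psi>", OF \<kappa>0(1)])
  have gi: "generalized_integral I J \<mu> \<nu> \<phi> \<psi> =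
      eintegral (restrict_space \<mu> J) (\<lambda>x. \<phi> x - ereal (\<kappa> x)) +
      eintegral (restrict_space \<nu> J) (\<lambda>x. \<psi> x + ereal (\<kappa> x)) + concave_difference I J \<mu> \<nu> \<kappa>"
    by (simp add: generalized_integral_def \<kappa>_def Let_def)
  let ?Z = "\<lambda>\<omega>. if \<omega> \<in> relevant_paths T I J then payoff T (\<phi>, \<psi>, (h, \<lambda>(\<omega>, a). a)) A \<omega> else 0"
  have meas: "?Z \<in> borel_measurable (completion P)" using me(1)[OF \<kappa>0(1)] \<kappa>0(2) by simp
  have "eintegral (completion P) ?Z \<le> generalized_integral I J \<mu> \<nu> \<phi> \<psi>"
  proof (cases "concave_difference I J \<mu> \<nu> \<kappa> = \<infinity>")
    case True
    have "eintegrable (restrict_space \<mu> J) (\<lambda>x. \<phi> x - ereal (\<kappa> x))"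
      "eintegrable (restrict_space \<nu> J) (\<lambda>x. \<psi> x + ereal (\<kappa> x))"
      using \<kappa> by (auto simp: concave_moderator_def)
    then have "eintegral (restrict_space \<mu> J) (\<lambda>x. \<phi> x - ereal (\<kappa> x)) \<noteq> - \<infinity>"
      "eintegral (restrict_space \<nu> J) (\<lambda>x. \<psi> x + ereal (\<kappa> x)) \<noteq> - \<infinity>"
      using eintegrable_restrict_real(2)[OF sets_mu borel_J, of _ "\<lambda>x. phi x - indicator J x * \<kappa> x"]
        eintegrable_restrict_real(2)[OF sets_nu borel_J, of _ "\<lambda>x. psi x + indicator J x * \<kappa> x"]
      by (simp_all add: phi_eq phi_off psi_eq psi_off)
    then have "generalized_integral I J \<mu> \<nu> \<phi> \<psi> = \<infinity>" unfolding gi True by simp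
    then show ?thesis by simp
  next
    case False
    then show ?thesis unfolding gi by (rule me(2)[OF \<kappa>])
  qed
  with meas show "let Z = ?Z in Z \<in> borel_measurable (completion P) \<and>
      eintegral (completion P) Z \<le> generalized_integral I J \<mu> \<nu> \<phi> \<psi>"
    by (simp add: Let_def)
qed

end

theorem proposition4p7:
  fixes T :: real and \<mu> \<nu> :: "real measure"
    and f \<phi> \<psi> :: "real \<Rightarrow> ereal" and \<phi>' \<psi>' :: "real \<Rightarrow> real"
    and h :: "path \<times> path \<Rightarrow> real \<Rightarrow> real" and \<A> :: "(path \<Rightarrow> path) set"
  assumes "T > 0"
    and "admissible_measure \<mu>" and "admissible_measure \<nu>"
    and "irreducible_pair \<mu> \<nu>"
    and "f \<in> borel_measurable borel" and "\<And>x. f x \<ge> 0"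
    and "(\<phi>, \<psi>) \<in> dual_aux \<mu> \<nu> f"
    and "superderivative (domain_I \<mu> \<nu>) (domain_J \<mu> \<nu>) \<phi> \<phi>'"
    and "subderivative (domain_I \<mu> \<nu>) (domain_J \<mu> \<nu>) \<psi> \<psi>'"
    and "\<And>x. x \<notin> domain_I \<mu> \<nu> \<Longrightarrow> \<phi>' x = 0 \<and> \<psi>' x = 0"
    and "\<And>\<omega> a. (\<omega>, a) \<in> hat_space T \<Longrightarrow>
           h (\<omega>, a) 0 = \<phi>' (\<omega> 0) * (1 - a 0) - \<psi>' (\<omega> 0) * a 0"
    and "\<And>\<omega> a t. (\<omega>, a) \<in> hat_space T \<Longrightarrow> t \<in> {0<..T} \<Longrightarrow>
           h (\<omega>, a) t = - \<phi>' (\<omega> 0) - \<psi>' (\<omega> t)"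
    and "\<A> \<subseteq> averaging_processes T" and "\<A> \<noteq> {}"
  shows "(\<phi>, \<psi>, (h, \<lambda>(\<omega>, a). a)) \<in> superhedges T \<mu> \<nu> f \<A>"
proof -
  interpret irreducible_measures \<mu> \<nu> by unfold_locales (use assms in auto)
  define phi where "phi x = indicator J x * real_of_ereal (\<phi> x)" for x
  define psi where "psi x = indicator J x * real_of_ereal (\<psi> x)" for x
  note fin = dual_aux_finite[OF assms(7,6)]
  have phi_eq: "\<phi> x = ereal (phi x)" and psi_eq: "\<psi> x = ereal (psi x)" if "x \<in> J" for x
    using fin[OF that] that by (simp_all add: phi_def psi_def ereal_real')
  have Lc: "(\<phi>, \<psi>) \<in> Lc I J \<mu> \<nu>" and f_le: "\<And>x. x \<in> J \<Longrightarrow> f x \<le> \<phi> x + \<psi> x"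
    using assms(7) by (auto simp: dual_aux_def)
  have "\<phi> \<in> borel_measurable (restrict_space borel J)" "\<psi> \<in> borel_measurable (restrict_space borel J)"
    using Lc by (auto simp: Lc_def concave_moderator_def)
  then have "(\<lambda>x. real_of_ereal (\<phi> x)) \<in> borel_measurable (restrict_space borel J)"
    "(\<lambda>x. real_of_ereal (\<psi> x)) \<in> borel_measurable (restrict_space borel J)" by auto
  then have phi_m: "phi \<in> borel_measurable borel" and psi_m: "psi \<in> borel_measurable borel"
    unfolding borel_measurable_restrict_indicator[OF borel_J] phi_def[abs_def] psi_def[abs_def] by auto
  have ind: "indicator I x * \<phi>' x = \<phi>' x" "indicator I x * \<psi>' x = \<psi>' x" for x
    using assms(10)[of x] by (auto simp: indicator_def)
  have "(\<lambda>x. - \<phi>' x) \<in> borel_measurable (restrict_space borel I)" "\<psi>' \<in> borel_measurable (restrict_space borel I)"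
    using assms(8,9) by (auto simp: superderivative_def subderivative_def)
  then have deriv_m: "\<phi>' \<in> borel_measurable borel" "\<psi>' \<in> borel_measurable borel"
    using borel_measurable_restrict_indicator[OF borel_I, of \<phi>'] borel_measurable_restrict_indicator[OF borel_I, of \<psi>']
    by (simp_all add: ind)
  have super: "phi y \<le> phi x + \<phi>' x * (y - x)" if "x \<in> I" "y \<in> J" for x y
  proof -
    have "x \<in> J" using that I_subset_J by auto
    moreover have "ereal (- \<phi>' x * (y - x)) \<le> - \<phi> y - - \<phi> x"
      using assms(8) that unfolding superderivative_def subderivative_def by blast
    ultimately show ?thesis using that by (simp add: phi_eq)
  qed
  have sub: "psi x + \<psi>' x * (y - x) \<le> psi y" if "x \<in> I" "y \<in> J" for x y
  proof -
    have "x \<in> J" using that I_subset_J by auto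
    moreover have "ereal (\<psi>' x * (y - x)) \<le> \<psi> y - \<psi> x"
      using assms(9) that unfolding subderivative_def by blast
    ultimately show ?thesis using that by (simp add: psi_eq)
  qed
  have nonneg: "0 \<le> phi x + psi x" if "x \<in> J" for x
    using order_trans[OF assms(6) f_le[OF that]] by (simp add: phi_eq[OF that] psi_eq[OF that])
  have off: "phi x = 0" "psi x = 0" if "x \<notin> J" for x using that by (simp_all add: phi_def psi_def)
  interpret dual_hedge \<mu> \<nu> phi psi \<phi>' \<psi>' T \<phi> \<psi> h
    by unfold_locales
      (rule super sub assms(10) deriv_m assms(1) phi_eq psi_eq off phi_m psi_m nonneg assms(11,12); assumption)+
  show ?thesis by (rule superhedge[OF Lc f_le assms(13)])
qed

end
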